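(* Let $M$ be a manifold and let $(M_\alpha)_{\alpha\in A}$ be a directed family of manifolds such that $M=\bigcup_{\alpha\in A}M_\alpha$ and all inclusion maps $M_\alpha\to M$ (for $\alpha\in A$) and $M_\alpha\to M_\beta$ (for $\alpha\le\beta$) are continuous. Assume that $M$ admits weak direct limit charts, i.e., each point of $M$ is contained in the domain of a weak direct limit chart of $M=\bigcup_{\alpha\in A}M_\alpha$. Then $$\pi_k(M,p)=\varinjlim_{\alpha\in A_p}\pi_k(M_\alpha,p)\quad\text{for all } k\in\mathbb{N}_0 \text{ and } p\in M,$$ where $A_p:=\{\alpha\in A: p\in M_\alpha\}$.
   Context: All topological spaces are Hausdorff, $\mathbb{N}_0=\{0,1,2,\dots\}$. Topological vector spaces are real and need not be locally convex. A directed family $(X_\alpha)_{\alpha\in A}$ is a family of sets indexed by a directed set $(A,\le)$ with $X_\alpha\subseteq X_\beta$ whenever $\alpha\le\beta$. A manifold is a (Hausdorff) topological space $M$ such that each $p\in M$ has an open neighbourhood $U$ for which there is a homeomorphism ("chart") $\phi:U\to V$ onto an open subset $V$ of some topological vector space (which may depend on $p$). The inclusion maps between the manifolds considered are continuous but need not be embeddings. A weak direct limit chart of $M=\bigcup_{\alpha\in A}M_\alpha$ is a chart $\phi:U\to V$ of $M$, taking the open set $U\subseteq M$ homeomorphically onto an open subset $V$ of a topological vector space $E$, such that there exist $\alpha_0\in A$, charts $\phi_\alpha:U_\alpha\to V_\alpha\subseteq E_\alpha$ of $M_\alpha$ (with $U_\alpha\subseteq M_\alpha$ open) onto open subsets $V_\alpha$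 of topological vector spaces $E_\alpha$ for $\alpha\ge\alpha_0$, and continuous linear maps $\lambda_\alpha:E_\alpha\to E$ and $\lambda_{\beta,\alpha}:E_\alpha\to E_\beta$ (if $\beta\ge\alpha\ge\alpha_0$) such that: (a) for all $\alpha\ge\alpha_0$: $U_\alpha\subseteq U$ and $\phi|_{U_\alpha}=\lambda_\alpha\circ\phi_\alpha$; (b) for all $\beta\ge\alpha\ge\alpha_0$: $U_\alpha\subseteq U_\beta$ and $\phi_\beta|_{U_\alpha}=\lambda_{\beta,\alpha}\circ\phi_\alpha$; (c) $U=\bigcup_{\alpha\ge\alpha_0}U_\alpha$. The equality with the direct limit means that $\pi_k(M,p)$, together with the maps $\pi_k(M_\alpha,p)\to\pi_k(M,p)$ induced by the inclusions, is a direct limit of the direct system of the $\pi_k(M_\alpha,p)$, $\alpha\in A_p$, with bonding maps induced by the inclusions: in the category of groups if $k\ge1$ (or if $k=0$, $M$ and all $M_\alpha$ are topological groups, the inclusions are homomorphisms and $p=1$, in which case $\pi_0$ is the group of path components), and in the category of sets for $k=0$ otherwise. *)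

theory Defs
  imports "HOL-Analysis.Analysis" "HOL-Algebra.Module"
begin

section \<open>Topological vector spaces, charts and manifolds\<close>

text \<open>
  The charts of one manifold may take values in different topological vector spaces, so a
  topological vector space is a value here and not a type: a module over the ring of reals,
  together with a topology on its carrier. The carrier lies in a type \<open>'e\<close>, which the notions below
  mention as a parameter \<open>TYPE('e)\<close> and which is arbitrary.
\<close>

definition real_ring :: "real ring"
  where "real_ring = \<lparr>carrier = UNIV, mult = (*), one = 1, zero = 0, add = (+)\<rparr>"

record 'e vs_with_topology = "(real, 'e) module" +
  vtop :: "'e topology"

definition topological_vector_space :: "'e vs_with_topology \<Rightarrow> bool"
  where "topological_vector_space E \<longleftrightarrow>
    Module.module real_ring E \<and>
    topspace (vtop E) = carrier E \<and>
    Hausdorff_space (vtop E) \<and>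
    continuous_map (prod_topology (vtop E) (vtop E)) (vtop E) (\<lambda>(x, y). x \<oplus>\<^bsub>E\<^esub> y) \<and>
    continuous_map (prod_topology euclideanreal (vtop E)) (vtop E) (\<lambda>(r, x). r \<odot>\<^bsub>E\<^esub> x)"

definition continuous_linear_map ::
    "'e vs_with_topology \<Rightarrow> 'e vs_with_topology \<Rightarrow> ('e \<Rightarrow> 'e) \<Rightarrow> bool"
  where "continuous_linear_map E F l \<longleftrightarrow>
    continuous_map (vtop E) (vtop F) l \<and>
    (\<forall>x\<in>carrier E. \<forall>y\<in>carrier E. l (x \<oplus>\<^bsub>E\<^esub> y) = l x \<oplus>\<^bsub>F\<^esub> l y) \<and>
    (\<forall>r. \<forall>x\<in>carrier E. l (r \<odot>\<^bsub>E\<^esub> x) = r \<odot>\<^bsub>F\<^esub> l x)"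

text \<open>A chart is a total function, of which only the values on its domain \<open>U\<close> matter.\<close>

definition is_chart ::
    "'a topology \<Rightarrow> 'a set \<Rightarrow> ('a \<Rightarrow> 'e) \<Rightarrow> 'e set \<Rightarrow> 'e vs_with_topology \<Rightarrow> bool"
  where "is_chart X U \<phi> V E \<longleftrightarrow>
    topological_vector_space E \<and> openin X U \<and> openin (vtop E) V \<and>
    homeomorphic_map (subtopology X U) (subtopology (vtop E) V) \<phi>"

definition manifold :: "'e itself \<Rightarrow> 'a topology \<Rightarrow> bool"
  where "manifold _ X \<longleftrightarrow>
    Hausdorff_space X \<and>
    (\<forall>p\<in>topspace X. \<exists>U \<phi> V (E :: 'e vs_with_topology). p \<in> U \<and> is_chart X U \<phi> V E)"


section \<open>Directed unions\<close>

definition directed_set :: "'i set \<Rightarrow> ('i \<Rightarrow> 'i \<Rightarrow> bool) \<Rightarrow> bool"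
  where "directed_set A leq \<longleftrightarrow>
    A \<noteq> {} \<and>
    (\<forall>a\<in>A. leq a a) \<and>
    (\<forall>a\<in>A. \<forall>b\<in>A. \<forall>c\<in>A. leq a b \<longrightarrow> leq b c \<longrightarrow> leq a c) \<and>
    (\<forall>a\<in>A. \<forall>b\<in>A. \<exists>c\<in>A. leq a c \<and> leq b c)"

text \<open>The topologies \<open>N a\<close> need not be subspace topologies.\<close>

definition directed_union ::
    "'i set \<Rightarrow> ('i \<Rightarrow> 'i \<Rightarrow> bool) \<Rightarrow> ('i \<Rightarrow> 'a topology) \<Rightarrow> 'a topology \<Rightarrow> bool"
  where "directed_union A leq N M \<longleftrightarrow>
    directed_set A leq \<and>
    (\<forall>a\<in>A. \<forall>b\<in>A. leq a b \<longrightarrow> topspace (N a) \<subseteq> topspace (N b)) \<and>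
    topspace M = (\<Union>a\<in>A. topspace (N a)) \<and>
    (\<forall>a\<in>A. continuous_map (N a) M id) \<and>
    (\<forall>a\<in>A. \<forall>b\<in>A. leq a b \<longrightarrow> continuous_map (N a) (N b) id)"

definition weak_direct_limit_chart ::
    "'i set \<Rightarrow> ('i \<Rightarrow> 'i \<Rightarrow> bool) \<Rightarrow> ('i \<Rightarrow> 'a topology) \<Rightarrow> 'a topology \<Rightarrow>
     'a set \<Rightarrow> ('a \<Rightarrow> 'e) \<Rightarrow> 'e set \<Rightarrow> 'e vs_with_topology \<Rightarrow> bool"
  where "weak_direct_limit_chart A leq N M U \<phi> V E \<longleftrightarrow>
    is_chart M U \<phi> V E \<and>
    (\<exists>a0\<in>A. \<exists>(U' :: 'i \<Rightarrow> 'a set) (\<phi>' :: 'i \<Rightarrow> 'a \<Rightarrow> 'e) (V' :: 'i \<Rightarrow> 'e set)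
        (E' :: 'i \<Rightarrow> 'e vs_with_topology) (l :: 'i \<Rightarrow> 'e \<Rightarrow> 'e) (l' :: 'i \<Rightarrow> 'i \<Rightarrow> 'e \<Rightarrow> 'e).
      (\<forall>a\<in>A. leq a0 a \<longrightarrow>
        is_chart (N a) (U' a) (\<phi>' a) (V' a) (E' a) \<and>
        continuous_linear_map (E' a) E (l a) \<and>
        U' a \<subseteq> U \<and> (\<forall>x\<in>U' a. \<phi> x = l a (\<phi>' a x))) \<and>
      (\<forall>a\<in>A. \<forall>b\<in>A. leq a0 a \<longrightarrow> leq a b \<longrightarrow>
        continuous_linear_map (E' a) (E' b) (l' b a) \<and>
        U' a \<subseteq> U' b \<and> (\<forall>x\<in>U' a. \<phi>' b x = l' b a (\<phi>' a x))) \<and>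
      U = (\<Union>a\<in>{a\<in>A. leq a0 a}. U' a))"

definition admits_weak_direct_limit_charts ::
    "'e itself \<Rightarrow> 'i set \<Rightarrow> ('i \<Rightarrow> 'i \<Rightarrow> bool) \<Rightarrow> ('i \<Rightarrow> 'a topology) \<Rightarrow> 'a topology \<Rightarrow> bool"
  where "admits_weak_direct_limit_charts _ A leq N M \<longleftrightarrow>
    (\<forall>x\<in>topspace M. \<exists>U \<phi> V (E :: 'e vs_with_topology).
       x \<in> U \<and> weak_direct_limit_chart A leq N M U \<phi> V E)"


section \<open>Homotopy groups\<close>

text \<open>
  For \<open>k \<ge> 1\<close> the elements of the homotopy group are the homotopy classes, relative to the boundary,
  of maps from the cube \<open>[0,1]\<^sup>k\<close> sending the boundary to the base point; a class contains all
  functions \<open>(nat \<Rightarrow> real) \<Rightarrow> 'a\<close> whose restriction to the cube belongs to it. The product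
  concatenates in the coordinate with index 0.
\<close>

definition cube :: "nat \<Rightarrow> (nat \<Rightarrow> real) topology"
  where "cube k = product_topology (\<lambda>_. top_of_set {0..1}) {..<k}"

definition cube_boundary :: "nat \<Rightarrow> (nat \<Rightarrow> real) set"
  where "cube_boundary k = {x \<in> topspace (cube k). \<exists>i<k. x i = 0 \<or> x i = 1}"

definition based_maps :: "nat \<Rightarrow> 'a topology \<Rightarrow> 'a \<Rightarrow> ((nat \<Rightarrow> real) \<Rightarrow> 'a) set"
  where "based_maps k X p = {f. continuous_map (cube k) X f \<and> (\<forall>x\<in>cube_boundary k. f x = p)}"

definition homotopy_class ::
    "nat \<Rightarrow> 'a topology \<Rightarrow> 'a \<Rightarrow> ((nat \<Rightarrow> real) \<Rightarrow> 'a) \<Rightarrow> ((nat \<Rightarrow> real) \<Rightarrow> 'a) set"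
  where "homotopy_class k X p f =
    {g. homotopic_with (\<lambda>h. \<forall>x\<in>cube_boundary k. h x = p) (cube k) X f g}"

definition concat_maps ::
    "((nat \<Rightarrow> real) \<Rightarrow> 'a) \<Rightarrow> ((nat \<Rightarrow> real) \<Rightarrow> 'a) \<Rightarrow> (nat \<Rightarrow> real) \<Rightarrow> 'a"
  where "concat_maps f g = (\<lambda>x. if x 0 \<le> 1 / 2 then f (x(0 := 2 * x 0)) else g (x(0 := 2 * x 0 - 1)))"

text \<open>
  In the next two definitions all sets in the union are equal, so the union is the usual
  representative-independent operation on classes.
\<close>

definition homotopy_group ::
    "nat \<Rightarrow> 'a topology \<Rightarrow> 'a \<Rightarrow> ((nat \<Rightarrow> real) \<Rightarrow> 'a) set monoid"
  where "homotopy_group k X p =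
    \<lparr>carrier = homotopy_class k X p ` based_maps k X p,
     mult = (\<lambda>c d. \<Union>f\<in>c. \<Union>g\<in>d. homotopy_class k X p (concat_maps f g)),
     one = homotopy_class k X p (\<lambda>_. p)\<rparr>"

text \<open>The map into the homotopy group of \<open>(Y, q)\<close> induced by \<open>j\<close>.\<close>

definition homotopy_map ::
    "nat \<Rightarrow> 'b topology \<Rightarrow> 'b \<Rightarrow> ('a \<Rightarrow> 'b) \<Rightarrow>
     ((nat \<Rightarrow> real) \<Rightarrow> 'a) set \<Rightarrow> ((nat \<Rightarrow> real) \<Rightarrow> 'b) set"
  where "homotopy_map k Y q j c = (\<Union>f\<in>c. homotopy_class k Y q (j \<circ> f))"

text \<open>
  For \<open>k = 0\<close> the homotopy set is the set of path components, \<^const>\<open>path_components_of\<close>. It is a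
  group if the space carries the structure of a topological group.
\<close>

definition path_components_map :: "'b topology \<Rightarrow> ('a \<Rightarrow> 'b) \<Rightarrow> 'a set \<Rightarrow> 'b set"
  where "path_components_map Y j c = (\<Union>x\<in>c. path_component_of_set Y (j x))"

definition topological_group :: "'a topology \<Rightarrow> 'a monoid \<Rightarrow> bool"
  where "topological_group X G \<longleftrightarrow>
    group G \<and> topspace X = carrier G \<and>
    continuous_map (prod_topology X X) X (\<lambda>(x, y). x \<otimes>\<^bsub>G\<^esub> y) \<and>
    continuous_map X X (\<lambda>x. inv\<^bsub>G\<^esub> x)"

definition path_components_group :: "'a topology \<Rightarrow> 'a monoid \<Rightarrow> 'a set monoid"
  where "path_components_group X G =
    \<lparr>carrier = path_components_of X,
     mult = (\<lambda>c d. \<Union>x\<in>c. \<Union>y\<in>d. path_component_of_set X (x \<otimes>\<^bsub>G\<^esub> y)),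
     one = path_component_of_set X \<one>\<^bsub>G\<^esub>\<rparr>"


section \<open>Direct limits of sets and of groups\<close>

text \<open>
  The map \<open>b i j\<close> goes from the \<open>i\<close>-th to the \<open>j\<close>-th object and \<open>u i\<close> from the \<open>i\<close>-th object to the
  limit. The universal property is tested on all sets (groups) whose elements have type \<open>'t\<close>; for
  the full universal property \<open>'t\<close> has to be arbitrary. Maps out of the limit are made unique as
  functions by requiring them to be extensional.
\<close>

definition direct_system_of_sets ::
    "'i set \<Rightarrow> ('i \<Rightarrow> 'i \<Rightarrow> bool) \<Rightarrow> ('i \<Rightarrow> 's set) \<Rightarrow> ('i \<Rightarrow> 'i \<Rightarrow> 's \<Rightarrow> 's) \<Rightarrow> bool"
  where "direct_system_of_sets I leq S b \<longleftrightarrow>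
    directed_set I leq \<and>
    (\<forall>i\<in>I. \<forall>j\<in>I. leq i j \<longrightarrow> b i j \<in> S i \<rightarrow> S j) \<and>
    (\<forall>i\<in>I. \<forall>x\<in>S i. b i i x = x) \<and>
    (\<forall>i\<in>I. \<forall>j\<in>I. \<forall>k\<in>I. leq i j \<longrightarrow> leq j k \<longrightarrow> (\<forall>x\<in>S i. b j k (b i j x) = b i k x))"

definition cocone_of_sets ::
    "'i set \<Rightarrow> ('i \<Rightarrow> 'i \<Rightarrow> bool) \<Rightarrow> ('i \<Rightarrow> 's set) \<Rightarrow> ('i \<Rightarrow> 'i \<Rightarrow> 's \<Rightarrow> 's) \<Rightarrow>
     't set \<Rightarrow> ('i \<Rightarrow> 's \<Rightarrow> 't) \<Rightarrow> bool"
  where "cocone_of_sets I leq S b T g \<longleftrightarrow>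
    (\<forall>i\<in>I. g i \<in> S i \<rightarrow> T) \<and>
    (\<forall>i\<in>I. \<forall>j\<in>I. leq i j \<longrightarrow> (\<forall>x\<in>S i. g j (b i j x) = g i x))"

definition direct_limit_of_sets ::
    "'t itself \<Rightarrow> 'i set \<Rightarrow> ('i \<Rightarrow> 'i \<Rightarrow> bool) \<Rightarrow> ('i \<Rightarrow> 's set) \<Rightarrow> ('i \<Rightarrow> 'i \<Rightarrow> 's \<Rightarrow> 's) \<Rightarrow>
     'l set \<Rightarrow> ('i \<Rightarrow> 's \<Rightarrow> 'l) \<Rightarrow> bool"
  where "direct_limit_of_sets _ I leq S b L u \<longleftrightarrow>
    direct_system_of_sets I leq S b \<and>
    cocone_of_sets I leq S b L u \<and>
    (\<forall>(T :: 't set) g. cocone_of_sets I leq S b T g \<longrightarrow>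
      (\<exists>!h. h \<in> L \<rightarrow>\<^sub>E T \<and> (\<forall>i\<in>I. \<forall>x\<in>S i. h (u i x) = g i x)))"

definition direct_system_of_groups ::
    "'i set \<Rightarrow> ('i \<Rightarrow> 'i \<Rightarrow> bool) \<Rightarrow> ('i \<Rightarrow> 's monoid) \<Rightarrow> ('i \<Rightarrow> 'i \<Rightarrow> 's \<Rightarrow> 's) \<Rightarrow> bool"
  where "direct_system_of_groups I leq S b \<longleftrightarrow>
    direct_system_of_sets I leq (\<lambda>i. carrier (S i)) b \<and>
    (\<forall>i\<in>I. group (S i)) \<and>
    (\<forall>i\<in>I. \<forall>j\<in>I. leq i j \<longrightarrow> b i j \<in> hom (S i) (S j))"

definition cocone_of_groups ::
    "'i set \<Rightarrow> ('i \<Rightarrow> 'i \<Rightarrow> bool) \<Rightarrow> ('i \<Rightarrow> 's monoid) \<Rightarrow> ('i \<Rightarrow> 'i \<Rightarrow> 's \<Rightarrow> 's) \<Rightarrow>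
     't monoid \<Rightarrow> ('i \<Rightarrow> 's \<Rightarrow> 't) \<Rightarrow> bool"
  where "cocone_of_groups I leq S b T g \<longleftrightarrow>
    group T \<and>
    (\<forall>i\<in>I. g i \<in> hom (S i) T) \<and>
    cocone_of_sets I leq (\<lambda>i. carrier (S i)) b (carrier T) g"

definition direct_limit_of_groups ::
    "'t itself \<Rightarrow> 'i set \<Rightarrow> ('i \<Rightarrow> 'i \<Rightarrow> bool) \<Rightarrow> ('i \<Rightarrow> 's monoid) \<Rightarrow> ('i \<Rightarrow> 'i \<Rightarrow> 's \<Rightarrow> 's) \<Rightarrow>
     'l monoid \<Rightarrow> ('i \<Rightarrow> 's \<Rightarrow> 'l) \<Rightarrow> bool"
  where "direct_limit_of_groups _ I leq S b L u \<longleftrightarrow>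
    direct_system_of_groups I leq S b \<and>
    cocone_of_groups I leq S b L u \<and>
    (\<forall>(T :: 't monoid) g. cocone_of_groups I leq S b T g \<longrightarrow>
      (\<exists>!h. h \<in> hom L T \<and> h \<in> extensional (carrier L) \<and>
        (\<forall>i\<in>I. \<forall>x\<in>carrier (S i). h (u i x) = g i x)))"

end

theory Submission
  imports Defs
begin

text \<open>
  Injectivity and surjectivity of the limit map both reduce to one compression statement: a map
  \<open>f\<close> from a cube (or cylinder over a cube) \<open>X\<close> to \<open>M\<close> which is continuous into some \<open>N a\<close> on a collar of
  the boundary is homotopic, relative to the boundary, to a map that is continuous into some \<open>N b\<close>.
  One covers \<open>X\<close> by finitely many compact sets, each mapped into a weak direct limit chart, and
  treats the charts one after the other. In a chart, \<open>f\<close> is replaced by an interpolation of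
  finitely many of its values, which lie in a common \<open>E' b\<close>. A compact set in \<open>E' b\<close> whose image
  lies in \<open>V\<close> is eventually mapped into \<open>V' c\<close>, because linearity and injectivity of \<open>\<phi>\<close> make \<open>l c\<close>
  injective as soon as \<open>U' c\<close> is nonempty. The spaces need not be locally convex, so the
  interpolation stays close to \<open>f\<close> only because finite dimensionality of \<open>X\<close> bounds, in advance,
  the number of values that contribute at any given point.
\<close>

text \<open>The obstacle is that the members do not carry the topology induced from
  \<open>M\<close>. Continuity into \<open>M\<close> gives no continuity into a member, and the
  image of a compact space need not lie in one: take an infinite-dimensional Banach space as the
  union of its finite-dimensional subspaces. An interpolation escapes this because it involves
  finitely many vectors only. It is not a convex combination over a partition of unity, but a
  succession of two-point mixes whose coefficients are bump functions attaining the value 1.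
  Continuous linear maps commute with mixing, so one formula can be evaluated in \<open>E' b\<close>
  and in \<open>E\<close>. A deformation in one chart must not push points out of the charts that
  are treated later; the sets \<open>Lf j\<close> and \<open>Uf j\<close> record this side
  condition. The collar comes from precomposition with a map that is constant on the outer thirds of
  every coordinate. For injectivity the time coordinate of the homotopy is treated in the same
  way.\<close>

lemma continuous_map_closed_union:
  assumes "closedin X S" "closedin X T" "topspace X \<subseteq> S \<union> T"
    and "continuous_map (subtopology X S) Y f" "continuous_map (subtopology X T) Y f"
  shows "continuous_map X Y f"
  by (rule pasting_lemma_closed[of "{S,T}" X "\<lambda>i. i" Y "\<lambda>_. f" f]) (use assms in auto)

section \<open>Mixing in topological vector spaces\<close>

definition mix :: "'e vs_with_topology \<Rightarrow> real \<Rightarrow> 'e \<Rightarrow> 'e \<Rightarrow> 'e"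
  where "mix E c u w = ((1 - c) \<odot>\<^bsub>E\<^esub> u) \<oplus>\<^bsub>E\<^esub> (c \<odot>\<^bsub>E\<^esub> w)"

text \<open>The head of the list acts last. An entry with coefficient 1 therefore erases the start
  vector and all entries behind it in the list.\<close>

definition mixes :: "'e vs_with_topology \<Rightarrow> (real \<times> 'e) list \<Rightarrow> 'e \<Rightarrow> 'e"
  where "mixes E xs u = foldr (\<lambda>(c, w) v. mix E c v w) xs u"

lemma mixes_simps [simp]:
  "mixes E [] u = u"
  "mixes E ((c, w) # xs) u = mix E c (mixes E xs u) w"
  by (simp_all add: mixes_def)

context
  fixes E :: "'e vs_with_topology"
  assumes tvs: "topological_vector_space E"
begin

interpretation Module.module real_ring E
  using tvs by (simp add: topological_vector_space_def)

lemma topspace_vtop: "topspace (vtop E) = carrier E"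
  using tvs by (simp add: topological_vector_space_def)

lemma mix_closed: "u \<in> carrier E \<Longrightarrow> w \<in> carrier E \<Longrightarrow> mix E c u w \<in> carrier E"
  by (simp add: mix_def real_ring_def smult_closed)

lemma mix_same: "u \<in> carrier E \<Longrightarrow> mix E c u u = u"
  using smult_l_distr[of "1 - c" c u] smult_one[of u]
  by (simp add: mix_def real_ring_def)

lemma mix_0: "u \<in> carrier E \<Longrightarrow> w \<in> carrier E \<Longrightarrow> mix E 0 u w = u"
  using smult_l_null[of w] smult_one[of u] by (simp add: mix_def real_ring_def)

lemma mix_1: "u \<in> carrier E \<Longrightarrow> w \<in> carrier E \<Longrightarrow> mix E 1 u w = w"
  using smult_l_null[of u] smult_one[of w] by (simp add: mix_def real_ring_def)

lemma mix_cancel: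
  assumes "u \<in> carrier E" "w \<in> carrier E" "w' \<in> carrier E" "c \<noteq> 0" "mix E c u w = mix E c u w'"
  shows "w = w'"
proof -
  have "c \<odot>\<^bsub>E\<^esub> w = c \<odot>\<^bsub>E\<^esub> w'"
    using assms smult_closed by (simp add: mix_def real_ring_def)
  then have "inverse c \<odot>\<^bsub>E\<^esub> (c \<odot>\<^bsub>E\<^esub> w) = inverse c \<odot>\<^bsub>E\<^esub> (c \<odot>\<^bsub>E\<^esub> w')"
    by simp
  then show ?thesis
    using assms smult_assoc1[of "inverse c" c] smult_one by (simp add: real_ring_def)
qed

lemma continuous_map_mix:
  assumes "continuous_map X euclideanreal c"
    and "continuous_map X (vtop E) u" "continuous_map X (vtop E) w"
  shows "continuous_map X (vtop E) (\<lambda>x. mix E (c x) (u x) (w x))"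
proof -
  have add: "continuous_map (prod_topology (vtop E) (vtop E)) (vtop E) (\<lambda>(x, y). x \<oplus>\<^bsub>E\<^esub> y)"
    and smult: "continuous_map (prod_topology euclideanreal (vtop E)) (vtop E) (\<lambda>(r, x). r \<odot>\<^bsub>E\<^esub> x)"
    using tvs by (auto simp: topological_vector_space_def)
  have s: "continuous_map X (vtop E) (\<lambda>x. r x \<odot>\<^bsub>E\<^esub> v x)"
    if "continuous_map X euclideanreal r" "continuous_map X (vtop E) v" for r v
    using continuous_map_compose[OF continuous_map_pairedI[OF that] smult] by (simp add: o_def)
  have a: "continuous_map X (vtop E) (\<lambda>x. a x \<oplus>\<^bsub>E\<^esub> b x)"
    if "continuous_map X (vtop E) a" "continuous_map X (vtop E) b" for a b
    using continuous_map_compose[OF continuous_map_pairedI[OF that] add] by (simp add: o_def)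
  show ?thesis
    unfolding mix_def by (intro a s continuous_intros assms)
qed

lemma mixes_closed:
  "u \<in> carrier E \<Longrightarrow> snd ` set xs \<subseteq> carrier E \<Longrightarrow> mixes E xs u \<in> carrier E"
  by (induction xs) (auto simp: mix_closed)

lemma mixes_zeros:
  assumes "u \<in> carrier E" "snd ` set xs \<subseteq> carrier E" "\<forall>(c, w)\<in>set xs. c = 0"
  shows "mixes E xs u = u"
  using assms by (induction xs) (auto simp: mix_0)

text \<open>This allows an interpolation to be defined with one fixed start vector and nevertheless
  to be estimated, at each point, with a start vector close to the value there.\<close>

lemma mixes_start_irrelevant:
  assumes "u \<in> carrier E" "v \<in> carrier E" "snd ` set xs \<subseteq> carrier E" "1 \<in> fst ` set xs"
  shows "mixes E xs u = mixes E xs v"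
  using assms by (induction xs) (force simp: mix_1 mixes_closed)+

lemma continuous_map_mixes:
  assumes "\<And>c w. (c, w) \<in> set cs \<Longrightarrow> continuous_map X euclideanreal c \<and> w \<in> carrier E"
    and "continuous_map X (vtop E) u"
  shows "continuous_map X (vtop E) (\<lambda>x. mixes E (map (\<lambda>(c, w). (c x, w)) cs) (u x))"
  using assms(1)
proof (induction cs)
  case Nil
  then show ?case using assms by simp
next
  case (Cons a cs)
  obtain c w where a: "a = (c, w)" by fastforce
  show ?case
    unfolding a list.map prod.case mixes_simps
    using Cons.prems[of c w] Cons.IH Cons.prems a
    by (intro continuous_map_mix) (auto simp: topspace_vtop)
qed

text \<open>Substitute for convexity of neighbourhoods. All mixes of \<open>y\<close> with itself
  equal \<open>y\<close>, so the compact set of all \<open>(c, y, y)\<close> with \<open>c\<close>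
  in the unit interval lies in the open preimage of \<open>V\<close>, and the tube lemma makes the
  neighbourhood of \<open>(y, y)\<close> uniform in \<open>c\<close>.\<close>

lemma mix_neighbourhood:
  assumes "openin (vtop E) V" "y \<in> V"
  obtains G where "openin (vtop E) G" "y \<in> G" "G \<subseteq> V"
    "\<And>c u w. c \<in> {0..1} \<Longrightarrow> u \<in> G \<Longrightarrow> w \<in> G \<Longrightarrow> mix E c u w \<in> V"
proof -
  have y: "y \<in> carrier E"
    using assms openin_subset topspace_vtop by blast
  let ?Z = "prod_topology (top_of_set {0..1::real}) (prod_topology (vtop E) (vtop E))"
  have cont: "continuous_map ?Z (vtop E) (\<lambda>z. mix E (fst z) (fst (snd z)) (snd (snd z)))"
  proof (rule continuous_map_mix)
    show "continuous_map ?Z euclideanreal fst"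
      using continuous_map_fst continuous_map_in_subtopology by blast
    show "continuous_map ?Z (vtop E) (\<lambda>z. fst (snd z))" "continuous_map ?Z (vtop E) (\<lambda>z. snd (snd z))"
      using continuous_map_compose[OF continuous_map_snd continuous_map_fst]
        continuous_map_compose[OF continuous_map_snd continuous_map_snd] by (auto simp: o_def)
  qed
  define W where "W = {z \<in> topspace ?Z. mix E (fst z) (fst (snd z)) (snd (snd z)) \<in> V}"
  have "openin ?Z W"
    unfolding W_def using openin_continuous_map_preimage[OF cont assms(1)] .
  moreover have "{0..1} \<times> {(y, y)} \<subseteq> W"
    using assms y by (auto simp: W_def mix_same topspace_vtop)
  moreover have "compactin (top_of_set {0..1::real}) {0..1}"
    by (simp add: compactin_subtopology)
  moreover have "(y, y) \<in> topspace (prod_topology (vtop E) (vtop E))"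
    using y by (simp add: topspace_vtop)
  ultimately have "\<exists>A B. openin (top_of_set {0..1::real}) A \<and>
      openin (prod_topology (vtop E) (vtop E)) B \<and> {0..1} \<subseteq> A \<and> (y, y) \<in> B \<and> A \<times> B \<subseteq> W"
    by (intro tube_lemma_left)
  then obtain A B where A: "{0..1} \<subseteq> A"
    and B: "openin (prod_topology (vtop E) (vtop E)) B" "(y, y) \<in> B" "A \<times> B \<subseteq> W"
    by (elim exE conjE) (rule that)
  have "\<exists>G1 G2. openin (vtop E) G1 \<and> openin (vtop E) G2 \<and> y \<in> G1 \<and> y \<in> G2 \<and> G1 \<times> G2 \<subseteq> B"
    using B(1,2) unfolding openin_prod_topology_alt by (elim allE impE)
  then obtain G1 G2 where G: "openin (vtop E) G1" "openin (vtop E) G2" "y \<in> G1" "y \<in> G2" "G1 \<times> G2 \<subseteq> B"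
    by (elim exE conjE) (rule that)
  show ?thesis
  proof
    show "openin (vtop E) (G1 \<inter> G2 \<inter> V)" "y \<in> G1 \<inter> G2 \<inter> V" "G1 \<inter> G2 \<inter> V \<subseteq> V"
      using G assms by auto
    fix c u w assume "c \<in> {0..1::real}" "u \<in> G1 \<inter> G2 \<inter> V" "w \<in> G1 \<inter> G2 \<inter> V"
    then have "(c, u, w) \<in> A \<times> B" using A G by auto
    then have "(c, u, w) \<in> W" using B by auto
    then show "mix E c u w \<in> V" by (simp add: W_def)
  qed
qed

text \<open>The line \<open>c \<mapsto> mix E c u w\<close> passes through \<open>u\<close> at
  \<open>c = 0\<close> and so stays in \<open>V\<close> for small nonzero \<open>c\<close>. Together
  with \<open>mix_cancel\<close> this carries statements about linear maps from a nonempty open set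
  to the whole space.\<close>

lemma mix_absorbing:
  assumes "openin (vtop E) V" "u \<in> V" "w \<in> carrier E"
  obtains c where "c \<noteq> 0" "mix E c u w \<in> V"
proof -
  have u: "u \<in> carrier E"
    using assms openin_subset topspace_vtop by blast
  have "continuous_map euclideanreal (vtop E) (\<lambda>c. mix E c u w)"
    using u assms(3) by (intro continuous_map_mix) (auto simp: topspace_vtop)
  then have "openin euclideanreal {c \<in> topspace euclideanreal. mix E c u w \<in> V}"
    using assms(1) by (rule openin_continuous_map_preimage)
  then have "open {c. mix E c u w \<in> V}" by simp
  moreover have "0 \<in> {c. mix E c u w \<in> V}" using assms u by (simp add: mix_0)
  ultimately obtain e where "e > 0" "ball 0 e \<subseteq> {c. mix E c u w \<in> V}"
    using openE by blast
  then show ?thesis using that[of "e / 2"] by (auto simp: subset_iff)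
qed

text \<open>
  Without local convexity, only a bounded number of consecutive mixing steps can be controlled.
\<close>

lemma mixes_neighbourhood:
  assumes "openin (vtop E) V" "y \<in> V"
  shows "\<exists>G. openin (vtop E) G \<and> y \<in> G \<and> G \<subseteq> V \<and>
    (\<forall>xs. \<forall>u\<in>G. (\<forall>(c, w)\<in>set xs. c \<in> {0..1} \<and> w \<in> carrier E \<and> (c \<noteq> 0 \<longrightarrow> w \<in> G)) \<longrightarrow>
       length (filter (\<lambda>x. fst x \<noteq> 0) xs) \<le> n \<longrightarrow> mixes E xs u \<in> V)"
  using assms
proof (induction n arbitrary: V)
  case 0
  have "mixes E xs u \<in> V"
    if "u \<in> V" "\<forall>(c, w)\<in>set xs. c \<in> {0..1} \<and> w \<in> carrier E \<and> (c \<noteq> 0 \<longrightarrow> w \<in> V)"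
      "length (filter (\<lambda>x. fst x \<noteq> 0) xs) \<le> 0" for xs u
  proof -
    have "mixes E xs u = u"
      using that openin_subset[OF "0.prems"(1)] topspace_vtop
      by (intro mixes_zeros) (auto simp: filter_empty_conv)
    then show ?thesis using that by simp
  qed
  then show ?case
    using 0 by (intro exI[of _ V]) blast
next
  case (Suc n)
  \<comment> \<open>The last mix with a nonzero coefficient has to stay in \<open>V\<close> and
    needs arguments in \<open>G1\<close>; the at most \<open>n\<close> nonzero ones before it have
    to stay in \<open>G1\<close> and need arguments in the smaller set \<open>G\<close>.\<close>
  obtain G1 where G1: "openin (vtop E) G1" "y \<in> G1" "G1 \<subseteq> V"
    and G1_mix: "\<And>c u w. c \<in> {0..1} \<Longrightarrow> u \<in> G1 \<Longrightarrow> w \<in> G1 \<Longrightarrow> mix E c u w \<in> V"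
    using mix_neighbourhood[OF Suc.prems] by metis
  obtain G where G: "openin (vtop E) G" "y \<in> G" "G \<subseteq> G1"
    and G_mix: "\<And>xs u. u \<in> G \<Longrightarrow> (\<forall>(c, w)\<in>set xs. c \<in> {0..1} \<and> w \<in> carrier E \<and> (c \<noteq> 0 \<longrightarrow> w \<in> G)) \<Longrightarrow>
       length (filter (\<lambda>x. fst x \<noteq> 0) xs) \<le> n \<Longrightarrow> mixes E xs u \<in> G1"
    using Suc.IH[OF G1(1,2)] by blast
  have "mixes E xs u \<in> V"
    if u: "u \<in> G" and "\<forall>(c, w)\<in>set xs. c \<in> {0..1} \<and> w \<in> carrier E \<and> (c \<noteq> 0 \<longrightarrow> w \<in> G)"
      "length (filter (\<lambda>x. fst x \<noteq> 0) xs) \<le> Suc n" for xs u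
    using that(2,3)
  proof (induction xs)
    case Nil
    then show ?case using u G G1 by auto
  next
    case (Cons a xs)
    obtain c w where a: "a = (c, w)" by fastforce
    have uE: "u \<in> carrier E"
      using u openin_subset[OF G(1)] topspace_vtop by auto
    show ?case
    proof (cases "c = 0")
      case True
      have "mixes E (a # xs) u = mixes E xs u"
        using Cons.prems a True uE by (auto simp: mix_0 mixes_closed image_subset_iff split_beta)
      then show ?thesis using Cons a True by auto
    next
      case False
      then show ?thesis
        using G_mix[OF u, of xs] G1_mix[of c "mixes E xs u" w] Cons.prems a G by auto
    qed
  qed
  then show ?case
    using G G1 by (intro exI[of _ G]) blast
qed

end

lemma continuous_linear_map_mix:
  assumes "topological_vector_space E" "topological_vector_space F" "continuous_linear_map E F l"
    and "u \<in> carrier E" "w \<in> carrier E"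
  shows "l (mix E c u w) = mix F c (l u) (l w)"
proof -
  interpret Module.module real_ring E
    using assms by (simp add: topological_vector_space_def)
  show ?thesis
    using assms smult_closed by (simp add: continuous_linear_map_def mix_def real_ring_def)
qed

lemma continuous_linear_map_carrier:
  assumes "topological_vector_space E" "topological_vector_space F" "continuous_linear_map E F l"
    and "u \<in> carrier E"
  shows "l u \<in> carrier F"
proof -
  have "l \<in> topspace (vtop E) \<rightarrow> topspace (vtop F)"
    by (rule continuous_map_funspace) (use assms(3) in \<open>simp add: continuous_linear_map_def\<close>)
  then show ?thesis
    using assms(4) by (auto simp: topspace_vtop[OF assms(1)] topspace_vtop[OF assms(2)])
qed

lemma continuous_linear_map_mixes:
  assumes "topological_vector_space E" "topological_vector_space F" "continuous_linear_map E F l"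
    and "u \<in> carrier E" "snd ` set xs \<subseteq> carrier E"
  shows "l (mixes E xs u) = mixes F (map (apsnd l) xs) (l u)"
  using assms(5)
proof (induction xs)
  case (Cons a xs)
  then show ?case
    using assms by (cases a) (auto simp: continuous_linear_map_mix mixes_closed)
qed simp

section \<open>Bump functions of bounded multiplicity\<close>

text \<open>The sum of the functions is not prescribed; instead one of them equals 1 at each point,
  which is what \<open>mixes_start_irrelevant\<close> asks for. The bound \<open>m\<close> limits
  the number of effective mixing steps. By the last clause all functions that are active at
  \<open>x\<close> live in one common member of the cover, so values sampled from their supports are
  close to each other.\<close>

definition bump_cover :: "'a topology \<Rightarrow> nat \<Rightarrow> 'a set set \<Rightarrow> ('a \<Rightarrow> real) set \<Rightarrow> bool"
  where "bump_cover X m \<U> \<Phi> \<longleftrightarrow>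
    finite \<Phi> \<and> (\<forall>c\<in>\<Phi>. continuous_map X euclideanreal c \<and> (\<forall>x\<in>topspace X. c x \<in> {0..1})) \<and>
    (\<forall>x\<in>topspace X. (\<exists>c\<in>\<Phi>. c x = 1) \<and> card {c\<in>\<Phi>. c x \<noteq> 0} \<le> m \<and>
      (\<exists>U\<in>\<U>. \<forall>c\<in>\<Phi>. c x \<noteq> 0 \<longrightarrow> {z\<in>topspace X. c z \<noteq> 0} \<subseteq> U))"

lemma bump_cover_star:
  assumes "bump_cover X m \<U> \<Phi>" "x \<in> topspace X"
  shows "\<exists>U\<in>\<U>. \<forall>c\<in>\<Phi>. c x \<noteq> 0 \<longrightarrow> {z\<in>topspace X. c z \<noteq> 0} \<subseteq> U"
proof -
  have "(\<exists>c\<in>\<Phi>. c x = 1) \<and> card {c\<in>\<Phi>. c x \<noteq> 0} \<le> m \<and>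
      (\<exists>U\<in>\<U>. \<forall>c\<in>\<Phi>. c x \<noteq> 0 \<longrightarrow> {z\<in>topspace X. c z \<noteq> 0} \<subseteq> U)"
    by (rule assms(1)[unfolded bump_cover_def, THEN conjunct2, THEN conjunct2, THEN bspec, OF assms(2)])
  then show ?thesis by (elim conjE)
qed

text \<open>A quantitative form of finite covering dimension, with star refinement built in.\<close>

definition bump_dimension :: "'a topology \<Rightarrow> nat \<Rightarrow> bool"
  where "bump_dimension X m \<longleftrightarrow>
    (\<forall>\<U>. (\<forall>U\<in>\<U>. openin X U) \<longrightarrow> topspace X \<subseteq> \<Union>\<U> \<longrightarrow> (\<exists>\<Phi>. bump_cover X m \<U> \<Phi>))"

lemma bump_dimension_singleton:
  assumes "topspace X = {a}"
  shows "bump_dimension X 1"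
  unfolding bump_dimension_def
proof (intro allI impI)
  fix \<U> assume "\<forall>U\<in>\<U>. openin X U" "topspace X \<subseteq> \<Union>\<U>"
  moreover have "{c. c = (\<lambda>_. 1::real) \<and> c a \<noteq> 0} = {\<lambda>_::'a. 1::real}" by auto
  ultimately show "\<exists>\<Phi>. bump_cover X 1 \<U> \<Phi>"
    using assms by (intro exI[of _ "{\<lambda>_. 1}"]) (auto simp: bump_cover_def)
qed

lemma bump_dimension_homeomorphic:
  assumes "bump_dimension X m" "homeomorphic_maps X Y f g"
  shows "bump_dimension Y m"
  unfolding bump_dimension_def
proof (intro allI impI)
  fix \<U> assume opn: "\<forall>U\<in>\<U>. openin Y U" and cov: "topspace Y \<subseteq> \<Union>\<U>"
  have f: "continuous_map X Y f" and g: "continuous_map Y X g"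
    and gf: "\<And>x. x \<in> topspace X \<Longrightarrow> g (f x) = x" and fg: "\<And>y. y \<in> topspace Y \<Longrightarrow> f (g y) = y"
    using assms(2) by (auto simp: homeomorphic_maps_def)
  have fX: "f x \<in> topspace Y" if "x \<in> topspace X" for x
    using f that continuous_map_image_subset_topspace by blast
  have gY: "g x \<in> topspace X" if "x \<in> topspace Y" for x
    using g that continuous_map_image_subset_topspace by blast
  let ?pull = "\<lambda>U. {x \<in> topspace X. f x \<in> U}"
  have "\<forall>U\<in>?pull ` \<U>. openin X U"
    using opn openin_continuous_map_preimage[OF f] by auto
  moreover have "topspace X \<subseteq> \<Union>(?pull ` \<U>)"
    using cov fX by blast
  ultimately obtain \<Phi> where Phi: "bump_cover X m (?pull ` \<U>) \<Phi>"
    using assms(1) unfolding bump_dimension_def by blast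
  have "bump_cover Y m \<U> ((\<lambda>c. c \<circ> g) ` \<Phi>)"
    unfolding bump_cover_def
  proof (intro conjI ballI)
    show "finite ((\<lambda>c. c \<circ> g) ` \<Phi>)"
      using Phi by (auto simp: bump_cover_def)
    show "continuous_map Y euclideanreal c" if "c \<in> (\<lambda>c. c \<circ> g) ` \<Phi>" for c
      using that Phi continuous_map_compose[OF g] by (auto simp: bump_cover_def)
    show "c y \<in> {0..1}" if "c \<in> (\<lambda>c. c \<circ> g) ` \<Phi>" "y \<in> topspace Y" for c y
      using that Phi gY by (auto simp: bump_cover_def)
    fix y assume y: "y \<in> topspace Y"
    show "\<exists>c\<in>(\<lambda>c. c \<circ> g) ` \<Phi>. c y = 1"
      using Phi gY[OF y] by (auto simp: bump_cover_def)
    have "{c \<in> (\<lambda>c. c \<circ> g) ` \<Phi>. c y \<noteq> 0} \<subseteq> (\<lambda>c. c \<circ> g) ` {c\<in>\<Phi>. c (g y) \<noteq> 0}"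
      by auto
    then have "card {c \<in> (\<lambda>c. c \<circ> g) ` \<Phi>. c y \<noteq> 0} \<le> card {c\<in>\<Phi>. c (g y) \<noteq> 0}"
      using Phi by (intro surj_card_le) (auto simp: bump_cover_def)
    also have "\<dots> \<le> m" using Phi gY[OF y] by (auto simp: bump_cover_def)
    finally show "card {c \<in> (\<lambda>c. c \<circ> g) ` \<Phi>. c y \<noteq> 0} \<le> m" .
    have "\<exists>U\<in>?pull ` \<U>. \<forall>c\<in>\<Phi>. c (g y) \<noteq> 0 \<longrightarrow> {z\<in>topspace X. c z \<noteq> 0} \<subseteq> U"
      using Phi gY[OF y] by (rule bump_cover_star)
    then obtain U where U: "U \<in> \<U>" "\<And>c. c \<in> \<Phi> \<Longrightarrow> c (g y) \<noteq> 0 \<Longrightarrow> {z\<in>topspace X. c z \<noteq> 0} \<subseteq> ?pull U"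
      by auto
    have "z \<in> U" if "c \<in> \<Phi>" "c (g y) \<noteq> 0" "z \<in> topspace Y" "c (g z) \<noteq> 0" for c z
      using U(2)[OF that(1,2)] gY[OF that(3)] fg[OF that(3)] that(4) by auto
    then show "\<exists>U\<in>\<U>. \<forall>c\<in>(\<lambda>c. c \<circ> g) ` \<Phi>. c y \<noteq> 0 \<longrightarrow> {z \<in> topspace Y. c z \<noteq> 0} \<subseteq> U"
      using U(1) by (intro bexI[of _ U]) auto
  qed
  then show "\<exists>\<Phi>. bump_cover Y m \<U> \<Phi>" by blast
qed

text \<open>Products of bump functions on \<open>X\<close> with trapezoids on the interval. Every
  point of the interval meets at most two trapezoids, which doubles the multiplicity. The cover of
  \<open>X\<close> is chosen so that above each of its sets one Lebesgue number serves the whole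
  interval.\<close>

lemma bump_dimension_cylinder:
  assumes X: "compact_space X" and dim: "bump_dimension X m"
  shows "bump_dimension (prod_topology (top_of_set {0..1::real}) X) (2 * m)"
  unfolding bump_dimension_def
proof (intro allI impI)
  let ?Z = "prod_topology (top_of_set {0..1::real}) X"
  fix \<U> assume opn: "\<forall>U\<in>\<U>. openin ?Z U" and cov: "topspace ?Z \<subseteq> \<Union>\<U>"
  \<comment> \<open>Here \<open>\<delta>\<close> is a Lebesgue number for the interval above
    \<open>x\<close>, valid simultaneously on the neighbourhood \<open>W\<close>.\<close>
  define Q where "Q x W \<delta> \<longleftrightarrow> openin X W \<and> x \<in> W \<and> \<delta> > 0 \<and> (\<forall>t\<in>{0..1}. \<exists>U\<in>\<U>. ({0..1} \<inter> ball t \<delta>) \<times> W \<subseteq> U)"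
    for x W and \<delta> :: real
  have "\<exists>W \<delta>. Q x W \<delta>"
    if x: "x \<in> topspace X" for x
  proof -
    define P where "P t A B \<longleftrightarrow> open A \<and> openin X B \<and> t \<in> A \<and> x \<in> B \<and> (\<exists>U\<in>\<U>. ({0..1} \<inter> A) \<times> B \<subseteq> U)"
      for t A B
    have "\<exists>A B. P t A B" if t: "t \<in> {0..1}" for t
    proof -
      have "(t, x) \<in> topspace ?Z" using t x by simp
      then obtain U where U: "U \<in> \<U>" "(t, x) \<in> U" using cov by blast
      then have "openin ?Z U" using opn by blast
      then have "\<exists>A' B. openin (top_of_set {0..1}) A' \<and> openin X B \<and> t \<in> A' \<and> x \<in> B \<and> A' \<times> B \<subseteq> U"
        using U(2) unfolding openin_prod_topology_alt by (elim allE impE)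
      then obtain A' B where AB: "openin (top_of_set {0..1}) A'" "openin X B" "t \<in> A'" "x \<in> B" "A' \<times> B \<subseteq> U"
        by (elim exE conjE) (rule that)
      obtain A where "open A" "A' = {0..1} \<inter> A"
        using AB(1) by (auto simp: openin_open)
      then show ?thesis unfolding P_def using AB U(1) by blast
    qed
    then obtain A B where "\<And>t. t \<in> {0..1} \<Longrightarrow> P t (A t) (B t)"
      by metis
    then have AB: "\<And>t. t \<in> {0..1} \<Longrightarrow> open (A t)" "\<And>t. t \<in> {0..1} \<Longrightarrow> openin X (B t)"
        "\<And>t. t \<in> {0..1} \<Longrightarrow> t \<in> A t" "\<And>t. t \<in> {0..1} \<Longrightarrow> x \<in> B t"
        "\<And>t. t \<in> {0..1} \<Longrightarrow> \<exists>U\<in>\<U>. ({0..1} \<inter> A t) \<times> B t \<subseteq> U"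
      unfolding P_def by blast+
    have "{0..1::real} \<subseteq> (\<Union>t\<in>{0..1}. A t)" using AB(3) by auto
    then obtain D where D: "D \<subseteq> {0..1}" "finite D" "{0..1} \<subseteq> (\<Union>t\<in>D. A t)"
      using compactE_image[of "{0..1::real}" "{0..1}" A] AB(1) by auto
    have opD: "open G" if "G \<in> A ` D" for G
      using that AB(1) D(1) by auto
    obtain \<delta> where \<delta>: "\<delta> > 0" "\<And>t. t \<in> {0..1} \<Longrightarrow> \<exists>b\<in>A ` D. ball t \<delta> \<subseteq> b"
      by (rule Heine_Borel_lemma[OF compact_Icc D(3) opD]) (assumption, rule that)
    let ?W = "topspace X \<inter> (\<Inter>t\<in>D. B t)"
    have "openin X ((\<Inter>t\<in>D. B t) \<inter> topspace X)"
      by (rule openin_INT) (use D AB(2) in auto)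
    then have "openin X ?W" by (simp add: Int_commute)
    moreover have "x \<in> ?W" using x D AB(4) by auto
    moreover have "\<exists>U\<in>\<U>. ({0..1} \<inter> ball t \<delta>) \<times> ?W \<subseteq> U" if t: "t \<in> {0..1}" for t
    proof -
      obtain d where d: "d \<in> D" "ball t \<delta> \<subseteq> A d" using \<delta>(2)[OF t] by auto
      have "d \<in> {0..1}" by (rule subsetD[OF D(1) d(1)])
      then obtain U where U: "U \<in> \<U>" "({0..1} \<inter> A d) \<times> B d \<subseteq> U" using AB(5) by blast
      have "({0..1} \<inter> ball t \<delta>) \<times> ?W \<subseteq> ({0..1} \<inter> A d) \<times> B d"
        using d by (intro Sigma_mono) auto
      then show ?thesis using U by (intro bexI[of _ U]) (rule order_trans)
    qed
    ultimately show ?thesis using \<delta>(1) unfolding Q_def by blast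
  qed
  then obtain W \<delta> where "\<And>x. x \<in> topspace X \<Longrightarrow> Q x (W x) (\<delta> x)"
    by metis
  then have W: "\<And>x. x \<in> topspace X \<Longrightarrow> openin X (W x)" "\<And>x. x \<in> topspace X \<Longrightarrow> x \<in> W x"
    and \<delta>: "\<And>x. x \<in> topspace X \<Longrightarrow> \<delta> x > 0"
    and W\<delta>: "\<And>x t. x \<in> topspace X \<Longrightarrow> t \<in> {0..1} \<Longrightarrow> \<exists>U\<in>\<U>. ({0..1} \<inter> ball t (\<delta> x)) \<times> W x \<subseteq> U"
    unfolding Q_def by blast+
  have "\<exists>\<F>. finite \<F> \<and> \<F> \<subseteq> W ` topspace X \<and> topspace X \<subseteq> \<Union>\<F>"
    using X W by (intro compactinD) (auto simp: compact_space_def)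
  then obtain \<F> where F: "finite \<F>" "\<F> \<subseteq> W ` topspace X" "topspace X \<subseteq> \<Union>\<F>"
    by blast
  obtain D where D: "finite D" "D \<subseteq> topspace X" "\<F> = W ` D"
    using finite_subset_image[OF F(1,2)] by blast
  define e where "e = Min (insert 1 (\<delta> ` D))"
  have e: "e > 0" "\<And>d. d \<in> D \<Longrightarrow> e \<le> \<delta> d"
    unfolding e_def using D(1,2) \<delta> by auto
  \<comment> \<open>Two points in the support of one trapezoid differ by less than
    \<open>2 / N\<close>, and this has to be below the smallest Lebesgue number
    \<open>e\<close>.\<close>
  obtain N where N: "2 / e < real N" using reals_Archimedean2 by blast
  then have N0: "N > 0" using e(1) by (intro gr0I) (auto simp: zero_less_divide_iff not_less)
  have "\<forall>U\<in>W ` D. openin X U" using W(1) D(2) by auto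
  moreover have "topspace X \<subseteq> \<Union>(W ` D)" using F(3) D(3) by simp
  ultimately obtain \<Phi> where Phi: "bump_cover X m (W ` D) \<Phi>"
    using dim unfolding bump_dimension_def by meson
  then have fin: "finite \<Phi>" and cont: "\<And>c. c \<in> \<Phi> \<Longrightarrow> continuous_map X euclideanreal c"
    and c01: "\<And>c x. c \<in> \<Phi> \<Longrightarrow> x \<in> topspace X \<Longrightarrow> c x \<in> {0..1}"
    and c1: "\<And>x. x \<in> topspace X \<Longrightarrow> \<exists>c\<in>\<Phi>. c x = 1"
    and cm: "\<And>x. x \<in> topspace X \<Longrightarrow> card {c\<in>\<Phi>. c x \<noteq> 0} \<le> m"
    unfolding bump_cover_def by auto
  \<comment> \<open>A trapezoid centred at \<open>j / N\<close>. Its plateau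
    \<open>\<bar>N * t - j\<bar> \<le> 1/2\<close> meets the neighbouring plateaus, so some
    trapezoid equals 1 at each \<open>t\<close>; it vanishes once \<open>N * t\<close> is at
    distance 1 or more from \<open>j\<close>.\<close>
  define \<tau> where "\<tau> = (\<lambda>(j::nat) (t::real). max 0 (min 1 (2 - 2 * \<bar>real N * t - real j\<bar>)))"
  have \<tau>01: "\<tau> j t \<in> {0..1}" for j t by (simp add: \<tau>_def)
  have \<tau>nz: "\<bar>real N * t - real j\<bar> < 1" if "\<tau> j t \<noteq> 0" for j t
    using that by (auto simp: \<tau>_def max_def min_def split: if_splits)
  define g where "g = (\<lambda>(c::'a \<Rightarrow> real, j) (z::real \<times> 'a). c (snd z) * \<tau> j (fst z))"
  have "bump_cover ?Z (2 * m) \<U> (g ` (\<Phi> \<times> {..N}))"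
    unfolding bump_cover_def
  proof (intro conjI ballI)
    show "finite (g ` (\<Phi> \<times> {..N}))" using fin by simp
  next
    fix h assume "h \<in> g ` (\<Phi> \<times> {..N})"
    then obtain c j where h: "h = (\<lambda>z. c (snd z) * \<tau> j (fst z))" and c: "c \<in> \<Phi>" by (auto simp: g_def)
    have "continuous_map ?Z euclideanreal (\<lambda>z. fst z)"
      using continuous_map_fst continuous_map_in_subtopology by blast
    moreover have "continuous_map ?Z euclideanreal (\<lambda>z. c (snd z))"
      using continuous_map_compose[OF continuous_map_snd cont[OF c]] by (simp add: o_def)
    ultimately show "continuous_map ?Z euclideanreal h"
      unfolding h \<tau>_def by (intro continuous_intros) auto
    fix z assume "z \<in> topspace ?Z"
    then show "h z \<in> {0..1}"
      using c01[OF c, of "snd z"] \<tau>01[of j "fst z"] unfolding h by (auto intro: mult_le_one)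
  next
    fix z assume z: "z \<in> topspace ?Z"
    obtain t x where tx: "z = (t, x)" "t \<in> {0..1}" "x \<in> topspace X" using z by auto
    have Nt: "0 \<le> real N * t" "real N * t \<le> real N" using tx(2) by (auto intro: mult_left_le)
    obtain c where c: "c \<in> \<Phi>" "c x = 1" using c1[OF tx(3)] by blast
    define j where "j = nat (round (real N * t))"
    have rd: "0 \<le> round (real N * t)" "round (real N * t) \<le> int N"
      using Nt round_mono[OF Nt(1)] round_mono[OF Nt(2)] by auto
    have "real j = of_int (round (real N * t))" using rd(1) by (simp add: j_def)
    then have "\<bar>real N * t - real j\<bar> \<le> 1 / 2"
      using of_int_round_abs_le[of "real N * t"] by linarith
    then have "\<tau> j t = 1" by (simp add: \<tau>_def)
    moreover have "j \<le> N" using rd by (simp add: j_def)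
    ultimately show "\<exists>h\<in>g ` (\<Phi> \<times> {..N}). h z = 1"
      using c by (intro bexI[of _ "g (c, j)"]) (auto simp: g_def tx)
    \<comment> \<open>The integers at distance less than 1 from \<open>N * t\<close> are among its
      floor and the successor of the floor.\<close>
    let ?J = "{nat \<lfloor>real N * t\<rfloor>, Suc (nat \<lfloor>real N * t\<rfloor>)}"
    have J: "j \<in> ?J" if "\<tau> j t \<noteq> 0" for j
      using \<tau>nz[OF that] Nt(1) by (simp, linarith)
    have "{h \<in> g ` (\<Phi> \<times> {..N}). h z \<noteq> 0} \<subseteq> g ` ({c\<in>\<Phi>. c x \<noteq> 0} \<times> ?J)"
    proof
      fix h assume "h \<in> {h \<in> g ` (\<Phi> \<times> {..N}). h z \<noteq> 0}"
      then obtain c j where h: "h = g (c, j)" "c \<in> \<Phi>" "g (c, j) z \<noteq> 0" by auto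
      then have "c x \<noteq> 0" "\<tau> j t \<noteq> 0" by (auto simp: g_def tx)
      then have "(c, j) \<in> {c\<in>\<Phi>. c x \<noteq> 0} \<times> ?J" using h(2) J by blast
      then show "h \<in> g ` ({c\<in>\<Phi>. c x \<noteq> 0} \<times> ?J)" unfolding h(1) by (rule imageI)
    qed
    then have "card {h \<in> g ` (\<Phi> \<times> {..N}). h z \<noteq> 0} \<le> card ({c\<in>\<Phi>. c x \<noteq> 0} \<times> ?J)"
      by (rule surj_card_le[rotated]) (use fin in simp)
    also have "\<dots> \<le> 2 * m"
      using cm[OF tx(3)] by (simp add: card_cartesian_product)
    finally show "card {h \<in> g ` (\<Phi> \<times> {..N}). h z \<noteq> 0} \<le> 2 * m" .
    obtain d where d: "d \<in> D" "\<And>c. c \<in> \<Phi> \<Longrightarrow> c x \<noteq> 0 \<Longrightarrow> {z\<in>topspace X. c z \<noteq> 0} \<subseteq> W d"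
      using bump_cover_star[OF Phi tx(3)] by auto
    obtain U where U: "U \<in> \<U>" "({0..1} \<inter> ball t (\<delta> d)) \<times> W d \<subseteq> U"
      using W\<delta>[of d t] d D tx by auto
    have "z' \<in> U" if c: "c \<in> \<Phi>" and nz: "g (c, j) z \<noteq> 0" and z': "z' \<in> topspace ?Z" "g (c, j) z' \<noteq> 0" for c j z'
    proof -
      obtain t' x' where tx': "z' = (t', x')" "t' \<in> {0..1}" "x' \<in> topspace X" using z' by auto
      have "\<bar>real N * t - real j\<bar> < 1" "\<bar>real N * t' - real j\<bar> < 1"
        using nz z' tx tx' by (auto simp: g_def intro!: \<tau>nz)
      then have "\<bar>real N * (t - t')\<bar> < 2" by (simp add: right_diff_distrib)
      then have "\<bar>t - t'\<bar> * real N < 2" by (simp add: abs_mult mult.commute)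
      also have "\<dots> < e * real N" using N e(1) by (simp add: field_simps)
      finally have "\<bar>t - t'\<bar> < e" using N0 by simp
      then have "t' \<in> ball t (\<delta> d)" using e(2)[OF d(1)] by (simp add: dist_real_def)
      moreover have "x' \<in> W d" using d(2)[OF c] nz z' tx tx' by (auto simp: g_def)
      ultimately show ?thesis using U tx' by auto
    qed
    then show "\<exists>U\<in>\<U>. \<forall>h\<in>g ` (\<Phi> \<times> {..N}). h z \<noteq> 0 \<longrightarrow> {z \<in> topspace ?Z. h z \<noteq> 0} \<subseteq> U"
      using U(1) by (intro bexI[of _ U]) blast+
  qed
  then show "\<exists>\<Phi>. bump_cover ?Z (2 * m) \<U> \<Phi>" by blast
qed

section \<open>Weak direct limit charts\<close>

lemma is_chart_homeomorphic_maps: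
  assumes "is_chart X U \<phi> V E"
  shows "homeomorphic_maps (subtopology X U) (subtopology (vtop E) V) \<phi> (inv_into U \<phi>)"
proof -
  have hm: "homeomorphic_map (subtopology X U) (subtopology (vtop E) V) \<phi>"
    and UV: "U \<subseteq> topspace X" "V \<subseteq> topspace (vtop E)"
    using assms openin_subset by (auto simp: is_chart_def)
  then obtain g where g: "homeomorphic_maps (subtopology X U) (subtopology (vtop E) V) \<phi> g"
    by (auto simp: homeomorphic_map_maps)
  have inj: "inj_on \<phi> U" and im: "\<phi> ` U = V"
    using homeomorphic_imp_injective_map[OF hm] homeomorphic_imp_surjective_map[OF hm] UV
    by (auto simp: Int_absorb1)
  have "g v = inv_into U \<phi> v" if v: "v \<in> V" for v
  proof -
    obtain x where x: "x \<in> U" "v = \<phi> x" using v im by blast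
    then have "g v = x" using g UV by (auto simp: homeomorphic_maps_def)
    then show ?thesis using x inj by simp
  qed
  then show ?thesis
    using g UV by (elim homeomorphic_maps_eq) auto
qed

context
  fixes X :: "'a topology" and U \<phi> V and E :: "'e vs_with_topology"
  assumes chart: "is_chart X U \<phi> V E"
begin

lemma chart_open: "openin X U" "openin (vtop E) V"
  and chart_tvs: "topological_vector_space E"
  using chart by (auto simp: is_chart_def)

lemma chart_subset: "U \<subseteq> topspace X" "V \<subseteq> carrier E"
  using chart_open openin_subset topspace_vtop[OF chart_tvs] by blast+

lemma chart_maps:
  shows chart_in: "x \<in> U \<Longrightarrow> \<phi> x \<in> V"
    and chart_inv_in: "v \<in> V \<Longrightarrow> inv_into U \<phi> v \<in> U"
    and chart_inv: "x \<in> U \<Longrightarrow> inv_into U \<phi> (\<phi> x) = x"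
    and chart_of_inv: "v \<in> V \<Longrightarrow> \<phi> (inv_into U \<phi> v) = v"
proof -
  have h: "homeomorphic_maps (subtopology X U) (subtopology (vtop E) V) \<phi> (inv_into U \<phi>)"
    by (rule is_chart_homeomorphic_maps[OF chart])
  have t: "topspace (subtopology X U) = U" "topspace (subtopology (vtop E) V) = V"
    using chart_subset by (simp_all add: topspace_vtop[OF chart_tvs] Int_absorb1)
  have c: "continuous_map (subtopology X U) (subtopology (vtop E) V) \<phi>"
      "continuous_map (subtopology (vtop E) V) (subtopology X U) (inv_into U \<phi>)"
    using h by (simp_all add: homeomorphic_maps_def)
  note * = c[THEN continuous_map_funspace, unfolded t]
  show "x \<in> U \<Longrightarrow> \<phi> x \<in> V" "v \<in> V \<Longrightarrow> inv_into U \<phi> v \<in> U"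
    using * by auto
  show "x \<in> U \<Longrightarrow> inv_into U \<phi> (\<phi> x) = x" "v \<in> V \<Longrightarrow> \<phi> (inv_into U \<phi> v) = v"
    using h unfolding homeomorphic_maps_def t by auto
qed

lemma chart_carrier: "x \<in> U \<Longrightarrow> \<phi> x \<in> carrier E"
  using chart_in chart_subset by blast

lemma continuous_map_into_chart:
  assumes "continuous_map Y X f" "\<And>y. y \<in> topspace Y \<Longrightarrow> f y \<in> U"
  shows "continuous_map Y (vtop E) (\<lambda>y. \<phi> (f y))"
proof -
  have "continuous_map Y (subtopology X U) f"
    using assms by (auto simp: continuous_map_in_subtopology)
  moreover have "continuous_map (subtopology X U) (subtopology (vtop E) V) \<phi>"
    using is_chart_homeomorphic_maps[OF chart] by (simp add: homeomorphic_maps_def)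
  ultimately have "continuous_map Y (subtopology (vtop E) V) (\<phi> \<circ> f)"
    by (rule continuous_map_compose)
  then show ?thesis by (simp add: continuous_map_in_subtopology o_def)
qed

lemma continuous_map_inv_chart:
  assumes "continuous_map Y (vtop E) T" "\<And>y. y \<in> topspace Y \<Longrightarrow> T y \<in> V"
  shows "continuous_map Y X (\<lambda>y. inv_into U \<phi> (T y))"
proof -
  have "continuous_map Y (subtopology (vtop E) V) T"
    using assms by (auto simp: continuous_map_in_subtopology)
  moreover have "continuous_map (subtopology (vtop E) V) (subtopology X U) (inv_into U \<phi>)"
    using is_chart_homeomorphic_maps[OF chart] by (simp add: homeomorphic_maps_def)
  ultimately have "continuous_map Y (subtopology X U) (inv_into U \<phi> \<circ> T)"
    by (rule continuous_map_compose)
  then show ?thesis by (simp add: continuous_map_in_subtopology o_def)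
qed

lemma openin_chart_preimage:
  assumes "openin (vtop E) G"
  shows "openin X {x \<in> U. \<phi> x \<in> G}"
proof -
  have "continuous_map (subtopology X U) (vtop E) \<phi>"
    using is_chart_homeomorphic_maps[OF chart]
    by (simp add: homeomorphic_maps_def continuous_map_in_subtopology)
  then have "openin (subtopology X U) {x \<in> topspace (subtopology X U). \<phi> x \<in> G}"
    using assms by (rule openin_continuous_map_preimage)
  moreover have "{x \<in> topspace (subtopology X U). \<phi> x \<in> G} = {x \<in> U. \<phi> x \<in> G}"
    using chart_subset(1) by auto
  ultimately show ?thesis
    using chart_open(1) by (simp add: openin_open_subtopology)
qed

lemma openin_chart_image:
  assumes "openin X W"
  shows "openin (vtop E) {v \<in> V. inv_into U \<phi> v \<in> W}"
proof -
  have "continuous_map (subtopology (vtop E) V) X (inv_into U \<phi>)"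
    using is_chart_homeomorphic_maps[OF chart]
    by (simp add: homeomorphic_maps_def continuous_map_in_subtopology)
  then have "openin (subtopology (vtop E) V) {x \<in> topspace (subtopology (vtop E) V). inv_into U \<phi> x \<in> W}"
    using assms by (rule openin_continuous_map_preimage)
  moreover have "{x \<in> topspace (subtopology (vtop E) V). inv_into U \<phi> x \<in> W} = {v \<in> V. inv_into U \<phi> v \<in> W}"
    using chart_subset(2) topspace_vtop[OF chart_tvs] by auto
  ultimately show ?thesis
    using chart_open(2) by (simp add: openin_open_subtopology)
qed

end

section \<open>Directed sets and increasing open covers of compact spaces\<close>

lemma directed_set_trans:
  assumes "directed_set A leq" "a \<in> A" "b \<in> A" "c \<in> A" "leq a b" "leq b c"
  shows "leq a c"
proof -
  have "\<forall>a\<in>A. \<forall>b\<in>A. \<forall>c\<in>A. leq a b \<longrightarrow> leq b c \<longrightarrow> leq a c"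
    using assms(1) unfolding directed_set_def by (elim conjE)
  from this[rule_format, OF assms(2-6)] show ?thesis .
qed

lemma directed_set_upper:
  assumes "directed_set A leq" "a \<in> A" "b \<in> A"
  shows "\<exists>c\<in>A. leq a c \<and> leq b c"
proof -
  have "\<forall>a\<in>A. \<forall>b\<in>A. \<exists>c\<in>A. leq a c \<and> leq b c"
    using assms(1) unfolding directed_set_def by (elim conjE)
  from this[rule_format, OF assms(2,3)] show ?thesis .
qed

lemma directed_set_refl:
  assumes "directed_set A leq" "a \<in> A"
  shows "leq a a"
proof -
  have "\<forall>a\<in>A. leq a a"
    using assms(1) unfolding directed_set_def by (elim conjE)
  from this[rule_format, OF assms(2)] show ?thesis .
qed

lemma directed_upper_bound:
  assumes "directed_set A leq" "a \<in> A" "finite D" "D \<subseteq> A"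
  shows "\<exists>b\<in>A. leq a b \<and> (\<forall>d\<in>D. leq d b)"
  using assms(3,4)
proof (induction D)
  case empty
  then show ?case using directed_set_refl[OF assms(1,2)] assms(2) by auto
next
  case (insert d D)
  then obtain b where b: "b \<in> A" "leq a b" "\<forall>d\<in>D. leq d b" by auto
  then obtain c where c: "c \<in> A" "leq b c" "leq d c"
    using directed_set_upper[OF assms(1), of b d] insert.prems by auto
  have "leq x c" if "x \<in> A" "leq x b" for x
    using directed_set_trans[OF assms(1)] that b c by blast
  then show ?case using b c assms insert.prems by (intro bexI[of _ c]) auto
qed

text \<open>A finite subcover has indices with a common upper bound, and by monotonicity the set at
  that bound contains all the others.\<close>

lemma directed_compact_cover:
  assumes dir: "directed_set A leq" and a: "a \<in> A" and Y: "compact_space Y"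
    and opn: "\<And>b. b \<in> A \<Longrightarrow> leq a b \<Longrightarrow> openin Y (W b)"
    and mono: "\<And>b c. b \<in> A \<Longrightarrow> c \<in> A \<Longrightarrow> leq a b \<Longrightarrow> leq b c \<Longrightarrow> W b \<subseteq> W c"
    and cov: "\<And>y. y \<in> topspace Y \<Longrightarrow> \<exists>b\<in>A. leq a b \<and> y \<in> W b"
  shows "\<exists>b\<in>A. leq a b \<and> topspace Y \<subseteq> W b"
proof -
  let ?B = "{b\<in>A. leq a b}"
  have "\<exists>\<F>. finite \<F> \<and> \<F> \<subseteq> W ` ?B \<and> topspace Y \<subseteq> \<Union>\<F>"
    using Y opn cov by (intro compactinD) (auto simp: compact_space_def)
  then obtain \<F> where F: "finite \<F>" "\<F> \<subseteq> W ` ?B" "topspace Y \<subseteq> \<Union>\<F>" by blast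
  obtain D where D: "finite D" "D \<subseteq> ?B" "\<F> = W ` D"
    using finite_subset_image[OF F(1,2)] by blast
  obtain b where b: "b \<in> A" "leq a b" "\<forall>d\<in>D. leq d b"
    using directed_upper_bound[OF dir a D(1)] D(2) by auto
  have "W d \<subseteq> W b" if "d \<in> D" for d
    using mono[of d b] D(2) b that by blast
  then show ?thesis using b F(3) D(3) by blast
qed

locale directed_spaces =
  fixes A :: "'i set" and leq :: "'i \<Rightarrow> 'i \<Rightarrow> bool" and N :: "'i \<Rightarrow> 'a topology" and M :: "'a topology"
  assumes directed_union: "directed_union A leq N M"
begin

lemma directed: "directed_set A leq"
  using directed_union by (simp add: directed_union_def)

lemma leq_refl: "a \<in> A \<Longrightarrow> leq a a"
  by (rule directed_set_refl[OF directed])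

lemma leq_trans: "a \<in> A \<Longrightarrow> b \<in> A \<Longrightarrow> c \<in> A \<Longrightarrow> leq a b \<Longrightarrow> leq b c \<Longrightarrow> leq a c"
  by (rule directed_set_trans[OF directed])

lemma upper_bound: "a \<in> A \<Longrightarrow> b \<in> A \<Longrightarrow> \<exists>c\<in>A. leq a c \<and> leq b c"
  by (rule directed_set_upper[OF directed])

lemma topspace_mono: "a \<in> A \<Longrightarrow> b \<in> A \<Longrightarrow> leq a b \<Longrightarrow> topspace (N a) \<subseteq> topspace (N b)"
  using directed_union by (simp add: directed_union_def)

lemma continuous_map_step:
  assumes "continuous_map Y (N a) f" "a \<in> A" "b \<in> A" "leq a b"
  shows "continuous_map Y (N b) f"
proof -
  have "continuous_map (N a) (N b) id"
    using directed_union assms by (simp add: directed_union_def)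
  from continuous_map_compose[OF assms(1) this] show ?thesis by (simp add: o_def)
qed

lemma continuous_map_limit:
  assumes "continuous_map Y (N a) f" "a \<in> A"
  shows "continuous_map Y M f"
proof -
  have "continuous_map (N a) M id"
    using directed_union assms by (simp add: directed_union_def)
  from continuous_map_compose[OF assms(1) this] show ?thesis by (simp add: o_def)
qed

end

section \<open>One weak direct limit chart with its witnesses fixed\<close>

locale weak_limit_chart = directed_spaces A leq N M
  for A :: "'i set" and leq and N :: "'i \<Rightarrow> 'a topology" and M +
  fixes U :: "'a set" and \<phi> :: "'a \<Rightarrow> 'e" and V E and a0 :: 'i
    and U' :: "'i \<Rightarrow> 'a set" and \<phi>' :: "'i \<Rightarrow> 'a \<Rightarrow> 'e" and V' :: "'i \<Rightarrow> 'e set"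
    and E' :: "'i \<Rightarrow> 'e vs_with_topology" and l :: "'i \<Rightarrow> 'e \<Rightarrow> 'e" and l' :: "'i \<Rightarrow> 'i \<Rightarrow> 'e \<Rightarrow> 'e"
  assumes chart: "is_chart M U \<phi> V E"
    and a0: "a0 \<in> A"
    and charts: "a \<in> A \<Longrightarrow> leq a0 a \<Longrightarrow> is_chart (N a) (U' a) (\<phi>' a) (V' a) (E' a)"
    and lin: "a \<in> A \<Longrightarrow> leq a0 a \<Longrightarrow> continuous_linear_map (E' a) E (l a)"
    and sub: "a \<in> A \<Longrightarrow> leq a0 a \<Longrightarrow> U' a \<subseteq> U"
    and phi: "a \<in> A \<Longrightarrow> leq a0 a \<Longrightarrow> x \<in> U' a \<Longrightarrow> \<phi> x = l a (\<phi>' a x)"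
    and lin': "a \<in> A \<Longrightarrow> b \<in> A \<Longrightarrow> leq a0 a \<Longrightarrow> leq a b \<Longrightarrow> continuous_linear_map (E' a) (E' b) (l' b a)"
    and sub': "a \<in> A \<Longrightarrow> b \<in> A \<Longrightarrow> leq a0 a \<Longrightarrow> leq a b \<Longrightarrow> U' a \<subseteq> U' b"
    and phi': "a \<in> A \<Longrightarrow> b \<in> A \<Longrightarrow> leq a0 a \<Longrightarrow> leq a b \<Longrightarrow> x \<in> U' a \<Longrightarrow> \<phi>' b x = l' b a (\<phi>' a x)"
    and U_eq: "U = (\<Union>a\<in>{a\<in>A. leq a0 a}. U' a)"
begin

lemmas tvs = chart_tvs[OF chart]
lemmas tvs' = chart_tvs[OF charts]

lemma finite_in_chart:
  assumes "finite P" "P \<subseteq> U" "a \<in> A"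
  shows "\<exists>b\<in>A. leq a b \<and> leq a0 b \<and> P \<subseteq> U' b"
  using assms(1,2)
proof (induction P)
  case empty
  then show ?case using upper_bound[OF assms(3) a0] by auto
next
  case (insert x P)
  then obtain b where b: "b \<in> A" "leq a b" "leq a0 b" "P \<subseteq> U' b" by auto
  obtain c where c: "c \<in> A" "leq a0 c" "x \<in> U' c" using insert.prems U_eq by auto
  obtain d where d: "d \<in> A" "leq b d" "leq c d" using upper_bound b c by blast
  have "leq a d" "leq a0 d" using leq_trans a0 assms(3) b c d by blast+
  moreover have "insert x P \<subseteq> U' d" using sub'[of b d] sub'[of c d] b c d by blast
  ultimately show ?case using d(1) by blast
qed

text \<open>The sets \<open>U' b\<close> are open in \<open>N b\<close> and need not be open in
  \<open>M\<close>. This is why \<open>f\<close> has to be continuous into a member: only then are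
  the preimages of the \<open>U' b\<close> an increasing open cover.\<close>

lemma compact_in_chart:
  assumes Y: "compact_space Y" and f: "continuous_map Y (N a) f" and a: "a \<in> A" "leq a0 a"
    and fU: "\<And>y. y \<in> topspace Y \<Longrightarrow> f y \<in> U"
  shows "\<exists>b\<in>A. leq a b \<and> (\<forall>y\<in>topspace Y. f y \<in> U' b)"
proof -
  have a0b: "leq a0 b" if "b \<in> A" "leq a b" for b using leq_trans a0 a that by blast
  have "\<exists>b\<in>A. leq a b \<and> topspace Y \<subseteq> {y \<in> topspace Y. f y \<in> U' b}"
  proof (rule directed_compact_cover[OF directed a(1) Y])
    fix b assume b: "b \<in> A" "leq a b"
    have "openin (N b) (U' b)" using chart_open(1)[OF charts] a0b b by blast
    then show "openin Y {y \<in> topspace Y. f y \<in> U' b}"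
      using continuous_map_step[OF f a(1) b] by (rule openin_continuous_map_preimage[rotated])
  next
    fix b c assume "b \<in> A" "c \<in> A" "leq a b" "leq b c"
    then show "{y \<in> topspace Y. f y \<in> U' b} \<subseteq> {y \<in> topspace Y. f y \<in> U' c}"
      using sub'[of b c] a0b by blast
  next
    fix y assume y: "y \<in> topspace Y"
    have "\<exists>b\<in>A. leq a b \<and> leq a0 b \<and> {f y} \<subseteq> U' b"
      by (rule finite_in_chart) (use fU[OF y] a in auto)
    then show "\<exists>b\<in>A. leq a b \<and> y \<in> {y \<in> topspace Y. f y \<in> U' b}" using y by auto
  qed
  then show ?thesis by blast
qed

text \<open>The axioms relate \<open>l b\<close>, \<open>l c\<close> and \<open>l' c b\<close> only
  through the chart values, hence only on \<open>V' b\<close>. If \<open>V' b\<close> is nonempty it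
  absorbs every vector around one of its points, and linearity extends the identity to all of
  \<open>E' b\<close>.\<close>

lemma limit_map_compatible:
  assumes "b \<in> A" "c \<in> A" "leq a0 b" "leq b c" "U' b \<noteq> {}" "v \<in> carrier (E' b)"
  shows "l c (l' c b v) = l b v"
proof -
  have a0c: "leq a0 c" using leq_trans a0 assms by blast
  note Eb = tvs'[OF assms(1,3)] and Ec = tvs'[OF assms(2) a0c]
  note lb = lin[OF assms(1,3)] and lc = lin[OF assms(2) a0c] and lcb = lin'[OF assms(1,2,3,4)]
  obtain x0 where x0: "x0 \<in> U' b" using assms(5) by blast
  let ?p = "\<phi>' b x0"
  have p: "?p \<in> V' b" "?p \<in> carrier (E' b)"
    using chart_in[OF charts] chart_carrier[OF charts] assms x0 by blast+
  \<comment> \<open>A point \<open>w\<close> of \<open>V' b\<close> is the chart value of some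
    \<open>x\<close> in \<open>U' b\<close>, which also lies in \<open>U' c\<close>; both sides are
    then equal to \<open>\<phi> x\<close>.\<close>
  have on_chart: "l c (l' c b w) = l b w" if "w \<in> V' b" for w
  proof -
    let ?x = "inv_into (U' b) (\<phi>' b) w"
    have x: "?x \<in> U' b" "\<phi>' b ?x = w"
      using chart_inv_in[OF charts] chart_of_inv[OF charts] assms that by blast+
    then have "?x \<in> U' c" using sub' assms by blast
    then show ?thesis
      using phi[OF assms(1,3) x(1)] phi[OF assms(2) a0c] phi'[OF assms(1-4) x(1)] x(2) by simp
  qed
  obtain t where t: "t \<noteq> 0" "mix (E' b) t ?p v \<in> V' b"
    using mix_absorbing[OF Eb chart_open(2)[OF charts[OF assms(1,3)]] p(1) assms(6)] by blast
  note cl4 = continuous_linear_map_carrier[OF Eb Ec lcb p(2)]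
    and cl5 = continuous_linear_map_carrier[OF Eb Ec lcb assms(6)]
  note cl = continuous_linear_map_carrier[OF Eb tvs lb p(2)]
    continuous_linear_map_carrier[OF Eb tvs lb assms(6)]
    continuous_linear_map_carrier[OF Ec tvs lc cl5] cl4 cl5
  have "mix E t (l b ?p) (l c (l' c b v)) = mix E t (l c (l' c b ?p)) (l c (l' c b v))"
    by (simp add: on_chart[OF p(1)])
  also have "\<dots> = l c (l' c b (mix (E' b) t ?p v))"
    using continuous_linear_map_mix[OF Eb Ec lcb p(2) assms(6)]
      continuous_linear_map_mix[OF Ec tvs lc cl(4,5)] by simp
  also have "\<dots> = l b (mix (E' b) t ?p v)" by (rule on_chart[OF t(2)])
  also have "\<dots> = mix E t (l b ?p) (l b v)"
    by (rule continuous_linear_map_mix[OF Eb tvs lb p(2) assms(6)])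
  finally show ?thesis by (rule mix_cancel[OF tvs cl(1,3,2) t(1)])
qed

text \<open>Injectivity of \<open>\<phi>\<close> is available only on chart domains, so
  \<open>v\<close> is first moved close to \<open>?p = \<phi>' b x\<close>. A small mix of
  \<open>?p\<close> with \<open>v\<close> is the chart value of some \<open>?y\<close>, and
  \<open>\<phi> ?y\<close> is a mix of \<open>\<phi> x\<close> with itself. Thus
  \<open>?y = x\<close>, and cancelling the mix gives \<open>v = ?p\<close>.\<close>

lemma limit_map_inj:
  assumes "b \<in> A" "leq a0 b" "x \<in> U' b" "v \<in> carrier (E' b)" "l b v = \<phi> x"
  shows "v = \<phi>' b x"
proof -
  note Eb = tvs'[OF assms(1,2)] and lb = lin[OF assms(1,2)] and ch = charts[OF assms(1,2)]
  let ?p = "\<phi>' b x"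
  have p: "?p \<in> V' b" "?p \<in> carrier (E' b)"
    using chart_in[OF ch] chart_carrier[OF ch] assms by blast+
  have lp: "l b ?p = \<phi> x" using phi assms by simp
  obtain t where t: "t \<noteq> 0" "mix (E' b) t ?p v \<in> V' b"
    using mix_absorbing[OF Eb chart_open(2)[OF ch] p(1) assms(4)] by blast
  let ?y = "inv_into (U' b) (\<phi>' b) (mix (E' b) t ?p v)"
  have y: "?y \<in> U' b" "\<phi>' b ?y = mix (E' b) t ?p v"
    using chart_inv_in[OF ch t(2)] chart_of_inv[OF ch t(2)] by auto
  have "\<phi> ?y = l b (mix (E' b) t ?p v)" using phi[OF assms(1,2) y(1)] y(2) by simp
  also have "\<dots> = mix E t (\<phi> x) (\<phi> x)"
    using continuous_linear_map_mix[OF Eb tvs lb p(2) assms(4)] lp assms(5) by simp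
  also have "\<dots> = \<phi> x"
    using sub[OF assms(1,2)] assms(3) by (intro mix_same[OF tvs] chart_carrier[OF chart]) auto
  finally have phi_eq: "\<phi> ?y = \<phi> x" .
  have "x \<in> U" "?y \<in> U" using sub[OF assms(1,2)] y(1) assms(3) by auto
  then have "?y = x"
    using chart_inv[OF chart, of ?y] chart_inv[OF chart, of x] phi_eq by simp
  then have "mix (E' b) t ?p v = mix (E' b) t ?p ?p"
    using y(2) mix_same[OF Eb p(2)] by simp
  then show ?thesis by (rule mix_cancel[OF Eb p(2) assms(4) p(2) t(1)])
qed

text \<open>How a map is recognised as continuous into a member: its chart expression must factor
  continuously through some \<open>E' b\<close>. The set \<open>W c\<close> of points whose lifted
  value lies in \<open>V' c\<close> is open by continuity of \<open>T\<close>. By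
  \<open>limit_map_inj\<close> it is also the set of points with \<open>G y\<close> in
  \<open>U' c\<close>, and in this form it grows with \<open>c\<close> and eventually contains every
  point. Compactness yields one \<open>c\<close> for all points, and there \<open>G\<close> is an
  inverse chart applied to a continuous map.\<close>

lemma continuous_lift:
  assumes Y: "compact_space Y" and b: "b \<in> A" "leq a0 b" "U' b \<noteq> {}"
    and T: "continuous_map Y (vtop (E' b)) T"
    and GU: "\<And>y. y \<in> topspace Y \<Longrightarrow> G y \<in> U"
    and GT: "\<And>y. y \<in> topspace Y \<Longrightarrow> \<phi> (G y) = l b (T y)"
  shows "\<exists>c\<in>A. leq b c \<and> continuous_map Y (N c) G"
proof -
  have a0c: "leq a0 c" if "c \<in> A" "leq b c" for c using leq_trans a0 b that by blast
  have TE: "T y \<in> carrier (E' b)" if "y \<in> topspace Y" for y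
    using continuous_map_funspace[OF T] that topspace_vtop[OF tvs'[OF b(1,2)]] by auto
  define W where "W c = {y \<in> topspace Y. l' c b (T y) \<in> V' c}" for c
  have lT: "continuous_map Y (vtop (E' c)) (\<lambda>y. l' c b (T y))" if c: "c \<in> A" "leq b c" for c
  proof -
    have "continuous_map (vtop (E' b)) (vtop (E' c)) (l' c b)"
      using lin'[OF b(1) c(1) b(2) c(2)] by (simp add: continuous_linear_map_def)
    from continuous_map_compose[OF T this] show ?thesis by (simp add: o_def)
  qed
  have lTE: "l' c b (T y) \<in> carrier (E' c)" "l c (l' c b (T y)) = \<phi> (G y)"
    if c: "c \<in> A" "leq b c" "y \<in> topspace Y" for c y
    using continuous_linear_map_carrier[OF tvs'[OF b(1,2)] tvs'[OF c(1) a0c[OF c(1,2)]]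
        lin'[OF b(1) c(1) b(2) c(2)] TE[OF c(3)]]
      limit_map_compatible[OF b(1) c(1) b(2) c(2) b(3) TE[OF c(3)]] GT[OF c(3)] by auto
  have W1: "G y \<in> U' c \<and> \<phi>' c (G y) = l' c b (T y)" if c: "c \<in> A" "leq b c" and y: "y \<in> W c" for c y
  proof -
    note ch = charts[OF c(1) a0c[OF c]]
    let ?x = "inv_into (U' c) (\<phi>' c) (l' c b (T y))"
    have y': "y \<in> topspace Y" "l' c b (T y) \<in> V' c" using y by (auto simp: W_def)
    have x: "?x \<in> U' c" "\<phi>' c ?x = l' c b (T y)"
      using chart_inv_in[OF ch y'(2)] chart_of_inv[OF ch y'(2)] by auto
    have phi_eq: "\<phi> ?x = \<phi> (G y)"
      using phi[OF c(1) a0c[OF c] x(1)] x(2) lTE(2)[OF c y'(1)] by simp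
    have "?x \<in> U" by (rule subsetD[OF sub[OF c(1) a0c[OF c]] x(1)])
    then have "?x = inv_into U \<phi> (\<phi> ?x)" by (rule chart_inv[OF chart, symmetric])
    also have "\<dots> = G y" unfolding phi_eq by (rule chart_inv[OF chart GU[OF y'(1)]])
    finally have "?x = G y" .
    then show ?thesis using x by simp
  qed
  have W2: "y \<in> W c" if c: "c \<in> A" "leq b c" and y: "y \<in> topspace Y" "G y \<in> U' c" for c y
  proof -
    have "l' c b (T y) = \<phi>' c (G y)"
      using limit_map_inj[OF c(1) a0c[OF c] y(2) lTE[OF c y(1)]] .
    then show ?thesis
      using chart_in[OF charts[OF c(1) a0c[OF c]] y(2)] y(1) by (simp add: W_def)
  qed
  have "\<exists>c\<in>A. leq b c \<and> topspace Y \<subseteq> W c"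
  proof (rule directed_compact_cover[OF directed b(1) Y])
    fix c assume c: "c \<in> A" "leq b c"
    show "openin Y (W c)"
      unfolding W_def
      by (rule openin_continuous_map_preimage[OF lT[OF c] chart_open(2)[OF charts[OF c(1) a0c[OF c]]]])
  next
    fix c d assume c: "c \<in> A" "d \<in> A" "leq b c" "leq c d"
    show "W c \<subseteq> W d"
    proof
      fix y assume y: "y \<in> W c"
      then have "G y \<in> U' d" using W1[OF c(1,3)] sub'[OF c(1,2) a0c[OF c(1,3)] c(4)] by blast
      moreover have "leq b d" using leq_trans b c by blast
      ultimately show "y \<in> W d" using W2[OF c(2)] y by (auto simp: W_def)
    qed
  next
    fix y assume y: "y \<in> topspace Y"
    have "\<exists>c\<in>A. leq b c \<and> leq a0 c \<and> {G y} \<subseteq> U' c"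
      by (rule finite_in_chart) (use GU[OF y] b in auto)
    then show "\<exists>c\<in>A. leq b c \<and> y \<in> W c" using W2 y by blast
  qed
  then obtain c where c: "c \<in> A" "leq b c" "topspace Y \<subseteq> W c" by blast
  note ch = charts[OF c(1) a0c[OF c(1,2)]]
  have "continuous_map Y (N c) (\<lambda>y. inv_into (U' c) (\<phi>' c) (l' c b (T y)))"
    by (rule continuous_map_inv_chart[OF ch lT[OF c(1,2)]]) (use c(3) in \<open>auto simp: W_def\<close>)
  moreover have "inv_into (U' c) (\<phi>' c) (l' c b (T y)) = G y" if "y \<in> topspace Y" for y
    using W1[OF c(1,2), of y] chart_inv[OF ch, of "G y"] c(3) that by auto
  ultimately have "continuous_map Y (N c) G" by (rule continuous_map_eq)
  then show ?thesis using c by blast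
qed

end

section \<open>Deforming a map into a member of the union\<close>

lemma continuous_map_subtopology_Un:
  assumes "closedin X S" "closedin X T"
    and "continuous_map (subtopology X S) Y f" "continuous_map (subtopology X T) Y f"
  shows "continuous_map (subtopology X (S \<union> T)) Y f"
proof (rule continuous_map_closed_union)
  show "closedin (subtopology X (S \<union> T)) S" "closedin (subtopology X (S \<union> T)) T"
    using assms(1,2) by (auto intro: closedin_subset_topspace)
  show "continuous_map (subtopology (subtopology X (S \<union> T)) S) Y f"
    "continuous_map (subtopology (subtopology X (S \<union> T)) T) Y f"
    using assms(3,4) by (simp_all add: subtopology_subtopology Int_absorb1)
qed auto

context weak_limit_chart
begin

text \<open>
  Inside one chart, \<open>f\<close> is moved towards an interpolation \<open>\<sigma>\<close> of finitely many of its values,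
  which all lie in a common \<open>E' b\<close>. The movement happens where \<open>\<psi>\<close> is large and \<open>\<rho>\<close>
  is not 1; where \<open>0 < \<rho> < 1\<close> the map \<open>f\<close> itself already takes values in some \<open>N a\<close>.
\<close>

lemma chart_step:
  fixes X :: "'x topology"
  assumes X: "compact_space X" and dim: "bump_dimension X m"
    and f: "continuous_map X M f" and C: "closedin X C" and a: "a \<in> A"
    and fC: "continuous_map (subtopology X C) (N a) f"
    and \<rho>: "continuous_map X euclideanreal \<rho>" "\<And>x. x \<in> topspace X \<Longrightarrow> \<rho> x \<in> {0..1}"
    and \<rho>C: "\<And>x. x \<in> topspace X \<Longrightarrow> \<rho> x \<noteq> 0 \<Longrightarrow> x \<in> C"
    and \<psi>: "continuous_map X euclideanreal \<psi>"
    and fU: "\<And>x. x \<in> topspace X \<Longrightarrow> 1/3 \<le> \<psi> x \<Longrightarrow> f x \<in> U"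
    and J: "finite J" "\<And>j. j \<in> J \<Longrightarrow> closedin X (Lf j)" "\<And>j. j \<in> J \<Longrightarrow> openin M (Uf j)"
      "\<And>j x. j \<in> J \<Longrightarrow> x \<in> Lf j \<Longrightarrow> f x \<in> Uf j"
  shows "\<exists>b\<in>A. leq a b \<and> (\<exists>f'.
    homotopic_with (\<lambda>h. \<forall>x\<in>topspace X. \<rho> x = 1 \<longrightarrow> h x = f x) X M f f' \<and>
    (\<forall>j\<in>J. \<forall>x\<in>Lf j. f' x \<in> Uf j) \<and>
    continuous_map (subtopology X (C \<union> {x \<in> topspace X. 2/3 \<le> \<psi> x})) (N b) f')"
proof -
  \<comment> \<open>The map is changed on \<open>L\<close> only and is to become continuous into a
    member on \<open>K\<close>; the gap between 1/3 and 2/3 leaves room for the ramp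
    \<open>\<eta>\<close>.\<close>
  define L where "L = {x \<in> topspace X. 1/3 \<le> \<psi> x}"
  define K where "K = {x \<in> topspace X. 2/3 \<le> \<psi> x}"
  show ?thesis
  proof (cases "L = {}")
    case True
    then have "C \<union> {x \<in> topspace X. 2/3 \<le> \<psi> x} = C" by (force simp: L_def)
    moreover have "homotopic_with (\<lambda>h. \<forall>x\<in>topspace X. \<rho> x = 1 \<longrightarrow> h x = f x) X M f f"
      using f by simp
    ultimately show ?thesis
      using fC leq_refl[OF a] a J(4) by (intro bexI[of _ a] conjI exI[of _ f]) simp_all
  next
    case False
    \<comment> \<open>This point supplies the start vector of the interpolation, and
      \<open>f x0\<close> will witness that \<open>U' b\<close> is nonempty, as
      \<open>continuous_lift\<close> demands.\<close>
    then obtain x0 where x0: "x0 \<in> L" by blast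
    have LX: "x \<in> topspace X" if "x \<in> L" for x using that by (simp add: L_def)
    have LfX: "x \<in> topspace X" if "x \<in> Lf j" "j \<in> J" for x j
      using closedin_subset[OF J(2)[OF that(2)]] that by blast
    have LU: "f x \<in> U" if "x \<in> L" for x using that fU by (simp add: L_def)
    define F where "F x = \<phi> (f x)" for x
    have FE: "F x \<in> carrier E" if "x \<in> L" for x
      using chart_carrier[OF chart LU[OF that]] by (simp add: F_def)
    \<comment> \<open>The target around \<open>F x\<close>: besides staying in the chart, a point of
      \<open>Lf j\<close> has to keep its image in \<open>Uf j\<close>.\<close>
    define V1 where "V1 x = V \<inter> (\<Inter>j\<in>{j\<in>J. x \<in> Lf j}. {v \<in> V. inv_into U \<phi> v \<in> Uf j})" for x
    have V1_open: "openin (vtop E) (V1 x)" for x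
    proof -
      have "openin (vtop E) (\<Inter>i\<in>insert V ((\<lambda>j. {v \<in> V. inv_into U \<phi> v \<in> Uf j}) ` {j\<in>J. x \<in> Lf j}). i)"
        by (rule openin_Inter)
          (use J(1) openin_chart_image[OF chart J(3)] chart_open(2)[OF chart] in auto)
      then show ?thesis by (simp add: V1_def)
    qed
    have V1_F: "F x \<in> V1 x" if "x \<in> L" for x
      using chart_in[OF chart LU[OF that]] chart_inv[OF chart LU[OF that]] J(4)
      by (auto simp: V1_def F_def)
    \<comment> \<open>The bound is \<open>Suc m\<close> because at most \<open>m\<close> bump
      functions are nonzero at a point and the final mix with \<open>F x\<close> itself counts as
      one more step.\<close>
    define good where "good x G \<longleftrightarrow> openin (vtop E) G \<and> F x \<in> G \<and> G \<subseteq> V1 x \<and>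
        (\<forall>xs. \<forall>u\<in>G. (\<forall>(c, w)\<in>set xs. c \<in> {0..1} \<and> w \<in> carrier E \<and> (c \<noteq> 0 \<longrightarrow> w \<in> G)) \<longrightarrow>
       length (filter (\<lambda>x. fst x \<noteq> 0) xs) \<le> Suc m \<longrightarrow> mixes E xs u \<in> V1 x)" for x G
    have "\<exists>G. good x G" if "x \<in> L" for x
      unfolding good_def by (rule mixes_neighbourhood[OF tvs V1_open V1_F[OF that]])
    then obtain G where G: "\<And>x. x \<in> L \<Longrightarrow> good x (G x)" by metis
    have G_open: "openin (vtop E) (G x)" and FG: "F x \<in> G x" if "x \<in> L" for x
      using G[OF that] by (simp_all add: good_def)
    have G_mixes: "mixes E xs u \<in> V1 x"
      if "x \<in> L" "u \<in> G x" "\<And>c w. (c, w) \<in> set xs \<Longrightarrow> c \<in> {0..1} \<and> w \<in> carrier E \<and> (c \<noteq> 0 \<longrightarrow> w \<in> G x)"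
        "length (filter (\<lambda>x. fst x \<noteq> 0) xs) \<le> Suc m" for x xs u
    proof -
      have "\<forall>(c, w)\<in>set xs. c \<in> {0..1} \<and> w \<in> carrier E \<and> (c \<noteq> 0 \<longrightarrow> w \<in> G x)"
        using that(3) by blast
      with G[OF that(1)] that(2,4) show ?thesis unfolding good_def by blast
    qed
    \<comment> \<open>Those \<open>Lf j\<close> that miss \<open>x\<close> are removed so that every
      \<open>z\<close> in \<open>W x\<close> obeys only constraints which \<open>x\<close> obeys
      too. This gives \<open>V1 x \<subseteq> V1 z\<close>, so an estimate at the centre of a set of
      the cover is valid throughout that set.\<close>
    define W where "W x = {z \<in> topspace X. f z \<in> {p \<in> U. \<phi> p \<in> G x}} \<inter> (topspace X - \<Union>(Lf ` {j\<in>J. x \<notin> Lf j}))" for x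
    have W_open: "openin X (W x)" if "x \<in> L" for x
    proof -
      have "openin X {z \<in> topspace X. f z \<in> {p \<in> U. \<phi> p \<in> G x}}"
        by (rule openin_continuous_map_preimage[OF f openin_chart_preimage[OF chart G_open[OF that]]])
      moreover have "closedin X (\<Union>(Lf ` {j\<in>J. x \<notin> Lf j}))"
        using J(1,2) by (intro closedin_Union) auto
      ultimately show ?thesis unfolding W_def by (intro openin_Int openin_diff) auto
    qed
    have W_in: "x \<in> W x" if "x \<in> L" for x
      using LX[OF that] LU[OF that] FG[OF that] by (auto simp: W_def F_def)
    have L_closed: "closedin X L"
    proof -
      have "closedin X {x \<in> topspace X. \<psi> x \<in> {1/3..}}"
        by (rule closedin_continuous_map_preimage[OF \<psi>]) auto
      then show ?thesis by (simp add: L_def)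
    qed
    have "\<exists>\<Phi>. bump_cover X m (insert (topspace X - L) (W ` L)) \<Phi>"
    proof (rule dim[unfolded bump_dimension_def, rule_format])
      show "topspace X \<subseteq> \<Union>(insert (topspace X - L) (W ` L))" using W_in by auto
      show "openin X V" if "V \<in> insert (topspace X - L) (W ` L)" for V
        using that W_open L_closed by auto
    qed
    then obtain \<Phi> where Phi: "bump_cover X m (insert (topspace X - L) (W ` L)) \<Phi>" by blast
    then have fin: "finite \<Phi>" and cont: "\<And>c. c \<in> \<Phi> \<Longrightarrow> continuous_map X euclideanreal c"
      and c01: "\<And>c x. c \<in> \<Phi> \<Longrightarrow> x \<in> topspace X \<Longrightarrow> c x \<in> {0..1}"
      and c1: "\<And>x. x \<in> topspace X \<Longrightarrow> \<exists>c\<in>\<Phi>. c x = 1"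
      and cm: "\<And>x. x \<in> topspace X \<Longrightarrow> card {c\<in>\<Phi>. c x \<noteq> 0} \<le> m"
      unfolding bump_cover_def by auto
    \<comment> \<open>For \<open>x\<close> in \<open>L\<close> the common set cannot be the
      complement of \<open>L\<close>: a bump function with value 1 at \<open>x\<close> forces
      \<open>x\<close> to belong to it.\<close>
    have star: "\<exists>w\<in>L. \<forall>c\<in>\<Phi>. c x \<noteq> 0 \<longrightarrow> {z\<in>topspace X. c z \<noteq> 0} \<subseteq> W w" if x: "x \<in> L" for x
    proof -
      obtain S where S: "S \<in> insert (topspace X - L) (W ` L)"
        "\<forall>c\<in>\<Phi>. c x \<noteq> 0 \<longrightarrow> {z\<in>topspace X. c z \<noteq> 0} \<subseteq> S"
        using bump_cover_star[OF Phi LX[OF x]] by blast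
      obtain c where c: "c \<in> \<Phi>" "c x = 1" using c1[OF LX[OF x]] by blast
      then have "{z\<in>topspace X. c z \<noteq> 0} \<subseteq> S" using S(2) by simp
      then have "x \<in> S" using c(2) LX[OF x] by auto
      then show ?thesis using S x by auto
    qed
    \<comment> \<open>Only bump functions that are active somewhere on \<open>L\<close> are kept.
      Each gets a sample point which lies both in its support and in \<open>L\<close>, where
      \<open>\<phi>\<close> may be applied to the value of \<open>f\<close>.\<close>
    define \<Phi>' where "\<Phi>' = {c\<in>\<Phi>. \<exists>z\<in>L. c z \<noteq> 0}"
    define pt where "pt c = (SOME z. z \<in> L \<and> c z \<noteq> 0)" for c :: "'x \<Rightarrow> real"
    have pt: "pt c \<in> L" "c (pt c) \<noteq> 0" if "c \<in> \<Phi>'" for c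
    proof -
      have "\<exists>z. z \<in> L \<and> c z \<noteq> 0" using that by (auto simp: \<Phi>'_def)
      from someI_ex[OF this] show "pt c \<in> L" "c (pt c) \<noteq> 0" by (auto simp: pt_def)
    qed
    have "finite \<Phi>'" using fin by (simp add: \<Phi>'_def)
    from finite_distinct_list[OF this] obtain cs where cs: "set cs = \<Phi>'" "distinct cs" by blast
    have csc: "continuous_map X euclideanreal c" "\<And>x. x \<in> topspace X \<Longrightarrow> c x \<in> {0..1}" if "c \<in> set cs" for c
      using that cs cont c01 by (auto simp: \<Phi>'_def)
    have "finite (insert (f x0) (f ` pt ` \<Phi>'))" using \<open>finite \<Phi>'\<close> by simp
    moreover have "insert (f x0) (f ` pt ` \<Phi>') \<subseteq> U" using x0 pt LU by auto
    ultimately have "\<exists>b\<in>A. leq a b \<and> leq a0 b \<and> insert (f x0) (f ` pt ` \<Phi>') \<subseteq> U' b"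
      using a by (rule finite_in_chart)
    then obtain b1 where b1: "b1 \<in> A" "leq a b1" "leq a0 b1" "insert (f x0) (f ` pt ` \<Phi>') \<subseteq> U' b1" by blast
    \<comment> \<open>The index is raised once more. On \<open>C \<inter> L\<close> the map
      \<open>f\<close> keeps a share in the result, so its values there also have to lie in
      \<open>U' b\<close>; \<open>compact_in_chart\<close> applies because \<open>f\<close> is
      continuous into a member on \<open>C\<close>.\<close>
    have "compactin X (C \<inter> L)" using X C L_closed closedin_compact_space by blast
    then have "compact_space (subtopology X (C \<inter> L))" by (rule compact_space_subtopology)
    moreover have "continuous_map (subtopology X (C \<inter> L)) (N b1) f"
      by (rule continuous_map_step[OF continuous_map_from_subtopology_mono[OF fC] a b1(1,2)]) auto
    ultimately have "\<exists>b\<in>A. leq b1 b \<and> (\<forall>y\<in>topspace (subtopology X (C \<inter> L)). f y \<in> U' b)"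
      by (rule compact_in_chart[OF _ _ b1(1,3)]) (use LU in auto)
    then obtain b where b: "b \<in> A" "leq b1 b" "\<And>y. y \<in> C \<Longrightarrow> y \<in> L \<Longrightarrow> f y \<in> U' b"
      using LX by auto
    have a0b: "leq a0 b" and ab: "leq a b" using leq_trans a0 a b1 b by blast+
    have b_pts: "f x0 \<in> U' b" "f (pt c) \<in> U' b" if "c \<in> \<Phi>'" for c
      using sub'[OF b1(1) b(1) b1(3) b(2)] b1(4) that by auto
    have b_x0: "f x0 \<in> U' b" using sub'[OF b1(1) b(1) b1(3) b(2)] b1(4) by auto
    note chb = charts[OF b(1) a0b] and Eb = tvs'[OF b(1) a0b] and lb = lin[OF b(1) a0b]
    define pts where "pts = map (\<lambda>c. (c, F (pt c))) cs"
    define pts' where "pts' = map (\<lambda>c. (c, \<phi>' b (f (pt c)))) cs"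
    define ev where "ev ps x = map (\<lambda>(c, w). (c x, w)) ps" for ps :: "(('x \<Rightarrow> real) \<times> 'e) list" and x
    \<comment> \<open>One interpolation evaluated twice, in \<open>E\<close> and in
      \<open>E' b\<close>; \<open>l b\<close> maps the second to the first.\<close>
    define \<sigma> where "\<sigma> x = mixes E (ev pts x) (F x0)" for x
    define \<sigma>' where "\<sigma>' x = mixes (E' b) (ev pts' x) (\<phi>' b (f x0))" for x
    have pts_E: "w \<in> carrier E" "continuous_map X euclideanreal c" if "(c, w) \<in> set pts" for c w
      using that pt(1) FE csc(1) cs(1) by (auto simp: pts_def)
    have pts_E': "w \<in> carrier (E' b)" "continuous_map X euclideanreal c" if "(c, w) \<in> set pts'" for c w
      using that chart_carrier[OF chb b_pts(2)] csc(1) cs(1) by (auto simp: pts'_def)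
    have ev_E: "snd ` set (ev pts x) \<subseteq> carrier E" "snd ` set (ev pts' x) \<subseteq> carrier (E' b)" for x
      using pts_E(1) pts_E'(1) by (auto simp: ev_def)
    have \<sigma>_cont: "continuous_map X (vtop E) \<sigma>"
      unfolding \<sigma>_def ev_def
      by (rule continuous_map_mixes[OF tvs]) (use pts_E FE[OF x0] topspace_vtop[OF tvs] in auto)
    have \<sigma>'_cont: "continuous_map X (vtop (E' b)) \<sigma>'"
      unfolding \<sigma>'_def ev_def
      by (rule continuous_map_mixes[OF Eb])
        (use pts_E' chart_carrier[OF chb b_x0] topspace_vtop[OF Eb] in auto)
    have \<sigma>_lift: "l b (\<sigma>' x) = \<sigma> x" for x
    proof -
      have "l b (\<phi>' b (f (pt c))) = F (pt c)" if "c \<in> set cs" for c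
        using phi[OF b(1) a0b b_pts(2)] that cs by (simp add: F_def)
      then have "map (apsnd (l b)) (ev pts' x) = ev pts x"
        by (simp add: ev_def pts_def pts'_def)
      moreover have "l b (\<phi>' b (f x0)) = F x0"
        using phi[OF b(1) a0b b_x0] by (simp add: F_def)
      ultimately show ?thesis
        using continuous_linear_map_mixes[OF Eb tvs lb chart_carrier[OF chb b_x0] ev_E(2)]
        by (simp add: \<sigma>_def \<sigma>'_def)
    qed
    \<comment> \<open>At a point of \<open>L\<close> some coefficient equals 1, so the possibly
      distant start \<open>F x0\<close> may be replaced by \<open>F x\<close>, which lies in the
      same small neighbourhood as the active sample values.\<close>
    have \<sigma>_start: "\<sigma> x = mixes E (ev pts x) (F x)" if x: "x \<in> L" for x
    proof -
      obtain c where c: "c \<in> \<Phi>" "c x = 1" using c1[OF LX[OF x]] by blast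
      then have "c \<in> set cs" using x cs(1) by (auto simp: \<Phi>'_def)
      then have "(c x, F (pt c)) \<in> set (ev pts x)" by (auto simp: ev_def pts_def)
      then have "1 \<in> fst ` set (ev pts x)" using c(2) by force
      then show ?thesis
        unfolding \<sigma>_def by (rule mixes_start_irrelevant[OF tvs FE[OF x0] FE[OF x] ev_E(1)])
    qed
    \<comment> \<open>A ramp which is 0 where \<open>\<psi> \<le> 1/3\<close> and 1 where
      \<open>\<psi> \<ge> 2/3\<close>, that is on \<open>K\<close>.\<close>
    define \<eta> where "\<eta> x = max 0 (min 1 (3 * \<psi> x - 1))" for x
    have \<eta>01: "\<eta> x \<in> {0..1}" for x by (simp add: \<eta>_def)
    \<comment> \<open>The weight that \<open>F\<close> retains at time \<open>s\<close>. It is 1,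
      and nothing moves, if \<open>s = 0\<close>, \<open>\<eta> x = 0\<close> or
      \<open>\<rho> x = 1\<close>; it is 0 at the end of the deformation where
      \<open>\<eta> x = 1\<close> and \<open>\<rho> x = 0\<close>.\<close>
    define \<kappa> where "\<kappa> s x = 1 - s * \<eta> x * (1 - \<rho> x)" for s x
    have \<kappa>01: "\<kappa> s x \<in> {0..1}" if "s \<in> {0..1}" "x \<in> topspace X" for s x
    proof -
      have "0 \<le> s * \<eta> x * (1 - \<rho> x)" "s * \<eta> x * (1 - \<rho> x) \<le> 1"
        using that(1) \<eta>01[of x] \<rho>(2)[OF that(2)] by (auto intro!: mult_nonneg_nonneg mult_le_one)
      then show ?thesis by (simp add: \<kappa>_def)
    qed
    define T where "T s x = mix E (\<kappa> s x) (\<sigma> x) (F x)" for s x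
    have \<sigma>E: "\<sigma> x \<in> carrier E" for x
      unfolding \<sigma>_def by (rule mixes_closed[OF tvs FE[OF x0] ev_E(1)])
    have \<sigma>'E: "\<sigma>' x \<in> carrier (E' b)" for x
      unfolding \<sigma>'_def by (rule mixes_closed[OF Eb chart_carrier[OF chb b_x0] ev_E(2)])
    have T_1: "T s x = F x" if "\<kappa> s x = 1" "x \<in> L" for s x
      using mix_1[OF tvs \<sigma>E FE[OF that(2)]] that(1) by (simp add: T_def)
    have T_V1: "T s x \<in> V1 x" if s: "s \<in> {0..1}" and x: "x \<in> L" for s x
    proof -
      obtain w where w: "w \<in> L" "\<And>c. c \<in> \<Phi> \<Longrightarrow> c x \<noteq> 0 \<Longrightarrow> {z\<in>topspace X. c z \<noteq> 0} \<subseteq> W w"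
        using star[OF x] by blast
      have W_G: "F z \<in> G w" if "z \<in> W w" for z
        using that by (simp add: W_def F_def)
      obtain c where c: "c \<in> \<Phi>" "c x = 1" using c1[OF LX[OF x]] by blast
      have xW: "x \<in> W w" using w(2)[OF c(1)] c(2) LX[OF x] by auto
      \<comment> \<open>The mix with \<open>F x\<close> becomes the head of the list, so the
        interpolation and the movement towards it are controlled by a single application of
        \<open>G_mixes\<close>.\<close>
      have "T s x = mixes E ((\<kappa> s x, F x) # ev pts x) (F x)"
        by (simp add: T_def \<sigma>_start[OF x])
      also have "\<dots> \<in> V1 w"
      proof (rule G_mixes[OF w(1) W_G[OF xW]])
        fix d v assume "(d, v) \<in> set ((\<kappa> s x, F x) # ev pts x)"
        then consider "d = \<kappa> s x" "v = F x" | c where "c \<in> set cs" "d = c x" "v = F (pt c)"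
          by (auto simp: ev_def pts_def)
        then show "d \<in> {0..1} \<and> v \<in> carrier E \<and> (d \<noteq> 0 \<longrightarrow> v \<in> G w)"
        proof cases
          case 1
          then show ?thesis using \<kappa>01[OF s LX[OF x]] FE[OF x] W_G[OF xW] by simp
        next
          case 2
          have p: "pt c \<in> L" "c (pt c) \<noteq> 0" "c \<in> \<Phi>"
            using pt[of c] 2(1) cs(1) by (auto simp: \<Phi>'_def)
          have "v \<in> G w" if "d \<noteq> 0"
            using w(2)[OF p(3)] that p(1,2) 2(2,3) LX[OF p(1)] by (auto intro!: W_G)
          then show ?thesis using csc(2)[OF 2(1) LX[OF x]] FE[OF p(1)] 2(2,3) by simp
        qed
      next
        have "length (filter (\<lambda>y. fst y \<noteq> 0) (ev pts x)) = length (filter (\<lambda>c. c x \<noteq> 0) cs)"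
          by (simp add: ev_def pts_def filter_map o_def)
        also have "\<dots> = card {c \<in> \<Phi>'. c x \<noteq> 0}"
          using cs distinct_card[of "filter (\<lambda>c. c x \<noteq> 0) cs"] by simp
        also have "\<dots> \<le> card {c \<in> \<Phi>. c x \<noteq> 0}"
          using fin by (intro card_mono) (auto simp: \<Phi>'_def)
        also have "\<dots> \<le> m" by (rule cm[OF LX[OF x]])
        finally show "length (filter (\<lambda>y. fst y \<noteq> 0) ((\<kappa> s x, F x) # ev pts x)) \<le> Suc m" by simp
      qed
      also have "V1 w \<subseteq> V1 x"
        using xW by (auto simp: V1_def W_def)
      finally show ?thesis .
    qed
    have T_V: "T s x \<in> V" if "s \<in> {0..1}" "x \<in> L" for s x
      using T_V1[OF that] by (simp add: V1_def)
    define H where "H z = (if 1/3 \<le> \<psi> (snd z) then inv_into U \<phi> (T (fst z) (snd z)) else f (snd z))" for z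
    define f' where "f' x = H (1, x)" for x
    have H_const: "H (s, x) = f x" if "\<kappa> s x = 1" "x \<in> topspace X" for s x
    proof (cases "1/3 \<le> \<psi> x")
      case True
      then have "x \<in> L" using that by (simp add: L_def)
      then show ?thesis using True T_1[OF that(1)] chart_inv[OF chart LU] by (simp add: H_def F_def)
    qed (simp add: H_def)
    let ?Z = "prod_topology (top_of_set {0..1::real}) X"
    have fst_c: "continuous_map ?Z euclideanreal fst"
      using continuous_map_fst continuous_map_in_subtopology by blast
    have snd_c: "continuous_map ?Z Y (\<lambda>z. g (snd z))" if "continuous_map X Y g" for Y and g :: "'x \<Rightarrow> 'y"
      using continuous_map_compose[OF continuous_map_snd that] by (simp add: o_def)
    have \<kappa>_cont: "continuous_map ?Z euclideanreal (\<lambda>z. \<kappa> (fst z) (snd z))"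
      unfolding \<kappa>_def \<eta>_def by (intro continuous_intros fst_c snd_c[OF \<psi>] snd_c[OF \<rho>(1)]) simp_all
    have H_cont: "continuous_map ?Z M H"
      unfolding H_def
    proof (rule continuous_map_cases_le)
      show "continuous_map ?Z euclideanreal (\<lambda>z. 1/3)" by simp
      show "continuous_map ?Z euclideanreal (\<lambda>z. \<psi> (snd z))" by (rule snd_c[OF \<psi>])
      let ?ZL = "subtopology ?Z {z \<in> topspace ?Z. 1/3 \<le> \<psi> (snd z)}"
      have ZL: "fst z \<in> {0..1} \<and> snd z \<in> L" if "z \<in> topspace ?ZL" for z
        using that by (auto simp: L_def)
      have F_c: "continuous_map ?ZL (vtop E) (\<lambda>z. F (snd z))"
        unfolding F_def
        by (rule continuous_map_into_chart[OF chart continuous_map_from_subtopology[OF snd_c[OF f]]])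
          (use ZL LU in blast)
      have "continuous_map ?ZL (vtop E) (\<lambda>z. T (fst z) (snd z))"
        unfolding T_def
        by (rule continuous_map_mix[OF tvs continuous_map_from_subtopology[OF \<kappa>_cont]
              continuous_map_from_subtopology[OF snd_c[OF \<sigma>_cont]] F_c])
      then show "continuous_map ?ZL M (\<lambda>z. inv_into U \<phi> (T (fst z) (snd z)))"
        by (rule continuous_map_inv_chart[OF chart]) (use ZL T_V in blast)
      show "continuous_map (subtopology ?Z {z \<in> topspace ?Z. \<psi> (snd z) \<le> 1/3}) M (\<lambda>z. f (snd z))"
        by (rule continuous_map_from_subtopology[OF snd_c[OF f]])
      \<comment> \<open>At the seam \<open>\<psi> = 1/3\<close> the ramp \<open>\<eta>\<close>
        vanishes, so both branches return the value of \<open>f\<close>.\<close>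
      fix z assume z: "z \<in> topspace ?Z" "1/3 = \<psi> (snd z)"
      then have "\<kappa> (fst z) (snd z) = 1" "snd z \<in> topspace X" by (auto simp: \<kappa>_def \<eta>_def)
      then have "H z = f (snd z)" using H_const[of "fst z" "snd z"] by simp
      then show "inv_into U \<phi> (T (fst z) (snd z)) = f (snd z)" using z(2) by (simp add: H_def)
    qed
    have "homotopic_with (\<lambda>h. \<forall>x\<in>topspace X. \<rho> x = 1 \<longrightarrow> h x = f x) X M f f'"
    proof (subst homotopic_with)
      show "(\<forall>x\<in>topspace X. \<rho> x = 1 \<longrightarrow> h x = f x) = (\<forall>x\<in>topspace X. \<rho> x = 1 \<longrightarrow> k x = f x)"
        if "\<And>x. x \<in> topspace X \<Longrightarrow> h x = k x" for h k
        using that by simp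
      show "\<exists>h. continuous_map ?Z M h \<and> (\<forall>x\<in>topspace X. h (0, x) = f x) \<and>
          (\<forall>x\<in>topspace X. h (1, x) = f' x) \<and>
          (\<forall>t\<in>{0..1}. \<forall>x\<in>topspace X. \<rho> x = 1 \<longrightarrow> h (t, x) = f x)"
        using H_cont by (intro exI[of _ H]) (auto simp: f'_def \<kappa>_def intro!: H_const)
    qed
    moreover have "f' x \<in> Uf j" if "j \<in> J" "x \<in> Lf j" for j x
    proof (cases "1/3 \<le> \<psi> x")
      case True
      then have "x \<in> L" using LfX[OF that(2,1)] by (simp add: L_def)
      then show ?thesis
        using T_V1[of 1 x] True that by (simp add: f'_def H_def V1_def)
    next
      case False
      then show ?thesis using J(4) that by (simp add: f'_def H_def)
    qed
    moreover have "\<exists>c\<in>A. leq a c \<and> continuous_map (subtopology X (C \<union> K)) (N c) f'"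
    proof -
      have f'L: "f' x \<in> U" "\<phi> (f' x) = T 1 x" if "x \<in> L" for x
        using that chart_inv_in[OF chart T_V] chart_of_inv[OF chart T_V]
        by (auto simp: f'_def H_def L_def)
      have neU: "U' b \<noteq> {}" using b_x0 by blast
      \<comment> \<open>Three reasons for continuity into a member. On \<open>S1\<close> nothing has
        moved and \<open>f\<close> is continuous into \<open>N a\<close>; on \<open>S2\<close> both
        \<open>\<sigma>\<close> and \<open>f\<close> lift to \<open>E' b\<close>; on
        \<open>S3\<close> only \<open>\<sigma>\<close> is left. A point of \<open>K\<close> outside
        \<open>C\<close> satisfies \<open>\<rho> x = 0\<close> by \<open>\<rho>C\<close> and so
        belongs to \<open>S3\<close>.\<close>
      define S1 where "S1 = C \<inter> {x \<in> topspace X. \<psi> x \<in> {..1/3}}"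
      define S2 where "S2 = C \<inter> L"
      define S3 where "S3 = {x \<in> topspace X. \<psi> x \<in> {2/3..}} \<inter> {x \<in> topspace X. \<rho> x \<in> {0}}"
      have clo: "closedin X S1" "closedin X S2" "closedin X S3"
        unfolding S1_def S2_def S3_def
        by (intro closedin_Int C L_closed closedin_continuous_map_preimage[OF \<psi>]
            closedin_continuous_map_preimage[OF \<rho>(1)]; simp)+
      have comp: "compact_space (subtopology X S2)" "compact_space (subtopology X S3)"
        using clo X closedin_compact_space compact_space_subtopology by blast+
      have S2L: "x \<in> L \<and> x \<in> C \<and> x \<in> topspace X" if "x \<in> topspace (subtopology X S2)" for x
        using that by (simp add: S2_def)
      have S3L: "x \<in> L \<and> \<kappa> 1 x = 0 \<and> x \<in> topspace X" if "x \<in> topspace (subtopology X S3)" for x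
        using that by (simp add: S3_def L_def \<kappa>_def \<eta>_def)
      have c1: "continuous_map (subtopology X S1) (N a) f'"
      proof (rule continuous_map_eq)
        show "continuous_map (subtopology X S1) (N a) f"
          by (rule continuous_map_from_subtopology_mono[OF fC]) (simp add: S1_def)
        show "f x = f' x" if "x \<in> topspace (subtopology X S1)" for x
          using that unfolding f'_def by (intro H_const[symmetric]) (auto simp: S1_def \<kappa>_def \<eta>_def)
      qed
      have "\<exists>c\<in>A. leq b c \<and> continuous_map (subtopology X S2) (N c) f'"
      proof (rule continuous_lift[OF comp(1) b(1) a0b neU])
        have "continuous_map (subtopology X S2) (N b) f"
          by (rule continuous_map_step[OF continuous_map_from_subtopology_mono[OF fC] a b(1) ab])
            (auto simp: S2_def)
        then have f_b: "continuous_map (subtopology X S2) (vtop (E' b)) (\<lambda>x. \<phi>' b (f x))"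
          by (rule continuous_map_into_chart[OF chb]) (use S2L b(3) in blast)
        have \<kappa>1: "continuous_map X euclideanreal (\<kappa> 1)"
          unfolding \<kappa>_def \<eta>_def by (intro continuous_intros \<psi> \<rho>(1)) simp_all
        show "continuous_map (subtopology X S2) (vtop (E' b)) (\<lambda>x. mix (E' b) (\<kappa> 1 x) (\<sigma>' x) (\<phi>' b (f x)))"
          by (rule continuous_map_mix[OF Eb continuous_map_from_subtopology[OF \<kappa>1]
                continuous_map_from_subtopology[OF \<sigma>'_cont] f_b])
        fix x assume x: "x \<in> topspace (subtopology X S2)"
        show "f' x \<in> U" using f'L(1) S2L[OF x] by blast
        have fx: "f x \<in> U' b" using S2L[OF x] b(3) by blast
        have "l b (mix (E' b) (\<kappa> 1 x) (\<sigma>' x) (\<phi>' b (f x))) = mix E (\<kappa> 1 x) (\<sigma> x) (F x)"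
          using continuous_linear_map_mix[OF Eb tvs lb \<sigma>'E chart_carrier[OF chb fx]]
            phi[OF b(1) a0b fx] by (simp add: \<sigma>_lift F_def)
        then show "\<phi> (f' x) = l b (mix (E' b) (\<kappa> 1 x) (\<sigma>' x) (\<phi>' b (f x)))"
          using f'L(2) S2L[OF x] by (simp add: T_def)
      qed
      then obtain c2 where c2: "c2 \<in> A" "leq b c2" "continuous_map (subtopology X S2) (N c2) f'" by blast
      have "\<exists>c\<in>A. leq b c \<and> continuous_map (subtopology X S3) (N c) f'"
      proof (rule continuous_lift[OF comp(2) b(1) a0b neU])
        show "continuous_map (subtopology X S3) (vtop (E' b)) \<sigma>'"
          by (rule continuous_map_from_subtopology[OF \<sigma>'_cont])
        fix x assume x: "x \<in> topspace (subtopology X S3)"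
        show "f' x \<in> U" using f'L(1) S3L[OF x] by blast
        have "T 1 x = \<sigma> x"
          using mix_0[OF tvs \<sigma>E FE] S3L[OF x] by (simp add: T_def)
        then show "\<phi> (f' x) = l b (\<sigma>' x)"
          using f'L(2) S3L[OF x] by (simp add: \<sigma>_lift)
      qed
      then obtain c3 where c3: "c3 \<in> A" "leq b c3" "continuous_map (subtopology X S3) (N c3) f'" by blast
      obtain c where c: "c \<in> A" "leq c2 c" "leq c3 c" using upper_bound c2 c3 by blast
      have ac: "leq a c" using leq_trans[OF a b(1) c2(1) ab c2(2)] leq_trans[OF a c2(1) c(1)] c(2) by blast
      have "continuous_map (subtopology X (S1 \<union> S2 \<union> S3)) (N c) f'"
        by (intro continuous_map_subtopology_Un closedin_Un clo continuous_map_step[OF c1 a c(1) ac]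
            continuous_map_step[OF c2(3) c2(1) c(1,2)] continuous_map_step[OF c3(3) c3(1) c(1,3)])
      moreover have "C \<union> K \<subseteq> S1 \<union> S2 \<union> S3"
        using closedin_subset[OF C] \<rho>C by (auto simp: S1_def S2_def S3_def L_def K_def)
      ultimately have "continuous_map (subtopology X (C \<union> K)) (N c) f'"
        by (rule continuous_map_from_subtopology_mono)
      then show ?thesis using c(1) ac by blast
    qed
    ultimately show ?thesis unfolding K_def by blast
  qed
qed

end

context directed_spaces
begin

lemma weak_limit_chartE:
  assumes "weak_direct_limit_chart A leq N M U \<phi> V E"
  obtains a0 U' \<phi>' V' E' l l' where "weak_limit_chart A leq N M U \<phi> V E a0 U' \<phi>' V' E' l l'"
proof -
  from assms obtain a0 U' \<phi>' V' E' l l' where chart: "is_chart M U \<phi> V E" and a0: "a0 \<in> A"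
    and 1: "\<forall>a\<in>A. leq a0 a \<longrightarrow> is_chart (N a) (U' a) (\<phi>' a) (V' a) (E' a) \<and>
        continuous_linear_map (E' a) E (l a) \<and> U' a \<subseteq> U \<and> (\<forall>x\<in>U' a. \<phi> x = l a (\<phi>' a x))"
    and 2: "\<forall>a\<in>A. \<forall>b\<in>A. leq a0 a \<longrightarrow> leq a b \<longrightarrow> continuous_linear_map (E' a) (E' b) (l' b a) \<and>
        U' a \<subseteq> U' b \<and> (\<forall>x\<in>U' a. \<phi>' b x = l' b a (\<phi>' a x))"
    and U: "U = (\<Union>a\<in>{a\<in>A. leq a0 a}. U' a)"
    unfolding weak_direct_limit_chart_def by (elim conjE bexE exE) (rule that)
  have "weak_limit_chart A leq N M U \<phi> V E a0 U' \<phi>' V' E' l l'"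
    by unfold_locales (fact chart a0 U 1[rule_format, THEN conjunct1]
        1[rule_format, THEN conjunct2, THEN conjunct1]
        1[rule_format, THEN conjunct2, THEN conjunct2, THEN conjunct1]
        1[rule_format, THEN conjunct2, THEN conjunct2, THEN conjunct2, rule_format]
        2[rule_format, THEN conjunct1] 2[rule_format, THEN conjunct2, THEN conjunct1]
        2[rule_format, THEN conjunct2, THEN conjunct2, rule_format])+
  then show ?thesis by (rule that)
qed

text \<open>The charts are used one at a time. In each step the closed set on which the current map
  is already continuous into a member takes the place of \<open>C\<close>. The deformations can be
  composed because each of them is stationary where \<open>\<rho> = 1\<close>.\<close>

lemma homotopic_into_member:
  fixes X :: "'x topology"
  assumes adm: "admits_weak_direct_limit_charts TYPE('e) A leq N M"
    and X: "compact_space X" "Hausdorff_space X" and dim: "bump_dimension X m"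
    and f: "continuous_map X M f" and C: "closedin X C" and a: "a \<in> A"
    and fC: "continuous_map (subtopology X C) (N a) f"
    and \<rho>: "continuous_map X euclideanreal \<rho>" "\<And>x. x \<in> topspace X \<Longrightarrow> \<rho> x \<in> {0..1}"
    and \<rho>C: "\<And>x. x \<in> topspace X \<Longrightarrow> \<rho> x \<noteq> 0 \<Longrightarrow> x \<in> C"
  shows "\<exists>b\<in>A. leq a b \<and> (\<exists>g.
    homotopic_with (\<lambda>h. \<forall>x\<in>topspace X. \<rho> x = 1 \<longrightarrow> h x = f x) X M f g \<and> continuous_map X (N b) g)"
proof -
  \<comment> \<open>The function \<open>\<psi>\<close> peaks at \<open>x\<close>, and the set where
    it is at least 1/3 is mapped into one chart domain, in the form that \<open>chart_step\<close>
    expects.\<close>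
  define Q where "Q x U \<psi> \<longleftrightarrow> (\<exists>\<phi> V (E :: 'e vs_with_topology). weak_direct_limit_chart A leq N M U \<phi> V E) \<and>
      continuous_map X euclideanreal \<psi> \<and> (\<forall>z\<in>topspace X. 1/3 \<le> \<psi> z \<longrightarrow> f z \<in> U) \<and> \<psi> x = 1"
    for x U and \<psi> :: "'x \<Rightarrow> real"
  have "\<exists>U \<psi>. Q x U \<psi>" if x: "x \<in> topspace X" for x
  proof -
    have "f x \<in> topspace M" using continuous_map_funspace[OF f] x by auto
    then have "\<exists>U \<phi> V (E :: 'e vs_with_topology). f x \<in> U \<and> weak_direct_limit_chart A leq N M U \<phi> V E"
      using adm unfolding admits_weak_direct_limit_charts_def by (rule bspec[rotated])
    then obtain U \<phi> V and E :: "'e vs_with_topology" where fx: "f x \<in> U"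
      and ch: "weak_direct_limit_chart A leq N M U \<phi> V E"
      by (elim exE conjE) (rule that)
    have "is_chart M U \<phi> V E" using ch unfolding weak_direct_limit_chart_def by (elim conjE)
    then have "openin X {z \<in> topspace X. f z \<in> U}"
      using chart_open(1) openin_continuous_map_preimage[OF f] by blast
    then have "closedin X (topspace X - {z \<in> topspace X. f z \<in> U})" by auto
    moreover have "x \<in> topspace X - (topspace X - {z \<in> topspace X. f z \<in> U})" using x fx by auto
    moreover have "completely_regular_space X"
      using X by (simp add: locally_compact_regular_imp_completely_regular_space compact_imp_locally_compact_space)
    \<comment> \<open>Complete regularity of the compact Hausdorff space. Since \<open>g\<close>
      equals 1 off the preimage of \<open>U\<close>, the function \<open>1 - g\<close> vanishes
      there and equals 1 at \<open>x\<close>.\<close>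
    ultimately have "\<exists>g. continuous_map X (top_of_set {0..1::real}) g \<and> g x = 0 \<and>
        g ` (topspace X - {z \<in> topspace X. f z \<in> U}) \<subseteq> {1}"
      unfolding completely_regular_space_def by blast
    then obtain g where g: "continuous_map X (top_of_set {0..1::real}) g" "g x = 0"
      "g ` (topspace X - {z \<in> topspace X. f z \<in> U}) \<subseteq> {1}" by blast
    have "continuous_map X euclideanreal g" using g(1) continuous_map_in_subtopology by blast
    then have "continuous_map X euclideanreal (\<lambda>z. 1 - g z)" by (intro continuous_intros) simp_all
    then have "Q x U (\<lambda>z. 1 - g z)" unfolding Q_def using ch g(2,3) by fastforce
    then show ?thesis by blast
  qed
  then obtain U \<psi> where Q: "\<And>x. x \<in> topspace X \<Longrightarrow> Q x (U x) (\<psi> x)" by metis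
  have \<psi>: "continuous_map X euclideanreal (\<psi> x)" "\<psi> x x = 1"
    "\<And>z. z \<in> topspace X \<Longrightarrow> 1/3 \<le> \<psi> x z \<Longrightarrow> f z \<in> U x"
    and chart: "\<exists>\<phi> V (E :: 'e vs_with_topology). weak_direct_limit_chart A leq N M (U x) \<phi> V E"
    if "x \<in> topspace X" for x
    using Q[OF that] by (simp_all add: Q_def)
  define K where "K x = {z \<in> topspace X. 2/3 \<le> \<psi> x z}" for x
  define L where "L x = {z \<in> topspace X. 1/3 \<le> \<psi> x z}" for x
  have clo: "closedin X (K x)" "closedin X (L x)" if "x \<in> topspace X" for x
    using closedin_continuous_map_preimage[OF \<psi>(1)[OF that], of "{2/3..}"]
      closedin_continuous_map_preimage[OF \<psi>(1)[OF that], of "{1/3..}"] by (simp_all add: K_def L_def)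
  \<comment> \<open>The strict inequality gives an open cover, from which compactness selects
    finitely many sets; each is contained in the corresponding closed set
    \<open>K x\<close>.\<close>
  let ?O = "\<lambda>x. {z \<in> topspace X. \<psi> x z \<in> {2/3<..}}"
  have opO: "openin X (?O x)" if "x \<in> topspace X" for x
    by (rule openin_continuous_map_preimage[OF \<psi>(1)[OF that]]) simp
  have "\<exists>\<F>. finite \<F> \<and> \<F> \<subseteq> ?O ` topspace X \<and> topspace X \<subseteq> \<Union>\<F>"
  proof (rule compactinD)
    show "compactin X (topspace X)" using X(1) by (simp add: compact_space_def)
    show "openin X V" if "V \<in> ?O ` topspace X" for V using that opO by blast
    show "topspace X \<subseteq> \<Union>(?O ` topspace X)" using \<psi>(2) by auto
  qed
  then obtain \<F> where F: "finite \<F>" "\<F> \<subseteq> ?O ` topspace X" "topspace X \<subseteq> \<Union>\<F>" by blast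
  obtain D where D: "finite D" "D \<subseteq> topspace X" "\<F> = ?O ` D"
    using finite_subset_image[OF F(1,2)] by blast
  have cov: "topspace X \<subseteq> (\<Union>d\<in>D. K d)"
  proof
    fix x assume "x \<in> topspace X"
    then obtain d where d: "d \<in> D" "x \<in> ?O d" using F(3) D(3) by auto
    then have "x \<in> K d" by (auto simp: K_def)
    then show "x \<in> (\<Union>d\<in>D. K d)" using d(1) by (rule UN_I[rotated])
  qed
  define P where "P h \<longleftrightarrow> (\<forall>x\<in>topspace X. \<rho> x = 1 \<longrightarrow> h x = f x)" for h
  \<comment> \<open>Induction over the charts already used. The clause about \<open>L d\<close> is
    kept for every \<open>d\<close> in \<open>D\<close>, since a later step can only start if the
    current map still sends its \<open>L d\<close> into \<open>U d\<close>.\<close>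
  have "\<exists>b\<in>A. leq a b \<and> (\<exists>g. homotopic_with P X M f g \<and> (\<forall>d\<in>D. \<forall>x\<in>L d. g x \<in> U d) \<and>
      continuous_map (subtopology X (C \<union> (\<Union>d\<in>B. K d))) (N b) g)" if "B \<subseteq> D" for B
    using finite_subset[OF that D(1)] that
  proof (induction B)
    case empty
    have "homotopic_with P X M f f" using f by (simp add: P_def)
    moreover have "\<forall>d\<in>D. \<forall>x\<in>L d. f x \<in> U d" using \<psi>(3) D(2) by (auto simp: L_def)
    ultimately show ?case
      using a leq_refl[OF a] fC by (intro bexI[of _ a] conjI exI[of _ f]) simp_all
  next
    case (insert d B)
    then obtain b g where b: "b \<in> A" "leq a b" and fg: "homotopic_with P X M f g"
      and gU: "\<And>d x. d \<in> D \<Longrightarrow> x \<in> L d \<Longrightarrow> g x \<in> U d"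
      and gb: "continuous_map (subtopology X (C \<union> (\<Union>d\<in>B. K d))) (N b) g"
      by auto
    have d: "d \<in> D" "d \<in> topspace X" and B: "finite B" "B \<subseteq> topspace X" using insert D(2) by auto
    obtain \<phi> V and E :: "'e vs_with_topology" where "weak_direct_limit_chart A leq N M (U d) \<phi> V E"
      using chart[OF d(2)] by blast
    then obtain a0 U' \<phi>' V' E' l l' where w: "weak_limit_chart A leq N M (U d) \<phi> V E a0 U' \<phi>' V' E' l l'"
      by (rule weak_limit_chartE)
    have gM: "continuous_map X M g" using homotopic_with_imp_continuous_maps[OF fg] by blast
    have "closedin X (C \<union> (\<Union>d\<in>B. K d))"
      using B clo(1) by (intro closedin_Un C closedin_Union) auto
    then have "\<exists>c\<in>A. leq b c \<and> (\<exists>g'. homotopic_with (\<lambda>h. \<forall>x\<in>topspace X. \<rho> x = 1 \<longrightarrow> h x = g x) X M g g' \<and>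
      (\<forall>j\<in>D. \<forall>x\<in>L j. g' x \<in> U j) \<and>
      continuous_map (subtopology X ((C \<union> (\<Union>d\<in>B. K d)) \<union> {x \<in> topspace X. 2/3 \<le> \<psi> d x})) (N c) g')"
    proof (rule weak_limit_chart.chart_step[OF w X(1) dim gM _ b(1) gb \<rho> _ \<psi>(1)[OF d(2)] _ D(1)])
      show "x \<in> C \<union> (\<Union>d\<in>B. K d)" if "x \<in> topspace X" "\<rho> x \<noteq> 0" for x using \<rho>C that by blast
      show "g x \<in> U d" if "x \<in> topspace X" "1/3 \<le> \<psi> d x" for x using gU[OF d(1)] that by (simp add: L_def)
      show "closedin X (L j)" if "j \<in> D" for j using clo(2) D(2) that by blast
      show "openin M (U j)" if j: "j \<in> D" for j
      proof -
        have "j \<in> topspace X" using j D(2) by blast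
        then obtain \<phi> V and E :: "'e vs_with_topology" where "weak_direct_limit_chart A leq N M (U j) \<phi> V E"
          using chart by blast
        then have "is_chart M (U j) \<phi> V E" unfolding weak_direct_limit_chart_def by (elim conjE)
        then show ?thesis by (rule chart_open(1))
      qed
      show "g x \<in> U j" if "j \<in> D" "x \<in> L j" for j x using gU that by blast
    qed
    then obtain c g' where c: "c \<in> A" "leq b c"
      and gg': "homotopic_with (\<lambda>h. \<forall>x\<in>topspace X. \<rho> x = 1 \<longrightarrow> h x = g x) X M g g'"
      and g'U: "\<forall>j\<in>D. \<forall>x\<in>L j. g' x \<in> U j"
      and g'c: "continuous_map (subtopology X ((C \<union> (\<Union>d\<in>B. K d)) \<union> {x \<in> topspace X. 2/3 \<le> \<psi> d x})) (N c) g'"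
      by blast
    have "P g" using homotopic_with_imp_property[OF fg] by blast
    then have "homotopic_with P X M g g'"
      by (intro homotopic_with_mono[OF gg']) (simp add: P_def)
    with fg have "homotopic_with P X M f g'" by (rule homotopic_with_trans)
    moreover have "(C \<union> (\<Union>d\<in>B. K d)) \<union> {x \<in> topspace X. 2/3 \<le> \<psi> d x} = C \<union> (\<Union>d\<in>insert d B. K d)"
      by (auto simp: K_def)
    moreover have "leq a c" by (rule leq_trans[OF a b(1) c(1) b(2) c(2)])
    ultimately show ?case using c(1) g'U g'c by (intro bexI[of _ c] conjI exI[of _ g']) simp_all
  qed
  from this[OF order_refl] obtain b g where b: "b \<in> A" "leq a b" and fg: "homotopic_with P X M f g"
    and gb: "continuous_map (subtopology X (C \<union> (\<Union>d\<in>D. K d))) (N b) g"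
    by blast
  have "topspace X \<subseteq> C \<union> (\<Union>d\<in>D. K d)" using cov by blast
  then have "subtopology X (C \<union> (\<Union>d\<in>D. K d)) = X" by (rule subtopology_superset)
  then show ?thesis using b fg gb unfolding P_def by auto
qed

end

section \<open>Homotopies of maps on cubes\<close>

lemma topspace_cube: "topspace (cube k) = {..<k} \<rightarrow>\<^sub>E {0..1}"
  by (simp add: cube_def)

lemma compact_Hausdorff_cube: "compact_space (cube k)" "Hausdorff_space (cube k)"
  by (auto simp: cube_def compact_space_product_topology Hausdorff_space_product_topology
      compact_space_subtopology Hausdorff_space_subtopology)

lemma cube_coordinate:
  assumes "x \<in> topspace (cube k)" "i < k"
  shows "x i \<in> {0..1}"
  by (rule PiE_mem[of x "{..<k}" "\<lambda>_. {0..1}" i]) (use assms in \<open>simp_all add: topspace_cube\<close>)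

lemma continuous_map_cube_coordinate:
  assumes "i < k"
  shows "continuous_map (cube k) euclideanreal (\<lambda>x. x i)"
proof -
  have "continuous_map (cube k) (top_of_set {0..1::real}) (\<lambda>x. x i)"
    unfolding cube_def using assms by (intro continuous_map_product_projection) simp
  then show ?thesis by (simp add: continuous_map_in_subtopology)
qed

lemma continuous_map_into_cube:
  assumes "\<And>i. i < k \<Longrightarrow> continuous_map Y euclideanreal (\<lambda>y. g y i)"
    and "\<And>y i. y \<in> topspace Y \<Longrightarrow> i < k \<Longrightarrow> g y i \<in> {0..1}"
    and "\<And>y. y \<in> topspace Y \<Longrightarrow> g y \<in> extensional {..<k}"
  shows "continuous_map Y (cube k) g"
  unfolding cube_def continuous_map_componentwise
  using assms by (auto simp: continuous_map_in_subtopology)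

lemma continuous_map_compose_unit_interval:
  assumes "continuous_on {0..1} \<theta>" "continuous_map Y euclideanreal c"
    and "\<And>y. y \<in> topspace Y \<Longrightarrow> c y \<in> {0..1::real}"
  shows "continuous_map Y euclideanreal (\<lambda>y. \<theta> (c y) :: real)"
proof -
  have "continuous_map Y (top_of_set {0..1}) c"
    using assms(2,3) by (auto simp: continuous_map_in_subtopology)
  moreover have "continuous_map (top_of_set {0..1}) euclideanreal \<theta>"
    using assms(1) by simp
  ultimately have "continuous_map Y euclideanreal (\<theta> \<circ> c)" by (rule continuous_map_compose)
  then show ?thesis by (simp add: o_def)
qed

lemma cube_Suc_homeomorphic:
  "homeomorphic_maps (prod_topology (top_of_set {0..1}) (cube k)) (cube (Suc k))
     (\<lambda>(t, y). y(k := t)) (\<lambda>x. (x k, restrict x {..<k}))"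
  unfolding homeomorphic_maps_def
proof (intro conjI ballI)
  let ?Z = "prod_topology (top_of_set {0..1::real}) (cube k)"
  have f: "continuous_map ?Z euclideanreal fst"
    using continuous_map_fst continuous_map_in_subtopology by blast
  have s: "continuous_map ?Z euclideanreal (\<lambda>z. snd z i)" if "i < k" for i
    using continuous_map_compose[OF continuous_map_snd continuous_map_cube_coordinate[OF that]]
    by (simp add: o_def)
  show "continuous_map ?Z (cube (Suc k)) (\<lambda>(t, y). y(k := t))"
  proof (rule continuous_map_into_cube)
    show "continuous_map ?Z euclideanreal (\<lambda>z. (case z of (t, y) \<Rightarrow> y(k := t)) i)" if "i < Suc k" for i
      using f s[of i] that by (cases "i = k") (auto simp: split_beta)
    show "(case z of (t, y) \<Rightarrow> y(k := t)) i \<in> {0..1}" if "z \<in> topspace ?Z" "i < Suc k" for z i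
      using that cube_coordinate[of "snd z" k i] by (auto simp: split_beta less_Suc_eq)
    show "(case z of (t, y) \<Rightarrow> y(k := t)) \<in> extensional {..<Suc k}" if "z \<in> topspace ?Z" for z
      using that by (auto simp: split_beta topspace_cube extensional_def PiE_def)
  qed
  show "continuous_map (cube (Suc k)) ?Z (\<lambda>x. (x k, restrict x {..<k}))"
  proof (rule continuous_map_pairedI)
    show "continuous_map (cube (Suc k)) (top_of_set {0..1}) (\<lambda>x. x k)"
      using continuous_map_cube_coordinate[of k "Suc k"] cube_coordinate[of _ "Suc k" k]
      by (auto simp: continuous_map_in_subtopology)
    show "continuous_map (cube (Suc k)) (cube k) (\<lambda>x. restrict x {..<k})"
    proof (rule continuous_map_into_cube)
      show "continuous_map (cube (Suc k)) euclideanreal (\<lambda>y. restrict y {..<k} i)" if "i < k" for i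
        using continuous_map_cube_coordinate[of i "Suc k"] that by simp
      show "restrict y {..<k} i \<in> {0..1}" if "y \<in> topspace (cube (Suc k))" "i < k" for y i
        using cube_coordinate[OF that(1), of i] that(2) by simp
    qed simp
  qed
  show "((case z of (t, y) \<Rightarrow> y(k := t)) k, restrict (case z of (t, y) \<Rightarrow> y(k := t)) {..<k}) = z"
    if "z \<in> topspace ?Z" for z
    using that by (auto simp: split_beta topspace_cube fun_eq_iff PiE_def extensional_def)
  show "(case (x k, restrict x {..<k}) of (t, y) \<Rightarrow> y(k := t)) = x" if "x \<in> topspace (cube (Suc k))" for x
    using that by (auto simp: topspace_cube fun_eq_iff PiE_def extensional_def less_Suc_eq)
qed

text \<open>The bound obtained is \<open>2 ^ k\<close>: 1 for a point, doubled by every further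
  coordinate. Only its independence of the cover matters.\<close>

lemma bump_dimension_cube: "\<exists>m. bump_dimension (cube k) m"
proof (induction k)
  case 0
  have "topspace (cube 0) = {\<lambda>_. undefined}" by (simp add: topspace_cube)
  from bump_dimension_singleton[OF this] show ?case by (rule exI)
next
  case (Suc k)
  then obtain m where "bump_dimension (cube k) m" by (rule exE)
  from bump_dimension_homeomorphic[OF bump_dimension_cylinder[OF compact_Hausdorff_cube(1) this]
      cube_Suc_homeomorphic]
  show ?case by (rule exI)
qed

section \<open>Homotopy relative to the boundary as a relation\<close>

definition based_homotopic ::
    "nat \<Rightarrow> 'a topology \<Rightarrow> 'a \<Rightarrow> ((nat \<Rightarrow> real) \<Rightarrow> 'a) \<Rightarrow> ((nat \<Rightarrow> real) \<Rightarrow> 'a) \<Rightarrow> bool"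
  where "based_homotopic k X p f g \<longleftrightarrow>
    homotopic_with (\<lambda>h. \<forall>x\<in>cube_boundary k. h x = p) (cube k) X f g"

lemma homotopy_class_based_homotopic: "homotopy_class k X p f = {g. based_homotopic k X p f g}"
  by (simp add: homotopy_class_def based_homotopic_def)

lemma cube_boundary_subset: "x \<in> cube_boundary k \<Longrightarrow> x \<in> topspace (cube k)"
  by (simp add: cube_boundary_def)

lemma cube_boundaryI: "x \<in> topspace (cube k) \<Longrightarrow> i < k \<Longrightarrow> x i = 0 \<or> x i = 1 \<Longrightarrow> x \<in> cube_boundary k"
  by (auto simp: cube_boundary_def)

lemma based_homotopic_refl: "f \<in> based_maps k X p \<longleftrightarrow> based_homotopic k X p f f"
  by (simp add: based_maps_def based_homotopic_def)

lemma based_homotopic_sym: "based_homotopic k X p f g \<Longrightarrow> based_homotopic k X p g f"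
  unfolding based_homotopic_def by (rule homotopic_with_symD)

lemma based_homotopic_trans:
  "based_homotopic k X p f g \<Longrightarrow> based_homotopic k X p g h \<Longrightarrow> based_homotopic k X p f h"
  unfolding based_homotopic_def by (rule homotopic_with_trans)

lemma based_homotopic_imp_based_maps:
  assumes "based_homotopic k X p f g"
  shows "f \<in> based_maps k X p" "g \<in> based_maps k X p"
  using homotopic_with_imp_continuous_maps[OF assms[unfolded based_homotopic_def]]
    homotopic_with_imp_property[OF assms[unfolded based_homotopic_def]]
  by (auto simp: based_maps_def)

text \<open>Maps are total functions, and identities between concatenated or reparametrised maps
  often hold on the cube only; this turns them into homotopies.\<close>

lemma based_homotopic_eq:
  assumes "f \<in> based_maps k X p" "\<And>x. x \<in> topspace (cube k) \<Longrightarrow> g x = f x"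
  shows "based_homotopic k X p f g"
  unfolding based_homotopic_def
  using assms cube_boundary_subset[of _ k]
  by (intro homotopic_with_equal) (auto simp: based_maps_def)

text \<open>The ends of the homotopy have to be matched on the cube only, because the boundary
  condition does not look at values off the cube.\<close>

lemma based_homotopicI:
  assumes "continuous_map (prod_topology (top_of_set {0..1::real}) (cube k)) X h"
    and "\<And>x. x \<in> topspace (cube k) \<Longrightarrow> h (0, x) = f x"
    and "\<And>x. x \<in> topspace (cube k) \<Longrightarrow> h (1, x) = g x"
    and "\<And>t x. t \<in> {0..1} \<Longrightarrow> x \<in> cube_boundary k \<Longrightarrow> h (t, x) = p"
  shows "based_homotopic k X p f g"
  unfolding based_homotopic_def
proof (subst homotopic_with)
  show "(\<forall>x\<in>cube_boundary k. h x = p) \<longleftrightarrow> (\<forall>x\<in>cube_boundary k. h' x = p)"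
    if "\<And>x. x \<in> topspace (cube k) \<Longrightarrow> h x = h' x" for h h'
    using that cube_boundary_subset by auto
  show "\<exists>h. continuous_map (prod_topology (top_of_set {0..1::real}) (cube k)) X h \<and>
      (\<forall>x\<in>topspace (cube k). h (0, x) = f x) \<and> (\<forall>x\<in>topspace (cube k). h (1, x) = g x) \<and>
      (\<forall>t\<in>{0..1}. \<forall>x\<in>cube_boundary k. h (t, x) = p)"
    by (intro exI[of _ h] conjI ballI assms)
qed

lemma based_homotopic_mono:
  assumes "based_homotopic k X p f g" "continuous_map X Y id"
  shows "based_homotopic k Y p f g"
  using homotopic_with_compose_continuous_map_left[OF assms(1)[unfolded based_homotopic_def] assms(2),
      of "\<lambda>h. \<forall>x\<in>cube_boundary k. h x = p"]
  by (simp add: based_homotopic_def)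

section \<open>Coordinatewise reparametrisation\<close>

definition reparam :: "nat \<Rightarrow> (nat \<Rightarrow> real \<Rightarrow> real) \<Rightarrow> (nat \<Rightarrow> real) \<Rightarrow> nat \<Rightarrow> real"
  where "reparam k \<theta> x = (\<lambda>i\<in>{..<k}. \<theta> i (x i))"

definition unit_reparam :: "(real \<Rightarrow> real) \<Rightarrow> bool"
  where "unit_reparam \<tau> \<longleftrightarrow> continuous_on {0..1} \<tau> \<and> (\<forall>t\<in>{0..1}. \<tau> t \<in> {0..1}) \<and>
    \<tau> 0 \<in> {0, 1} \<and> \<tau> 1 \<in> {0, 1}"

lemma continuous_map_reparam:
  assumes "\<And>i. i < k \<Longrightarrow> unit_reparam (\<theta> i)"
  shows "continuous_map (cube k) (cube k) (reparam k \<theta>)"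
proof (rule continuous_map_into_cube)
  show "continuous_map (cube k) euclideanreal (\<lambda>y. reparam k \<theta> y i)" if "i < k" for i
    using assms[OF that] continuous_map_compose_unit_interval[OF _ continuous_map_cube_coordinate[OF that]]
      cube_coordinate[OF _ that] that
    by (auto simp: reparam_def unit_reparam_def)
  show "reparam k \<theta> y i \<in> {0..1}" if "y \<in> topspace (cube k)" "i < k" for y i
    using assms[OF that(2)] cube_coordinate[OF that] that(2) by (auto simp: reparam_def unit_reparam_def)
qed (simp add: reparam_def)

text \<open>Straight-line homotopy in every coordinate. A coordinate that is 0 or 1 stays at a
  constant end point during it, because the two reparametrisations agree at the ends; hence boundary
  points remain in the boundary.\<close>

lemma reparam_homotopic:
  assumes f: "f \<in> based_maps k X p"
    and \<theta>: "\<And>i. i < k \<Longrightarrow> unit_reparam (\<theta> i)" and \<theta>': "\<And>i. i < k \<Longrightarrow> unit_reparam (\<theta>' i)"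
    and ends: "\<And>i. i < k \<Longrightarrow> \<theta> i 0 = \<theta>' i 0" "\<And>i. i < k \<Longrightarrow> \<theta> i 1 = \<theta>' i 1"
  shows "based_homotopic k X p (\<lambda>x. f (reparam k \<theta> x)) (\<lambda>x. f (reparam k \<theta>' x))"
proof -
  define c where "c z = (\<lambda>i\<in>{..<k}. (1 - fst z) * \<theta> i (snd z i) + fst z * \<theta>' i (snd z i))" for z
  let ?Z = "prod_topology (top_of_set {0..1::real}) (cube k)"
  have fst_c: "continuous_map ?Z euclideanreal fst"
    using continuous_map_fst continuous_map_in_subtopology by blast
  have sndi: "snd z i \<in> {0..1}" if "z \<in> topspace ?Z" "i < k" for z i
    using that cube_coordinate[of "snd z" k i] by auto
  have snd_c: "continuous_map ?Z euclideanreal (\<lambda>z. snd z i)" if "i < k" for i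
    using continuous_map_compose[OF continuous_map_snd continuous_map_cube_coordinate[OF that]]
    by (simp add: o_def)
  have \<theta>_c: "continuous_map ?Z euclideanreal (\<lambda>z. \<tau> (snd z i))" if "i < k" "unit_reparam \<tau>" for i \<tau>
    by (rule continuous_map_compose_unit_interval[OF _ snd_c[OF that(1)] sndi[OF _ that(1)]])
      (use that(2) in \<open>auto simp: unit_reparam_def\<close>)
  have c_in: "c z i \<in> {0..1}" if "z \<in> topspace ?Z" "i < k" for z i
  proof -
    have "\<theta> i (snd z i) \<in> {0..1}" "\<theta>' i (snd z i) \<in> {0..1}" "fst z \<in> {0..1}"
      using \<theta>[OF that(2)] \<theta>'[OF that(2)] sndi[OF that] that(1) by (auto simp: unit_reparam_def)
    then show ?thesis
      using that(2) convex_bound_le[of "\<theta> i (snd z i)" 1 "\<theta>' i (snd z i)" "1 - fst z" "fst z"]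
      by (auto simp: c_def intro!: add_nonneg_nonneg)
  qed
  have c_c: "continuous_map ?Z (cube k) c"
  proof (rule continuous_map_into_cube)
    show "continuous_map ?Z euclideanreal (\<lambda>z. c z i)" if "i < k" for i
      using that unfolding c_def
      by (simp, intro continuous_intros fst_c \<theta>_c[OF that \<theta>[OF that]] \<theta>_c[OF that \<theta>'[OF that]]) simp_all
  qed (use c_in in \<open>auto simp: c_def\<close>)
  have fc: "continuous_map (cube k) X f" using f by (simp add: based_maps_def)
  show ?thesis
  proof (rule based_homotopicI)
    show "continuous_map ?Z X (\<lambda>z. f (c z))"
      using continuous_map_compose[OF c_c fc] by (simp add: o_def)
    show "f (c (0, x)) = f (reparam k \<theta> x)" "f (c (1, x)) = f (reparam k \<theta>' x)" for x
      by (simp_all add: c_def reparam_def)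
    fix t x assume t: "t \<in> {0..1::real}" and x: "x \<in> cube_boundary k"
    then obtain i where i: "i < k" "x i = 0 \<or> x i = 1" by (auto simp: cube_boundary_def)
    have tx: "(t, x) \<in> topspace ?Z" using t cube_boundary_subset[OF x] by simp
    have "c (t, x) i = \<theta> i (x i)"
      using i ends[OF i(1)] by (auto simp: c_def algebra_simps)
    then have "c (t, x) i = 0 \<or> c (t, x) i = 1"
      using i(2) \<theta>[OF i(1)] by (auto simp: unit_reparam_def)
    moreover have "c (t, x) \<in> topspace (cube k)"
      using continuous_map_funspace[OF c_c] tx by blast
    ultimately have "c (t, x) \<in> cube_boundary k" using i(1) by (intro cube_boundaryI)
    then show "f (c (t, x)) = p" using f by (simp add: based_maps_def)
  qed
qed

lemma unit_reparam_id: "unit_reparam (\<lambda>t. t)"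
  by (simp add: unit_reparam_def)

text \<open>Common source of the group laws: in associativity, unit and inverse, the two sides are
  one based map composed with two reparametrisations of coordinate 0 that have equal ends.\<close>

lemma first_coordinate_homotopic:
  assumes f: "f \<in> based_maps k X p" and k: "0 < k" and "unit_reparam \<tau>" "unit_reparam \<tau>'"
    and "\<tau> 0 = \<tau>' 0" "\<tau> 1 = \<tau>' 1"
  shows "based_homotopic k X p (\<lambda>x. f (x(0 := \<tau> (x 0)))) (\<lambda>x. f (x(0 := \<tau>' (x 0))))"
proof -
  define \<theta> where "\<theta> \<tau> i = (if i = 0 then \<tau> else (\<lambda>t. t))" for \<tau> :: "real \<Rightarrow> real" and i :: nat
  have eq: "x(0 := \<tau> (x 0)) = reparam k (\<theta> \<tau>) x" if "x \<in> topspace (cube k)" for \<tau> x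
    using that k by (auto simp: reparam_def \<theta>_def topspace_cube fun_eq_iff PiE_def extensional_def)
  have h: "based_homotopic k X p (\<lambda>x. f (reparam k (\<theta> \<tau>) x)) (\<lambda>x. f (reparam k (\<theta> \<tau>') x))"
    by (rule reparam_homotopic[OF f]) (use assms unit_reparam_id in \<open>auto simp: \<theta>_def\<close>)
  have h1: "based_homotopic k X p (\<lambda>x. f (reparam k (\<theta> \<tau>) x)) (\<lambda>x. f (x(0 := \<tau> (x 0))))"
    by (rule based_homotopic_eq[OF based_homotopic_imp_based_maps(1)[OF h]]) (simp add: eq)
  have h2: "based_homotopic k X p (\<lambda>x. f (reparam k (\<theta> \<tau>') x)) (\<lambda>x. f (x(0 := \<tau>' (x 0))))"
    by (rule based_homotopic_eq[OF based_homotopic_imp_based_maps(2)[OF h]]) (simp add: eq)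
  show ?thesis
    by (rule based_homotopic_trans[OF based_homotopic_sym[OF h1] based_homotopic_trans[OF h h2]])
qed

section \<open>Concatenation and the group laws up to homotopy\<close>

lemma update_cube:
  assumes "x \<in> topspace (cube k)" "0 < k" "t \<in> {0..1}"
  shows "x(0 := t) \<in> topspace (cube k)"
  using assms by (auto simp: topspace_cube PiE_def extensional_def)

lemma based_map_ends:
  assumes "f \<in> based_maps k X p" "x \<in> topspace (cube k)" "0 < k"
  shows "f (x(0 := 0)) = p" "f (x(0 := 1)) = p"
proof -
  have "x(0 := 0) \<in> cube_boundary k" "x(0 := 1) \<in> cube_boundary k"
    using update_cube[OF assms(2,3)] assms(3) by (auto intro!: cube_boundaryI[of _ k 0])
  then show "f (x(0 := 0)) = p" "f (x(0 := 1)) = p" using assms(1) by (auto simp: based_maps_def)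
qed

text \<open>The two homotopies are pasted along \<open>x 0 = 1/2\<close>, where the rescaled points
  lie on opposite faces of the cube and both homotopies take the value \<open>p\<close>.\<close>

lemma concat_homotopic:
  assumes k: "0 < k" and f: "based_homotopic k X p f f'" and g: "based_homotopic k X p g g'"
  shows "based_homotopic k X p (concat_maps f g) (concat_maps f' g')"
proof -
  let ?Z = "prod_topology (top_of_set {0..1::real}) (cube k)"
  obtain h where "continuous_map ?Z X h" "\<forall>x. h (0, x) = f x" "\<forall>x. h (1, x) = f' x"
    "\<forall>t\<in>{0..1}. \<forall>x\<in>cube_boundary k. h (t, x) = p"
    using f unfolding based_homotopic_def homotopic_with_def by (elim exE conjE) (rule that)
  note h = this[rule_format]
  obtain j where "continuous_map ?Z X j" "\<forall>x. j (0, x) = g x" "\<forall>x. j (1, x) = g' x"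
    "\<forall>t\<in>{0..1}. \<forall>x\<in>cube_boundary k. j (t, x) = p"
    using g unfolding based_homotopic_def homotopic_with_def by (elim exE conjE) (rule that)
  note j = this[rule_format]
  define H where "H z = (if snd z 0 \<le> 1/2 then h (fst z, (snd z)(0 := 2 * snd z 0))
      else j (fst z, (snd z)(0 := 2 * snd z 0 - 1)))" for z
  have snd_c: "continuous_map ?Z euclideanreal (\<lambda>z. snd z i)" if "i < k" for i
    using continuous_map_compose[OF continuous_map_snd continuous_map_cube_coordinate[OF that]]
    by (simp add: o_def)
  have sndi: "snd z i \<in> {0..1}" if "z \<in> topspace ?Z" "i < k" for z i
    using that cube_coordinate[of "snd z" k i] by auto
  have upd: "continuous_map (subtopology ?Z S) ?Z (\<lambda>z. (fst z, (snd z)(0 := \<tau> (snd z 0))))"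
    if "continuous_on UNIV \<tau>" "\<And>z. z \<in> topspace ?Z \<Longrightarrow> z \<in> S \<Longrightarrow> \<tau> (snd z 0) \<in> {0..1}"
    for S and \<tau> :: "real \<Rightarrow> real"
  proof (rule continuous_map_pairedI)
    show "continuous_map (subtopology ?Z S) (top_of_set {0..1}) fst"
      by (rule continuous_map_from_subtopology[OF continuous_map_fst])
    show "continuous_map (subtopology ?Z S) (cube k) (\<lambda>z. (snd z)(0 := \<tau> (snd z 0)))"
    proof (rule continuous_map_into_cube)
      fix i assume i: "i < k"
      have "continuous_map euclideanreal euclideanreal \<tau>" using that(1) by simp
      from continuous_map_compose[OF snd_c[OF k] this]
      have "continuous_map ?Z euclideanreal (\<lambda>z. \<tau> (snd z 0))" by (simp add: o_def)
      then have "continuous_map ?Z euclideanreal (\<lambda>z. ((snd z)(0 := \<tau> (snd z 0))) i)"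
        using snd_c[OF i] by (cases "i = 0") auto
      then show "continuous_map (subtopology ?Z S) euclideanreal (\<lambda>z. ((snd z)(0 := \<tau> (snd z 0))) i)"
        by (rule continuous_map_from_subtopology)
      fix z assume "z \<in> topspace (subtopology ?Z S)"
      then have z: "z \<in> topspace ?Z" "z \<in> S" by simp_all
      show "((snd z)(0 := \<tau> (snd z 0))) i \<in> {0..1}"
        using sndi[OF z(1) i] that(2)[OF z] by (cases "i = 0") auto
    next
      fix z assume "z \<in> topspace (subtopology ?Z S)"
      then show "(snd z)(0 := \<tau> (snd z 0)) \<in> extensional {..<k}"
        using k by (auto simp: topspace_cube PiE_def extensional_def)
    qed
  qed
  have "continuous_map ?Z X H"
    unfolding H_def
  proof (rule continuous_map_cases_le)
    show "continuous_map ?Z euclideanreal (\<lambda>z. snd z 0)" by (rule snd_c[OF k])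
    show "continuous_map ?Z euclideanreal (\<lambda>z. 1/2)" by simp
    have "continuous_map (subtopology ?Z {z \<in> topspace ?Z. snd z 0 \<le> 1/2}) ?Z
        (\<lambda>z. (fst z, (snd z)(0 := 2 * snd z 0)))"
    proof (rule upd)
      fix z assume "z \<in> topspace ?Z" "z \<in> {z \<in> topspace ?Z. snd z 0 \<le> 1/2}"
      then show "2 * snd z 0 \<in> {0..1}" using sndi[OF _ k, of z] by simp
    qed (intro continuous_intros)
    from continuous_map_compose[OF this h(1)]
    show "continuous_map (subtopology ?Z {z \<in> topspace ?Z. snd z 0 \<le> 1/2}) X
        (\<lambda>z. h (fst z, (snd z)(0 := 2 * snd z 0)))" by (simp add: o_def)
    have "continuous_map (subtopology ?Z {z \<in> topspace ?Z. 1/2 \<le> snd z 0}) ?Z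
        (\<lambda>z. (fst z, (snd z)(0 := 2 * snd z 0 - 1)))"
    proof (rule upd)
      fix z assume "z \<in> topspace ?Z" "z \<in> {z \<in> topspace ?Z. 1/2 \<le> snd z 0}"
      then show "2 * snd z 0 - 1 \<in> {0..1}" using sndi[OF _ k, of z] by simp
    qed (intro continuous_intros)
    from continuous_map_compose[OF this j(1)]
    show "continuous_map (subtopology ?Z {z \<in> topspace ?Z. 1/2 \<le> snd z 0}) X
        (\<lambda>z. j (fst z, (snd z)(0 := 2 * snd z 0 - 1)))" by (simp add: o_def)
    fix z assume z: "z \<in> topspace ?Z" "snd z 0 = 1/2"
    then have "(snd z)(0 := 2 * snd z 0) \<in> cube_boundary k" "(snd z)(0 := 2 * snd z 0 - 1) \<in> cube_boundary k"
      using k by (auto intro!: cube_boundaryI[of _ k 0] update_cube)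
    then show "h (fst z, (snd z)(0 := 2 * snd z 0)) = j (fst z, (snd z)(0 := 2 * snd z 0 - 1))"
      using h(4) j(4) z(1) by auto
  qed
  then show ?thesis
  proof (rule based_homotopicI)
    show "H (0, x) = concat_maps f g x" "H (1, x) = concat_maps f' g' x" for x
      by (simp_all add: H_def concat_maps_def h j)
    fix t x assume t: "t \<in> {0..1::real}" and x: "x \<in> cube_boundary k"
    then obtain i where i: "i < k" "x i = 0 \<or> x i = 1" by (auto simp: cube_boundary_def)
    have x0: "x 0 \<in> {0..1}" using cube_coordinate[OF cube_boundary_subset[OF x] k] .
    show "H (t, x) = p"
    proof (cases "x 0 \<le> 1/2")
      case True
      then have "x(0 := 2 * x 0) \<in> cube_boundary k"
        using i x0 k cube_boundary_subset[OF x]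
        by (intro cube_boundaryI[of _ k i] update_cube) auto
      then show ?thesis using True h(4)[OF t] by (simp add: H_def)
    next
      case False
      then have "x(0 := 2 * x 0 - 1) \<in> cube_boundary k"
        using i x0 k cube_boundary_subset[OF x]
        by (intro cube_boundaryI[of _ k i] update_cube) auto
      then show ?thesis using False j(4)[OF t] by (simp add: H_def)
    qed
  qed
qed

lemma concat_based_maps:
  "0 < k \<Longrightarrow> f \<in> based_maps k X p \<Longrightarrow> g \<in> based_maps k X p \<Longrightarrow> concat_maps f g \<in> based_maps k X p"
  using concat_homotopic[of k X p f f g g] by (simp add: based_homotopic_refl)

lemma concat_assoc_homotopic:
  assumes k: "0 < k" and "f \<in> based_maps k X p" "g \<in> based_maps k X p" "h \<in> based_maps k X p"
  shows "based_homotopic k X p (concat_maps (concat_maps f g) h) (concat_maps f (concat_maps g h))"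
proof -
  \<comment> \<open>Piecewise linear map taking the breakpoints 1/4 and 1/2 of the left-bracketed
    product to the breakpoints 1/2 and 3/4 of the right-bracketed one.\<close>
  define \<tau> where "\<tau> t = min (2 * t) (min (t + 1/4) (t / 2 + 1/2))" for t :: real
  let ?F = "concat_maps f (concat_maps g h)"
  have F: "?F \<in> based_maps k X p" using assms by (intro concat_based_maps)
  have \<tau>: "unit_reparam \<tau>"
    unfolding unit_reparam_def \<tau>_def by (auto intro!: continuous_intros)
  have h1: "based_homotopic k X p (\<lambda>x. ?F (x(0 := \<tau> (x 0)))) (\<lambda>x. ?F (x(0 := x 0)))"
    by (rule first_coordinate_homotopic[OF F k \<tau> unit_reparam_id]) (simp_all add: \<tau>_def)
  have "concat_maps (concat_maps f g) h x = ?F (x(0 := \<tau> (x 0)))" if "x \<in> topspace (cube k)" for x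
  proof -
    have x: "x 0 \<in> {0..1}" using cube_coordinate[OF that k] .
    consider "x 0 \<le> 1/4" | "1/4 < x 0" "x 0 \<le> 1/2" | "1/2 < x 0" by linarith
    then show ?thesis
    proof cases
      case 1
      then have "\<tau> (x 0) = 2 * x 0" using x by (auto simp: \<tau>_def)
      then show ?thesis using 1 by (simp add: concat_maps_def)
    next
      case 2
      then have "\<tau> (x 0) = x 0 + 1/4" by (auto simp: \<tau>_def)
      then show ?thesis using 2 by (simp add: concat_maps_def)
    next
      case 3
      then have "\<tau> (x 0) = x 0 / 2 + 1/2" by (auto simp: \<tau>_def)
      then show ?thesis using 3 by (simp add: concat_maps_def)
    qed
  qed
  then have "based_homotopic k X p (\<lambda>x. ?F (x(0 := \<tau> (x 0)))) (concat_maps (concat_maps f g) h)"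
    by (intro based_homotopic_eq[OF based_homotopic_imp_based_maps(1)[OF h1]])
  from based_homotopic_trans[OF based_homotopic_sym[OF this] h1] show ?thesis by simp
qed

lemma const_based_map: "p \<in> topspace X \<Longrightarrow> (\<lambda>_. p) \<in> based_maps k X p"
  by (simp add: based_maps_def)

lemma concat_const_left_homotopic:
  assumes k: "0 < k" and f: "f \<in> based_maps k X p"
  shows "based_homotopic k X p (concat_maps (\<lambda>_. p) f) f"
proof -
  \<comment> \<open>It waits at 0, where \<open>f\<close> takes the value \<open>p\<close>, during
    the first half and then runs through \<open>f\<close> at double speed.\<close>
  define \<tau> where "\<tau> t = max 0 (2 * t - 1)" for t :: real
  have \<tau>: "unit_reparam \<tau>"
    unfolding unit_reparam_def \<tau>_def by (auto intro!: continuous_intros)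
  have h1: "based_homotopic k X p (\<lambda>x. f (x(0 := \<tau> (x 0)))) (\<lambda>x. f (x(0 := x 0)))"
    by (rule first_coordinate_homotopic[OF f k \<tau> unit_reparam_id]) (simp_all add: \<tau>_def)
  have "concat_maps (\<lambda>_. p) f x = f (x(0 := \<tau> (x 0)))" if "x \<in> topspace (cube k)" for x
    using based_map_ends[OF f that k] by (auto simp: concat_maps_def \<tau>_def)
  then have "based_homotopic k X p (\<lambda>x. f (x(0 := \<tau> (x 0)))) (concat_maps (\<lambda>_. p) f)"
    by (intro based_homotopic_eq[OF based_homotopic_imp_based_maps(1)[OF h1]])
  from based_homotopic_trans[OF based_homotopic_sym[OF this] h1] show ?thesis by simp
qed

lemma concat_inverse_homotopic:
  assumes k: "0 < k" and f: "f \<in> based_maps k X p"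
  shows "(\<lambda>x. f (x(0 := 1 - x 0))) \<in> based_maps k X p"
    and "based_homotopic k X p (concat_maps (\<lambda>x. f (x(0 := 1 - x 0))) f) (\<lambda>_. p)"
proof -
  have "unit_reparam (\<lambda>t. 1 - t)"
    unfolding unit_reparam_def by (auto intro!: continuous_intros)
  from first_coordinate_homotopic[OF f k this this]
  show "(\<lambda>x. f (x(0 := 1 - x 0))) \<in> based_maps k X p"
    by (simp add: based_homotopic_refl)
  \<comment> \<open>Reversed \<open>f\<close> followed by \<open>f\<close> runs along
    \<open>f\<close> from 1 to 0 and back to 1. With equal ends this path deforms to the constant 1,
    and on that face \<open>f\<close> is \<open>p\<close>.\<close>
  define \<tau> where "\<tau> t = \<bar>2 * t - 1\<bar>" for t :: real
  have \<tau>: "unit_reparam \<tau>" "unit_reparam (\<lambda>_. 1)"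
    unfolding unit_reparam_def \<tau>_def by (auto intro!: continuous_intros)
  have h1: "based_homotopic k X p (\<lambda>x. f (x(0 := \<tau> (x 0)))) (\<lambda>x. f (x(0 := 1)))"
    by (rule first_coordinate_homotopic[OF f k \<tau>]) (simp_all add: \<tau>_def)
  have "concat_maps (\<lambda>x. f (x(0 := 1 - x 0))) f x = f (x(0 := \<tau> (x 0)))" for x
  proof (cases "x 0 \<le> 1/2")
    case True
    then have "\<tau> (x 0) = 1 - 2 * x 0" by (simp add: \<tau>_def)
    then show ?thesis using True by (simp add: concat_maps_def)
  next
    case False
    then have "\<tau> (x 0) = 2 * x 0 - 1" by (simp add: \<tau>_def)
    then show ?thesis using False by (simp add: concat_maps_def)
  qed
  then have h2: "based_homotopic k X p (\<lambda>x. f (x(0 := \<tau> (x 0)))) (concat_maps (\<lambda>x. f (x(0 := 1 - x 0))) f)"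
    by (intro based_homotopic_eq[OF based_homotopic_imp_based_maps(1)[OF h1]])
  have "based_homotopic k X p (\<lambda>x. f (x(0 := 1))) (\<lambda>_. p)"
    by (rule based_homotopic_eq[OF based_homotopic_imp_based_maps(2)[OF h1]])
      (simp add: based_map_ends[OF f _ k])
  from based_homotopic_trans[OF based_homotopic_sym[OF h2] based_homotopic_trans[OF h1 this]]
  show "based_homotopic k X p (concat_maps (\<lambda>x. f (x(0 := 1 - x 0))) f) (\<lambda>_. p)" .
qed

section \<open>Homotopy groups\<close>

lemma homotopy_class_eq:
  assumes "based_homotopic k X p f g"
  shows "homotopy_class k X p f = homotopy_class k X p g"
  unfolding homotopy_class_based_homotopic
  using based_homotopic_trans[OF based_homotopic_sym[OF assms]] based_homotopic_trans[OF assms] by blast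

lemma homotopy_class_eq_iff:
  assumes "f \<in> based_maps k X p"
  shows "homotopy_class k X p f = homotopy_class k X p g \<longleftrightarrow> based_homotopic k X p f g"
proof
  assume "homotopy_class k X p f = homotopy_class k X p g"
  moreover have "f \<in> homotopy_class k X p f"
    using assms by (simp add: homotopy_class_based_homotopic based_homotopic_refl)
  ultimately show "based_homotopic k X p f g"
    by (simp add: homotopy_class_based_homotopic based_homotopic_sym)
qed (rule homotopy_class_eq)

lemma in_own_homotopy_class: "f \<in> based_maps k X p \<Longrightarrow> f \<in> homotopy_class k X p f"
  by (simp add: homotopy_class_based_homotopic based_homotopic_refl)

lemma homotopy_class_mult:
  assumes k: "0 < k" and f: "f \<in> based_maps k X p" and g: "g \<in> based_maps k X p"
  shows "homotopy_class k X p f \<otimes>\<^bsub>homotopy_group k X p\<^esub> homotopy_class k X p g =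
    homotopy_class k X p (concat_maps f g)"
proof -
  have "homotopy_class k X p (concat_maps f' g') = homotopy_class k X p (concat_maps f g)"
    if "f' \<in> homotopy_class k X p f" "g' \<in> homotopy_class k X p g" for f' g'
    by (rule homotopy_class_eq[OF based_homotopic_sym[OF concat_homotopic[OF k]]])
      (use that in \<open>simp_all add: homotopy_class_based_homotopic\<close>)
  then have "(\<Union>f'\<in>homotopy_class k X p f. \<Union>g'\<in>homotopy_class k X p g.
      homotopy_class k X p (concat_maps f' g')) = homotopy_class k X p (concat_maps f g)"
    using in_own_homotopy_class[OF f] in_own_homotopy_class[OF g] by blast
  then show ?thesis by (simp add: homotopy_group_def)
qed

lemma homotopy_group_carrier: "carrier (homotopy_group k X p) = homotopy_class k X p ` based_maps k X p"
  by (simp add: homotopy_group_def)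

lemma homotopy_group_one: "\<one>\<^bsub>homotopy_group k X p\<^esub> = homotopy_class k X p (\<lambda>_. p)"
  by (simp add: homotopy_group_def)

lemma group_homotopy_group:
  assumes k: "0 < k" and p: "p \<in> topspace X"
  shows "group (homotopy_group k X p)"
proof (rule groupI)
  let ?G = "homotopy_group k X p"
  fix x assume "x \<in> carrier ?G"
  then obtain f where f: "f \<in> based_maps k X p" "x = homotopy_class k X p f"
    by (auto simp: homotopy_group_carrier)
  show "\<one>\<^bsub>?G\<^esub> \<otimes>\<^bsub>?G\<^esub> x = x"
    using homotopy_class_mult[OF k const_based_map[OF p] f(1)] f(2)
      homotopy_class_eq[OF concat_const_left_homotopic[OF k f(1)]] by (simp add: homotopy_group_one)
  let ?r = "\<lambda>x. f (x(0 := 1 - x 0))"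
  have "homotopy_class k X p ?r \<otimes>\<^bsub>?G\<^esub> x = \<one>\<^bsub>?G\<^esub>"
    using homotopy_class_mult[OF k concat_inverse_homotopic(1)[OF k f(1)] f(1)] f(2)
      homotopy_class_eq[OF concat_inverse_homotopic(2)[OF k f(1)]] by (simp add: homotopy_group_one)
  then show "\<exists>y\<in>carrier ?G. y \<otimes>\<^bsub>?G\<^esub> x = \<one>\<^bsub>?G\<^esub>"
    using concat_inverse_homotopic(1)[OF k f(1)] by (auto simp: homotopy_group_carrier)
  fix y assume "y \<in> carrier ?G"
  then obtain g where g: "g \<in> based_maps k X p" "y = homotopy_class k X p g"
    by (auto simp: homotopy_group_carrier)
  show "x \<otimes>\<^bsub>?G\<^esub> y \<in> carrier ?G"
    using homotopy_class_mult[OF k f(1) g(1)] concat_based_maps[OF k f(1) g(1)] f(2) g(2)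
    by (simp add: homotopy_group_carrier)
  fix z assume "z \<in> carrier ?G"
  then obtain h where h: "h \<in> based_maps k X p" "z = homotopy_class k X p h"
    by (auto simp: homotopy_group_carrier)
  show "x \<otimes>\<^bsub>?G\<^esub> y \<otimes>\<^bsub>?G\<^esub> z = x \<otimes>\<^bsub>?G\<^esub> (y \<otimes>\<^bsub>?G\<^esub> z)"
    using homotopy_class_eq[OF concat_assoc_homotopic[OF k f(1) g(1) h(1)]]
    by (simp add: f(2) g(2) h(2) homotopy_class_mult[OF k] f(1) g(1) h(1) concat_based_maps[OF k])
next
  show "\<one>\<^bsub>homotopy_group k X p\<^esub> \<in> carrier (homotopy_group k X p)"
    using const_based_map[OF p] by (auto simp: homotopy_group_carrier homotopy_group_one)
qed

lemma based_maps_mono: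
  "f \<in> based_maps k X p \<Longrightarrow> continuous_map X Y id \<Longrightarrow> f \<in> based_maps k Y p"
  unfolding based_homotopic_refl by (rule based_homotopic_mono)

lemma homotopy_map_class:
  assumes XY: "continuous_map X Y id" and f: "f \<in> based_maps k X p"
  shows "homotopy_map k Y p id (homotopy_class k X p f) = homotopy_class k Y p f"
proof -
  have "homotopy_class k Y p (id \<circ> g) = homotopy_class k Y p f" if "g \<in> homotopy_class k X p f" for g
    by (rule homotopy_class_eq[OF based_homotopic_sym[OF based_homotopic_mono[OF _ XY]]])
      (use that in \<open>simp add: homotopy_class_based_homotopic\<close>)
  then show ?thesis
    unfolding homotopy_map_def using in_own_homotopy_class[OF f] by blast
qed

lemma homotopy_map_hom:
  assumes XY: "continuous_map X Y id" and k: "0 < k"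
  shows "homotopy_map k Y p id \<in> hom (homotopy_group k X p) (homotopy_group k Y p)"
proof (rule homI)
  fix x assume "x \<in> carrier (homotopy_group k X p)"
  then obtain f where f: "f \<in> based_maps k X p" "x = homotopy_class k X p f"
    by (auto simp: homotopy_group_carrier)
  show "homotopy_map k Y p id x \<in> carrier (homotopy_group k Y p)"
    using f based_maps_mono[OF f(1) XY] by (simp add: homotopy_map_class[OF XY] homotopy_group_carrier)
  fix y assume "y \<in> carrier (homotopy_group k X p)"
  then obtain g where g: "g \<in> based_maps k X p" "y = homotopy_class k X p g"
    by (auto simp: homotopy_group_carrier)
  show "homotopy_map k Y p id (x \<otimes>\<^bsub>homotopy_group k X p\<^esub> y) =
      homotopy_map k Y p id x \<otimes>\<^bsub>homotopy_group k Y p\<^esub> homotopy_map k Y p id y"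
    by (simp add: f(2) g(2) homotopy_class_mult[OF k] homotopy_map_class[OF XY] f(1) g(1)
        concat_based_maps[OF k] based_maps_mono[OF _ XY])
qed

section \<open>Compression relative to the boundary\<close>

text \<open>Constant 0 up to 1/3 and constant 1 from 2/3 on. After precomposition with it in each
  coordinate, a based map equals \<open>p\<close> not only on the boundary but on the whole of
  \<open>cube_shell\<close>.\<close>

definition collar :: "real \<Rightarrow> real"
  where "collar t = max 0 (min 1 (3 * t - 1))"

text \<open>It vanishes on the boundary and equals 1 outside the shell, so
  \<open>1 - interior_weight k x\<close> can serve as \<open>\<rho>\<close>. For
  \<open>k = 0\<close> the empty product is 1, matching the empty boundary and the empty
  shell.\<close>

definition interior_weight :: "nat \<Rightarrow> (nat \<Rightarrow> real) \<Rightarrow> real"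
  where "interior_weight k x = (\<Prod>i<k. min 1 (3 * x i) * min 1 (3 * (1 - x i)))"

definition cube_shell :: "nat \<Rightarrow> (nat \<Rightarrow> real) set"
  where "cube_shell k = (\<Union>i\<in>{..<k}. {x \<in> topspace (cube k). x i \<in> {..1/3} \<union> {2/3..}})"

lemma unit_reparam_collar: "unit_reparam collar"
  unfolding unit_reparam_def collar_def by (auto intro!: continuous_intros)

lemma weight_factor:
  assumes "t \<in> {0..1::real}"
  shows "min 1 (3 * t) * min 1 (3 * (1 - t)) \<in> {0..1}"
proof -
  have "0 \<le> min 1 (3 * t)" "0 \<le> min 1 (3 * (1 - t))" using assms by auto
  moreover have "min 1 (3 * t) * min 1 (3 * (1 - t)) \<le> 1"
    by (rule mult_le_one) (use assms in auto)
  ultimately show ?thesis by simp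
qed

lemma interior_weight_range:
  assumes "x \<in> topspace (cube k)"
  shows "interior_weight k x \<in> {0..1}"
  using weight_factor[OF cube_coordinate[OF assms]]
  unfolding interior_weight_def by (auto intro!: prod_nonneg prod_le_1)

lemma interior_weight_boundary: "x \<in> cube_boundary k \<Longrightarrow> interior_weight k x = 0"
  unfolding interior_weight_def cube_boundary_def by (force intro!: prod_zero)

lemma interior_weight_shell:
  assumes "x \<in> topspace (cube k)" "interior_weight k x \<noteq> 1"
  shows "x \<in> cube_shell k"
proof (rule ccontr)
  assume "x \<notin> cube_shell k"
  then have lt: "1/3 < x i" "x i < 2/3" if "i < k" for i
    using assms(1) that by (auto simp: cube_shell_def not_le)
  have "min 1 (3 * x i) * min 1 (3 * (1 - x i)) = 1" if "i < k" for i
    using lt[OF that] by (simp add: min_def)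
  then have "interior_weight k x = 1" by (simp add: interior_weight_def)
  then show False using assms(2) by simp
qed

lemma closedin_cube_shell: "closedin (cube k) (cube_shell k)"
proof -
  have "closedin (cube k) {x \<in> topspace (cube k). x i \<in> {..1/3} \<union> {2/3..}}" if "i < k" for i
    by (rule closedin_continuous_map_preimage[OF continuous_map_cube_coordinate[OF that]])
      (simp add: closed_Un)
  then show ?thesis unfolding cube_shell_def by (intro closedin_Union) auto
qed

lemma continuous_map_interior_weight: "continuous_map (cube k) euclideanreal (interior_weight k)"
  unfolding interior_weight_def
  by (intro continuous_intros continuous_map_cube_coordinate) simp_all

lemma collar_shell:
  assumes "x \<in> cube_shell k"
  shows "reparam k (\<lambda>_. collar) x \<in> cube_boundary k"
proof -
  obtain i where i: "i < k" "x \<in> topspace (cube k)" "x i \<le> 1/3 \<or> 2/3 \<le> x i"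
    using assms by (auto simp: cube_shell_def)
  have "continuous_map (cube k) (cube k) (reparam k (\<lambda>_. collar))"
    by (rule continuous_map_reparam) (rule unit_reparam_collar)
  then have "reparam k (\<lambda>_. collar) x \<in> topspace (cube k)"
    using continuous_map_funspace i(2) by blast
  moreover have "reparam k (\<lambda>_. collar) x i = 0 \<or> reparam k (\<lambda>_. collar) x i = 1"
    using i(1,3) by (auto simp: reparam_def collar_def)
  ultimately show ?thesis using i(1) by (intro cube_boundaryI)
qed

lemma collar_homotopic:
  assumes "f \<in> based_maps k X p"
  shows "based_homotopic k X p f (\<lambda>x. f (reparam k (\<lambda>_. collar) x))"
proof -
  have h: "based_homotopic k X p (\<lambda>x. f (reparam k (\<lambda>_ t. t) x)) (\<lambda>x. f (reparam k (\<lambda>_. collar) x))"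
    by (rule reparam_homotopic[OF assms]) (auto simp: unit_reparam_id unit_reparam_collar collar_def)
  have "reparam k (\<lambda>_ t. t) x = x" if "x \<in> topspace (cube k)" for x
    using that by (auto simp: reparam_def topspace_cube fun_eq_iff PiE_def extensional_def)
  then have "based_homotopic k X p f (\<lambda>x. f (reparam k (\<lambda>_ t. t) x))"
    by (intro based_homotopic_eq[OF assms]) simp
  from based_homotopic_trans[OF this h] show ?thesis .
qed

text \<open>The cube of dimension 0 is a single point with empty boundary, so homotopies of maps on
  it are paths. Path components are thereby covered by the compression results for cubes.\<close>

lemma path_component_based_homotopic:
  "path_component_of X x y \<longleftrightarrow> based_homotopic 0 X p (\<lambda>_. x) (\<lambda>_. y)"
proof
  have nb: "cube_boundary 0 = {}" by (simp add: cube_boundary_def)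
  assume "path_component_of X x y"
  then obtain g where g: "continuous_map (top_of_set {0..1::real}) X g" "g 0 = x" "g 1 = y"
    unfolding path_component_of_def pathin_def by (elim exE conjE) (rule that)
  show "based_homotopic 0 X p (\<lambda>_. x) (\<lambda>_. y)"
  proof (rule based_homotopicI)
    show "continuous_map (prod_topology (top_of_set {0..1}) (cube 0)) X (g \<circ> fst)"
      by (rule continuous_map_compose[OF continuous_map_fst g(1)])
  qed (use g nb in auto)
next
  assume "based_homotopic 0 X p (\<lambda>_. x) (\<lambda>_. y)"
  then obtain h where h: "continuous_map (prod_topology (top_of_set {0..1::real}) (cube 0)) X h"
    "\<forall>z. h (0, z) = x" "\<forall>z. h (1, z) = y"
    unfolding based_homotopic_def homotopic_with_def by (elim exE conjE) (rule that)
  have "continuous_map (top_of_set {0..1::real}) (prod_topology (top_of_set {0..1::real}) (cube 0))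
      (\<lambda>t. (t, \<lambda>_. undefined))"
    by (intro continuous_map_pairedI) (simp_all add: topspace_cube)
  from continuous_map_compose[OF this h(1)]
  have "pathin X (\<lambda>t. h (t, \<lambda>_. undefined))" by (simp add: pathin_def o_def)
  then show "path_component_of X x y"
    unfolding path_component_of_def using h(2,3) by (intro exI[of _ "\<lambda>t. h (t, \<lambda>_. undefined)"]) simp
qed

section \<open>Surjectivity and injectivity at the level of based maps\<close>

context directed_spaces
begin

text \<open>Surjectivity. The collared map is constant on the shell and therefore continuous into
  \<open>N a\<close> there as soon as \<open>p\<close> lies in \<open>N a\<close>; this starts the
  compression, which then leaves the boundary alone.\<close>

lemma based_map_from_member:
  assumes adm: "admits_weak_direct_limit_charts TYPE('e) A leq N M"
    and f: "f \<in> based_maps k M p" and a: "a \<in> A" and p: "p \<in> topspace (N a)"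
  shows "\<exists>b\<in>A. leq a b \<and> (\<exists>g\<in>based_maps k (N b) p. based_homotopic k M p f g)"
proof -
  obtain m where m: "bump_dimension (cube k) m" using bump_dimension_cube by (rule exE)
  let ?f = "\<lambda>x. f (reparam k (\<lambda>_. collar) x)" and ?\<rho> = "\<lambda>x. 1 - interior_weight k x"
  have h: "based_homotopic k M p f ?f" by (rule collar_homotopic[OF f])
  then have f': "?f \<in> based_maps k M p" by (rule based_homotopic_imp_based_maps)
  have shell: "?f x = p" if "x \<in> cube_shell k" for x
    using f collar_shell[OF that] by (simp add: based_maps_def)
  have "\<exists>b\<in>A. leq a b \<and> (\<exists>g. homotopic_with (\<lambda>h. \<forall>x\<in>topspace (cube k). ?\<rho> x = 1 \<longrightarrow> h x = ?f x)
      (cube k) M ?f g \<and> continuous_map (cube k) (N b) g)"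
  proof (rule homotopic_into_member[OF adm compact_Hausdorff_cube m _ closedin_cube_shell a])
    show "continuous_map (cube k) M ?f" using f' by (simp add: based_maps_def)
    show "continuous_map (subtopology (cube k) (cube_shell k)) (N a) ?f"
      by (rule continuous_map_eq[of _ _ "\<lambda>_. p"]) (use p shell in auto)
    show "continuous_map (cube k) euclideanreal ?\<rho>"
      by (intro continuous_intros continuous_map_interior_weight) simp
    show "?\<rho> x \<in> {0..1}" if "x \<in> topspace (cube k)" for x
      using interior_weight_range[OF that] by simp
    show "x \<in> cube_shell k" if "x \<in> topspace (cube k)" "?\<rho> x \<noteq> 0" for x
      using interior_weight_shell that by simp
  qed
  then obtain b g where b: "b \<in> A" "leq a b" and gb: "continuous_map (cube k) (N b) g"
    and fg: "homotopic_with (\<lambda>h. \<forall>x\<in>topspace (cube k). ?\<rho> x = 1 \<longrightarrow> h x = ?f x) (cube k) M ?f g"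
    by (elim bexE exE conjE) (rule that)
  have "based_homotopic k M p ?f g"
    unfolding based_homotopic_def
  proof (rule homotopic_with_mono[OF fg], intro ballI)
    fix h x assume "\<forall>x\<in>topspace (cube k). ?\<rho> x = 1 \<longrightarrow> h x = ?f x" and x: "x \<in> cube_boundary k"
    then have "h x = ?f x" using interior_weight_boundary[OF x] cube_boundary_subset[OF x] by simp
    also have "\<dots> = p" using f' x by (simp add: based_maps_def)
    finally show "h x = p" .
  qed
  from based_homotopic_trans[OF h this] have fg': "based_homotopic k M p f g" .
  then have "g \<in> based_maps k M p" by (rule based_homotopic_imp_based_maps)
  then have "g \<in> based_maps k (N b) p" using gb by (simp add: based_maps_def)
  then show ?thesis using b fg' by (intro bexI[of _ b] conjI bexI[of _ g])
qed

text \<open>Injectivity. The homotopy itself is compressed, as a map on a cylinder over the cube.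
  Its ends must be kept as well, so the collar is introduced in the time coordinate too.\<close>

lemma based_homotopy_from_member:
  assumes adm: "admits_weak_direct_limit_charts TYPE('e) A leq N M"
    and f: "f \<in> based_maps k (N a) p" and g: "g \<in> based_maps k (N a) p" and a: "a \<in> A"
    and p: "k = 0 \<or> p \<in> topspace (N a)" and fg: "based_homotopic k M p f g"
  shows "\<exists>b\<in>A. leq a b \<and> based_homotopic k (N b) p f g"
proof -
  let ?I = "top_of_set {0..1::real}"
  let ?Z = "prod_topology ?I (cube k)"
  obtain m where m: "bump_dimension (cube k) m" using bump_dimension_cube by (rule exE)
  obtain h where "continuous_map ?Z M h" "\<forall>x. h (0, x) = f x" "\<forall>x. h (1, x) = g x"
    "\<forall>t\<in>{0..1}. \<forall>x\<in>cube_boundary k. h (t, x) = p"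
    using fg unfolding based_homotopic_def homotopic_with_def by (elim exE conjE) (rule that)
  note h = this[rule_format]
  let ?c = "reparam k (\<lambda>_. collar)"
  have c: "continuous_map (cube k) (cube k) ?c"
    by (rule continuous_map_reparam) (rule unit_reparam_collar)
  have collar01: "collar t \<in> {0..1}" for t by (simp add: collar_def)
  have fst_c: "continuous_map ?Z euclideanreal fst"
    using continuous_map_fst continuous_map_in_subtopology by blast
  \<comment> \<open>On the outer thirds of the time interval \<open>F\<close> is the collared
    \<open>f\<close> or the collared \<open>g\<close>, and above the shell it is \<open>p\<close>.
    All of these are continuous into \<open>N a\<close>.\<close>
  define F where "F z = h (collar (fst z), ?c (snd z))" for z
  have "continuous_map ?Z ?Z (\<lambda>z. (collar (fst z), ?c (snd z)))"
  proof (rule continuous_map_pairedI)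
    have "continuous_map ?Z euclideanreal (\<lambda>z. collar (fst z))"
      unfolding collar_def by (intro continuous_intros fst_c) simp_all
    then show "continuous_map ?Z ?I (\<lambda>z. collar (fst z))"
      using collar01 by (auto simp: continuous_map_in_subtopology)
    show "continuous_map ?Z (cube k) (\<lambda>z. ?c (snd z))"
      using continuous_map_compose[OF continuous_map_snd c] by (simp add: o_def)
  qed
  from continuous_map_compose[OF this h(1)] have F: "continuous_map ?Z M F"
    by (simp add: o_def F_def[abs_def])
  define S0 where "S0 = {z \<in> topspace ?Z. fst z \<in> {..1/3}}"
  define S1 where "S1 = {z \<in> topspace ?Z. fst z \<in> {2/3..}}"
  define S2 where "S2 = {z \<in> topspace ?Z. snd z \<in> cube_shell k}"
  have clo: "closedin ?Z S0" "closedin ?Z S1" "closedin ?Z S2"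
    unfolding S0_def S1_def S2_def
    by (rule closedin_continuous_map_preimage[OF fst_c], simp)+
      (rule closedin_continuous_map_preimage[OF continuous_map_snd closedin_cube_shell])
  have end_c: "continuous_map (subtopology ?Z S) (N a) (\<lambda>z. e (?c (snd z)))"
    if "e \<in> based_maps k (N a) p" for e S
  proof -
    have "continuous_map (cube k) (N a) e" using that by (simp add: based_maps_def)
    from continuous_map_compose[OF continuous_map_snd continuous_map_compose[OF c this]]
    have "continuous_map ?Z (N a) (\<lambda>z. e (?c (snd z)))" by (simp add: o_def)
    then show ?thesis by (rule continuous_map_from_subtopology)
  qed
  have c0: "continuous_map (subtopology ?Z S0) (N a) F"
    by (rule continuous_map_eq[OF end_c[OF f]]) (simp add: S0_def F_def collar_def h)
  have c1: "continuous_map (subtopology ?Z S1) (N a) F"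
    by (rule continuous_map_eq[OF end_c[OF g]]) (simp add: S1_def F_def collar_def h)
  have Fp: "F z = p" if "snd z \<in> cube_shell k" for z
    using h(4)[OF collar01 collar_shell[OF that]] by (simp add: F_def)
  \<comment> \<open>In dimension 0 there is no shell and \<open>p\<close> is only a dummy parameter,
    possibly outside \<open>N a\<close>; in positive dimension \<open>F\<close> is constant
    here.\<close>
  have c2: "continuous_map (subtopology ?Z S2) (N a) F"
  proof (cases "k = 0")
    case True
    then have "S2 = {}" by (simp add: S2_def cube_shell_def)
    then show ?thesis by (simp add: continuous_map_on_empty)
  next
    case False
    then have "p \<in> topspace (N a)" using p by simp
    then show ?thesis
      by (intro continuous_map_eq[of _ _ "\<lambda>_. p" F]) (auto simp: S2_def Fp)
  qed
  \<comment> \<open>The factor of \<open>interior_weight\<close> for the time coordinate. The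
    product with \<open>interior_weight\<close> vanishes on the whole boundary of the cylinder,
    including both ends, and equals 1 off the three closed pieces.\<close>
  define w where "w t = min 1 (3 * t) * min 1 (3 * (1 - t))" for t :: real
  let ?\<rho> = "\<lambda>z. 1 - w (fst z) * interior_weight k (snd z)"
  have "\<exists>b\<in>A. leq a b \<and> (\<exists>G. homotopic_with (\<lambda>h. \<forall>z\<in>topspace ?Z. ?\<rho> z = 1 \<longrightarrow> h z = F z)
      ?Z M F G \<and> continuous_map ?Z (N b) G)"
  proof (rule homotopic_into_member[OF adm _ _ bump_dimension_cylinder[OF compact_Hausdorff_cube(1) m] F
        _ a continuous_map_subtopology_Un[OF closedin_Un[OF clo(1,2)] clo(3)
          continuous_map_subtopology_Un[OF clo(1,2) c0 c1] c2]])
    show "compact_space ?Z" "Hausdorff_space ?Z"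
      using compact_Hausdorff_cube[of k]
      by (auto simp: compact_space_prod_topology Hausdorff_space_prod_topology
          compact_space_subtopology Hausdorff_space_subtopology)
    show "closedin ?Z (S0 \<union> S1 \<union> S2)" by (intro closedin_Un clo)
    have "continuous_map ?Z euclideanreal (\<lambda>z. interior_weight k (snd z))"
      using continuous_map_compose[OF continuous_map_snd continuous_map_interior_weight] by (simp add: o_def)
    then show "continuous_map ?Z euclideanreal ?\<rho>"
      unfolding w_def by (intro continuous_intros fst_c) simp_all
    fix z assume z: "z \<in> topspace ?Z"
    then have fz: "fst z \<in> {0..1}" and sz: "snd z \<in> topspace (cube k)" by auto
    have w01: "w (fst z) \<in> {0..1}" unfolding w_def by (rule weight_factor[OF fz])
    have i01: "interior_weight k (snd z) \<in> {0..1}" by (rule interior_weight_range[OF sz])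
    have "0 \<le> w (fst z) * interior_weight k (snd z)" "w (fst z) * interior_weight k (snd z) \<le> 1"
      using w01 i01 by (auto intro: mult_le_one)
    then show "?\<rho> z \<in> {0..1}" by simp
    assume nz: "?\<rho> z \<noteq> 0"
    show "z \<in> S0 \<union> S1 \<union> S2"
    proof (rule ccontr)
      assume n: "z \<notin> S0 \<union> S1 \<union> S2"
      then have "1/3 < fst z" "fst z < 2/3" using z by (auto simp: S0_def S1_def not_le)
      then have "w (fst z) = 1" by (simp add: w_def)
      moreover have "interior_weight k (snd z) = 1"
        using n z interior_weight_shell[OF sz] by (auto simp: S2_def)
      ultimately show False using nz by simp
    qed
  qed
  then obtain b G where b: "b \<in> A" "leq a b" and Gb: "continuous_map ?Z (N b) G"
    and FG: "homotopic_with (\<lambda>h. \<forall>z\<in>topspace ?Z. ?\<rho> z = 1 \<longrightarrow> h z = F z) ?Z M F G"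
    by (elim bexE exE conjE) (rule that)
  have GF: "G z = F z" if "z \<in> topspace ?Z" "w (fst z) * interior_weight k (snd z) = 0" for z
  proof -
    have "\<forall>z\<in>topspace ?Z. ?\<rho> z = 1 \<longrightarrow> G z = F z"
      using homotopic_with_imp_property[OF FG] by (rule conjunct2)
    from this[rule_format, OF that(1)] that(2) show ?thesis by simp
  qed
  have fg': "based_homotopic k (N b) p (\<lambda>x. f (?c x)) (\<lambda>x. g (?c x))"
  proof (rule based_homotopicI[OF Gb])
    show "G (0, x) = f (?c x)" "G (1, x) = g (?c x)" if "x \<in> topspace (cube k)" for x
      using GF[of "(0, x)"] GF[of "(1, x)"] that by (simp_all add: w_def F_def collar_def h)
    fix t x assume t: "t \<in> {0..1::real}" and x: "x \<in> cube_boundary k"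
    have "G (t, x) = F (t, x)"
      using t cube_boundary_subset[OF x] interior_weight_boundary[OF x] by (intro GF) simp_all
    also have "\<dots> = p"
      using Fp[of "(t, x)"] interior_weight_shell[OF cube_boundary_subset[OF x]]
        interior_weight_boundary[OF x] by simp
    finally show "G (t, x) = p" .
  qed
  have Nab: "continuous_map (N a) (N b) id"
    by (rule continuous_map_step[OF continuous_map_id a b])
  \<comment> \<open>The collar is removed without leaving the members: \<open>f\<close> and
    \<open>g\<close> are based maps into \<open>N a\<close>, so the homotopies to their collared
    versions take place there and can be moved to \<open>N b\<close>.\<close>
  have e: "based_homotopic k (N b) p e (\<lambda>x. e (?c x))" if "e \<in> based_maps k (N a) p" for e
    by (rule based_homotopic_mono[OF collar_homotopic[OF that] Nab])
  have "based_homotopic k (N b) p f g"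
    by (rule based_homotopic_trans[OF e[OF f] based_homotopic_trans[OF fg' based_homotopic_sym[OF e[OF g]]]])
  then show ?thesis using b by (intro bexI[of _ b] conjI)
qed

end

section \<open>Path components\<close>

lemma path_component_set_eq_iff:
  assumes "x \<in> topspace X"
  shows "path_component_of_set X x = path_component_of_set X y \<longleftrightarrow> path_component_of X x y"
proof -
  have "path_component_of_set X x = path_component_of_set X y \<longleftrightarrow>
      path_component_of X x = path_component_of X y"
    by (auto dest: Collect_inj)
  then show ?thesis
    using assms path_component_of_eq[of X x y] path_component_in_topspace[of X x y] by blast
qed

lemma path_components_map_class:
  assumes XY: "continuous_map X Y id" and x: "x \<in> topspace X"
  shows "path_components_map Y id (path_component_of_set X x) = path_component_of_set Y x"
proof -
  have "path_component_of_set Y (id z) = path_component_of_set Y x" if "path_component_of X x z" for z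
  proof -
    have "path_component_of Y x z" using path_component_of_continuous_image[OF XY that] by simp
    then show ?thesis by (simp add: path_component_of_equiv)
  qed
  moreover have "x \<in> path_component_of_set X x" using x by (simp add: path_component_of_refl)
  ultimately show ?thesis unfolding path_components_map_def by blast
qed

text \<open>Path components of a product space are products of path components, and the continuous
  multiplication maps them into single path components.\<close>

lemma path_components_mult:
  assumes G: "topological_group X G" and x: "x \<in> topspace X" and y: "y \<in> topspace X"
  shows "path_component_of_set X x \<otimes>\<^bsub>path_components_group X G\<^esub> path_component_of_set X y =
    path_component_of_set X (x \<otimes>\<^bsub>G\<^esub> y)"
proof -
  have cont: "continuous_map (prod_topology X X) X (\<lambda>(x, y). x \<otimes>\<^bsub>G\<^esub> y)"
    using G by (simp add: topological_group_def)
  have "path_component_of_set X (x' \<otimes>\<^bsub>G\<^esub> y') = path_component_of_set X (x \<otimes>\<^bsub>G\<^esub> y)"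
    if "path_component_of X x x'" "path_component_of X y y'" for x' y'
  proof -
    have "(x', y') \<in> path_component_of_set X x \<times> path_component_of_set X y"
      using that by simp
    then have "path_component_of (prod_topology X X) (x, y) (x', y')"
      unfolding path_component_of_pair[symmetric] by (rule CollectD)
    from path_component_of_continuous_image[OF cont this]
    show ?thesis by (simp add: path_component_of_equiv)
  qed
  moreover have "x \<in> path_component_of_set X x" "y \<in> path_component_of_set X y"
    using x y by (simp_all add: path_component_of_refl)
  ultimately have "(\<Union>x'\<in>path_component_of_set X x. \<Union>y'\<in>path_component_of_set X y.
      path_component_of_set X (x' \<otimes>\<^bsub>G\<^esub> y')) = path_component_of_set X (x \<otimes>\<^bsub>G\<^esub> y)"
    by blast
  then show ?thesis by (simp add: path_components_group_def)
qed

lemma group_path_components_group: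
  assumes XG: "topological_group X G"
  shows "group (path_components_group X G)"
proof -
  interpret G: group G using XG by (simp add: topological_group_def)
  have top: "topspace X = carrier G" using XG by (simp add: topological_group_def)
  note mult = path_components_mult[OF XG, unfolded top]
  have carrier: "carrier (path_components_group X G) = path_component_of_set X ` carrier G"
    by (simp add: path_components_group_def path_components_of_def top)
  have one: "\<one>\<^bsub>path_components_group X G\<^esub> = path_component_of_set X \<one>\<^bsub>G\<^esub>"
    by (simp add: path_components_group_def)
  show ?thesis
  proof (rule groupI)
    fix x assume "x \<in> carrier (path_components_group X G)"
    then obtain x0 where x: "x0 \<in> carrier G" "x = path_component_of_set X x0"
      unfolding carrier by (rule imageE)
    show "\<one>\<^bsub>path_components_group X G\<^esub> \<otimes>\<^bsub>path_components_group X G\<^esub> x = x"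
      using x by (simp add: one mult)
    have "path_component_of_set X (inv\<^bsub>G\<^esub> x0) \<otimes>\<^bsub>path_components_group X G\<^esub> x = \<one>\<^bsub>path_components_group X G\<^esub>"
      using x by (simp add: one mult)
    then show "\<exists>y\<in>carrier (path_components_group X G). y \<otimes>\<^bsub>path_components_group X G\<^esub> x = \<one>\<^bsub>path_components_group X G\<^esub>"
      using x unfolding carrier by (intro bexI[of _ "path_component_of_set X (inv\<^bsub>G\<^esub> x0)"]) simp_all
    fix y assume "y \<in> carrier (path_components_group X G)"
    then obtain y0 where y: "y0 \<in> carrier G" "y = path_component_of_set X y0"
      unfolding carrier by (rule imageE)
    show "x \<otimes>\<^bsub>path_components_group X G\<^esub> y \<in> carrier (path_components_group X G)"
      using x y by (simp add: mult carrier)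
    fix z assume "z \<in> carrier (path_components_group X G)"
    then obtain z0 where z: "z0 \<in> carrier G" "z = path_component_of_set X z0"
      unfolding carrier by (rule imageE)
    show "x \<otimes>\<^bsub>path_components_group X G\<^esub> y \<otimes>\<^bsub>path_components_group X G\<^esub> z =
        x \<otimes>\<^bsub>path_components_group X G\<^esub> (y \<otimes>\<^bsub>path_components_group X G\<^esub> z)"
      using x(1) y(1) z(1) by (simp add: x(2) y(2) z(2) mult G.m_assoc)
  next
    show "\<one>\<^bsub>path_components_group X G\<^esub> \<in> carrier (path_components_group X G)"
      by (simp add: one carrier)
  qed
qed

lemma path_components_map_hom:
  assumes XG: "topological_group X G" and YH: "topological_group Y H"
    and XY: "continuous_map X Y id" and hom: "id \<in> hom G H"
  shows "path_components_map Y id \<in> hom (path_components_group X G) (path_components_group Y H)"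
proof (rule homI)
  have top: "topspace X = carrier G" "topspace Y = carrier H"
    using XG YH by (simp_all add: topological_group_def)
  interpret G: group G using XG by (simp add: topological_group_def)
  have GH: "x \<in> carrier H" if "x \<in> carrier G" for x using hom that by (auto simp: hom_def Pi_iff)
  have carrier: "carrier (path_components_group X G) = path_component_of_set X ` carrier G"
    "carrier (path_components_group Y H) = path_component_of_set Y ` carrier H"
    by (simp_all add: path_components_group_def path_components_of_def top)
  note cls = path_components_map_class[OF XY, unfolded top]
  fix x assume "x \<in> carrier (path_components_group X G)"
  then obtain x0 where x: "x0 \<in> carrier G" "x = path_component_of_set X x0"
    unfolding carrier by (rule imageE)
  show "path_components_map Y id x \<in> carrier (path_components_group Y H)"
    using x GH by (simp add: cls carrier)
  fix y assume "y \<in> carrier (path_components_group X G)"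
  then obtain y0 where y: "y0 \<in> carrier G" "y = path_component_of_set X y0"
    unfolding carrier by (rule imageE)
  have eq: "x0 \<otimes>\<^bsub>G\<^esub> y0 = x0 \<otimes>\<^bsub>H\<^esub> y0" using hom_mult[OF hom x(1) y(1)] by simp
  have "path_components_map Y id (path_component_of_set X (x0 \<otimes>\<^bsub>G\<^esub> y0)) =
      path_component_of_set Y (x0 \<otimes>\<^bsub>H\<^esub> y0)"
    unfolding eq[symmetric] by (rule cls[OF G.m_closed[OF x(1) y(1)]])
  then show "path_components_map Y id (x \<otimes>\<^bsub>path_components_group X G\<^esub> y) =
      path_components_map Y id x \<otimes>\<^bsub>path_components_group Y H\<^esub> path_components_map Y id y"
    unfolding x(2) y(2) cls[OF x(1)] cls[OF y(1)]
      path_components_mult[OF XG, unfolded top, OF x(1) y(1)]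
      path_components_mult[OF YH, unfolded top, OF GH[OF x(1)] GH[OF y(1)]] .
qed

section \<open>Direct limits\<close>

text \<open>The factorisation is defined by choosing representatives. Two representatives of one
  element are moved to a common index, where \<open>inj\<close> makes them equal at a still later
  index; any cocone hence gives them the same value. The existence statement is separate because the
  group case starts from it.\<close>

lemma direct_limit_of_sets_factor:
  assumes sys: "direct_system_of_sets I leq S b" and coc: "cocone_of_sets I leq S b L u"
    and surj: "\<And>y. y \<in> L \<Longrightarrow> \<exists>i\<in>I. \<exists>x\<in>S i. y = u i x"
    and inj: "\<And>i x y. i \<in> I \<Longrightarrow> x \<in> S i \<Longrightarrow> y \<in> S i \<Longrightarrow> u i x = u i y \<Longrightarrow>
      \<exists>j\<in>I. leq i j \<and> b i j x = b i j y"
    and T: "cocone_of_sets I leq S b T g"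
  shows "\<exists>h. h \<in> L \<rightarrow>\<^sub>E T \<and> (\<forall>i\<in>I. \<forall>x\<in>S i. h (u i x) = g i x)"
proof -
  note dir = sys[unfolded direct_system_of_sets_def, THEN conjunct1]
    and b = sys[unfolded direct_system_of_sets_def, THEN conjunct2, THEN conjunct1]
  have bS: "b i j x \<in> S j" if "i \<in> I" "j \<in> I" "leq i j" "x \<in> S i" for i j x
    using b[rule_format, OF that(1-3)] that(4) by (rule funcset_mem)
  have u: "u j (b i j x) = u i x" if "i \<in> I" "j \<in> I" "leq i j" "x \<in> S i" for i j x
  proof -
    have "\<forall>i\<in>I. \<forall>j\<in>I. leq i j \<longrightarrow> (\<forall>x\<in>S i. u j (b i j x) = u i x)"
      using coc unfolding cocone_of_sets_def by (elim conjE)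
    from this[rule_format, OF that] show ?thesis .
  qed
  have g: "g j (b i j x) = g i x" if "i \<in> I" "j \<in> I" "leq i j" "x \<in> S i" for i j x
  proof -
    have "\<forall>i\<in>I. \<forall>j\<in>I. leq i j \<longrightarrow> (\<forall>x\<in>S i. g j (b i j x) = g i x)"
      using T unfolding cocone_of_sets_def by (elim conjE)
    from this[rule_format, OF that] show ?thesis .
  qed
  have gT: "g i x \<in> T" if "i \<in> I" "x \<in> S i" for i x
  proof -
    have "\<forall>i\<in>I. g i \<in> S i \<rightarrow> T" using T unfolding cocone_of_sets_def by (elim conjE)
    then show ?thesis using that by auto
  qed
  have well: "g i x = g j y" if i: "i \<in> I" "x \<in> S i" and j: "j \<in> I" "y \<in> S j" and eq: "u i x = u j y" for i j x y
  proof -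
    obtain k where k: "k \<in> I" "leq i k" "leq j k"
      using directed_set_upper[OF dir i(1) j(1)] by (elim bexE conjE) (rule that)
    have "u k (b i k x) = u k (b j k y)"
      using u[OF i(1) k(1,2) i(2)] u[OF j(1) k(1,3) j(2)] eq by simp
    from inj[OF k(1) bS[OF i(1) k(1,2) i(2)] bS[OF j(1) k(1,3) j(2)] this]
    obtain l where l: "l \<in> I" "leq k l" "b k l (b i k x) = b k l (b j k y)"
      by (elim bexE conjE) (rule that)
    have "g i x = g l (b k l (b i k x))"
      using g[OF i(1) k(1,2) i(2)] g[OF k(1) l(1,2) bS[OF i(1) k(1,2) i(2)]] by simp
    also have "\<dots> = g j y"
      using g[OF j(1) k(1,3) j(2)] g[OF k(1) l(1,2) bS[OF j(1) k(1,3) j(2)]] l(3) by simp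
    finally show ?thesis .
  qed
  have "\<forall>y\<in>L. \<exists>q. fst q \<in> I \<and> snd q \<in> S (fst q) \<and> y = u (fst q) (snd q)"
  proof
    fix y assume "y \<in> L"
    from surj[OF this] obtain i x where "i \<in> I" "x \<in> S i" "y = u i x" by (elim bexE) (rule that)
    then show "\<exists>q. fst q \<in> I \<and> snd q \<in> S (fst q) \<and> y = u (fst q) (snd q)"
      by (intro exI[of _ "(i, x)"]) simp
  qed
  from bchoice[OF this] obtain q where
    q: "\<forall>y\<in>L. fst (q y) \<in> I \<and> snd (q y) \<in> S (fst (q y)) \<and> y = u (fst (q y)) (snd (q y))" by (rule exE)
  define h where "h = (\<lambda>y\<in>L. g (fst (q y)) (snd (q y)))"
  have uL: "u i x \<in> L" if "i \<in> I" "x \<in> S i" for i x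
  proof -
    have "\<forall>i\<in>I. u i \<in> S i \<rightarrow> L" using coc unfolding cocone_of_sets_def by (elim conjE)
    then show ?thesis using that by auto
  qed
  have "h (u i x) = g i x" if "i \<in> I" "x \<in> S i" for i x
    using well[of "fst (q (u i x))" "snd (q (u i x))" i x] q[rule_format, OF uL[OF that]] uL[OF that] that
    by (simp add: h_def)
  moreover have "h \<in> L \<rightarrow>\<^sub>E T"
    using gT q by (auto simp: h_def)
  ultimately show ?thesis by (intro exI[of _ h]) blast
qed

lemma direct_limit_of_setsI:
  assumes sys: "direct_system_of_sets I leq S b" and coc: "cocone_of_sets I leq S b L u"
    and surj: "\<And>y. y \<in> L \<Longrightarrow> \<exists>i\<in>I. \<exists>x\<in>S i. y = u i x"
    and inj: "\<And>i x y. i \<in> I \<Longrightarrow> x \<in> S i \<Longrightarrow> y \<in> S i \<Longrightarrow> u i x = u i y \<Longrightarrow>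
      \<exists>j\<in>I. leq i j \<and> b i j x = b i j y"
  shows "direct_limit_of_sets TYPE('t) I leq S b L u"
  unfolding direct_limit_of_sets_def
proof (intro conjI allI impI sys coc)
  fix T :: "'t set" and g assume T: "cocone_of_sets I leq S b T g"
  have "\<exists>h. h \<in> L \<rightarrow>\<^sub>E T \<and> (\<forall>i\<in>I. \<forall>x\<in>S i. h (u i x) = g i x)"
    by (rule direct_limit_of_sets_factor[OF sys coc _ _ T]) (erule surj, erule inj)
  then obtain h where h: "h \<in> L \<rightarrow>\<^sub>E T" "\<forall>i\<in>I. \<forall>x\<in>S i. h (u i x) = g i x"
    by (elim exE conjE) (rule that)
  show "\<exists>!h. h \<in> L \<rightarrow>\<^sub>E T \<and> (\<forall>i\<in>I. \<forall>x\<in>S i. h (u i x) = g i x)"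
  proof (rule ex1I[of _ h])
    show "h \<in> L \<rightarrow>\<^sub>E T \<and> (\<forall>i\<in>I. \<forall>x\<in>S i. h (u i x) = g i x)" using h by (rule conjI)
    fix h' assume h': "h' \<in> L \<rightarrow>\<^sub>E T \<and> (\<forall>i\<in>I. \<forall>x\<in>S i. h' (u i x) = g i x)"
    show "h' = h"
    proof (rule PiE_ext)
      show "h' \<in> L \<rightarrow>\<^sub>E T" using h' by (rule conjunct1)
      show "h \<in> L \<rightarrow>\<^sub>E T" by (rule h(1))
      fix y assume "y \<in> L"
      from surj[OF this] obtain i x where "i \<in> I" "x \<in> S i" "y = u i x" by (elim bexE) (rule that)
      then show "h' y = h y" using h(2) conjunct2[OF h'] by simp
    qed
  qed
qed

text \<open>The factorisation through the underlying sets is already multiplicative: two elements of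
  \<open>L\<close> have representatives at a common index \<open>k\<close>, and there
  \<open>u k\<close> and \<open>g k\<close> are homomorphisms.\<close>

lemma direct_limit_of_groupsI:
  assumes sys: "direct_system_of_groups I leq S b" and coc: "cocone_of_groups I leq S b L u"
    and surj: "\<And>y. y \<in> carrier L \<Longrightarrow> \<exists>i\<in>I. \<exists>x\<in>carrier (S i). y = u i x"
    and inj: "\<And>i x y. i \<in> I \<Longrightarrow> x \<in> carrier (S i) \<Longrightarrow> y \<in> carrier (S i) \<Longrightarrow> u i x = u i y \<Longrightarrow>
      \<exists>j\<in>I. leq i j \<and> b i j x = b i j y"
  shows "direct_limit_of_groups TYPE('t) I leq S b L u"
  unfolding direct_limit_of_groups_def
proof (intro conjI allI impI sys coc)
  fix T :: "'t monoid" and g assume T: "cocone_of_groups I leq S b T g"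
  note sys' = sys[unfolded direct_system_of_groups_def, THEN conjunct1]
    and grp = sys[unfolded direct_system_of_groups_def, THEN conjunct2, THEN conjunct1]
    and bhom = sys[unfolded direct_system_of_groups_def, THEN conjunct2, THEN conjunct2]
    and uhom = coc[unfolded cocone_of_groups_def, THEN conjunct2, THEN conjunct1]
    and coc' = coc[unfolded cocone_of_groups_def, THEN conjunct2, THEN conjunct2]
    and ghom = T[unfolded cocone_of_groups_def, THEN conjunct2, THEN conjunct1]
    and T' = T[unfolded cocone_of_groups_def, THEN conjunct2, THEN conjunct2]
  have dir: "directed_set I leq"
    using sys' unfolding direct_system_of_sets_def by (elim conjE)
  have u: "u j (b i j x) = u i x" if "i \<in> I" "j \<in> I" "leq i j" "x \<in> carrier (S i)" for i j x
  proof -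
    have "\<forall>i\<in>I. \<forall>j\<in>I. leq i j \<longrightarrow> (\<forall>x\<in>carrier (S i). u j (b i j x) = u i x)"
      using coc' unfolding cocone_of_sets_def by (elim conjE)
    from this[rule_format, OF that] show ?thesis .
  qed
  have "\<exists>h. h \<in> carrier L \<rightarrow>\<^sub>E carrier T \<and> (\<forall>i\<in>I. \<forall>x\<in>carrier (S i). h (u i x) = g i x)"
    by (rule direct_limit_of_sets_factor[OF sys' coc' _ _ T']) (erule surj, erule inj)
  then obtain h where h: "h \<in> carrier L \<rightarrow>\<^sub>E carrier T" "\<forall>i\<in>I. \<forall>x\<in>carrier (S i). h (u i x) = g i x"
    by (elim exE conjE) (rule that)
  have hom: "h \<in> hom L T"
  proof (rule homI)
    show "h x \<in> carrier T" if "x \<in> carrier L" for x using h(1) that by (rule PiE_mem)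
    fix x y assume x: "x \<in> carrier L" and y: "y \<in> carrier L"
    from surj[OF x] obtain i x' where i: "i \<in> I" "x' \<in> carrier (S i)" "x = u i x'" by (elim bexE) (rule that)
    from surj[OF y] obtain j y' where j: "j \<in> I" "y' \<in> carrier (S j)" "y = u j y'" by (elim bexE) (rule that)
    obtain k where k: "k \<in> I" "leq i k" "leq j k"
      using directed_set_upper[OF dir i(1) j(1)] by (elim bexE conjE) (rule that)
    define x'' y'' where "x'' = b i k x'" and "y'' = b j k y'"
    have mem: "x'' \<in> carrier (S k)" "y'' \<in> carrier (S k)"
      using bhom[rule_format, OF i(1) k(1,2)] bhom[rule_format, OF j(1) k(1,3)] i(2) j(2)
      by (auto simp: x''_def y''_def hom_def Pi_iff)
    have xy: "x = u k x''" "y = u k y''"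
      using u[OF i(1) k(1,2) i(2)] u[OF j(1) k(1,3) j(2)] i(3) j(3) by (simp_all add: x''_def y''_def)
    interpret Sk: group "S k" using grp k(1) by blast
    have "h (x \<otimes>\<^bsub>L\<^esub> y) = h (u k (x'' \<otimes>\<^bsub>S k\<^esub> y''))"
      using hom_mult[OF uhom[rule_format, OF k(1)] mem] xy by simp
    also have "\<dots> = g k (x'' \<otimes>\<^bsub>S k\<^esub> y'')"
      using h(2) k(1) Sk.m_closed[OF mem] by blast
    also have "\<dots> = g k x'' \<otimes>\<^bsub>T\<^esub> g k y''"
      by (rule hom_mult[OF ghom[rule_format, OF k(1)] mem])
    also have "\<dots> = h x \<otimes>\<^bsub>T\<^esub> h y"
      using h(2) k(1) mem xy by simp
    finally show "h (x \<otimes>\<^bsub>L\<^esub> y) = h x \<otimes>\<^bsub>T\<^esub> h y" .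
  qed
  show "\<exists>!h. h \<in> hom L T \<and> h \<in> extensional (carrier L) \<and> (\<forall>i\<in>I. \<forall>x\<in>carrier (S i). h (u i x) = g i x)"
  proof (rule ex1I[of _ h])
    show "h \<in> hom L T \<and> h \<in> extensional (carrier L) \<and> (\<forall>i\<in>I. \<forall>x\<in>carrier (S i). h (u i x) = g i x)"
      using hom h by (auto simp: PiE_def)
    fix h' assume h': "h' \<in> hom L T \<and> h' \<in> extensional (carrier L) \<and>
      (\<forall>i\<in>I. \<forall>x\<in>carrier (S i). h' (u i x) = g i x)"
    show "h' = h"
    proof (rule PiE_ext)
      show "h' \<in> carrier L \<rightarrow>\<^sub>E carrier T" using h' by (auto simp: PiE_def hom_def)
      show "h \<in> carrier L \<rightarrow>\<^sub>E carrier T" by (rule h(1))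
      fix y assume "y \<in> carrier L"
      from surj[OF this] obtain i x where "i \<in> I" "x \<in> carrier (S i)" "y = u i x" by (elim bexE) (rule that)
      then show "h' y = h y" using h(2) h' by simp
    qed
  qed
qed

section \<open>Direct limits of homotopy groups and of path components\<close>

context directed_spaces
begin

abbreviation "members_at p \<equiv> {a \<in> A. p \<in> topspace (N a)}"

lemma inclusion: "a \<in> A \<Longrightarrow> b \<in> A \<Longrightarrow> leq a b \<Longrightarrow> continuous_map (N a) (N b) id"
  by (rule continuous_map_step[OF continuous_map_id])

lemma limit_inclusion: "a \<in> A \<Longrightarrow> continuous_map (N a) M id"
  by (rule continuous_map_limit[OF continuous_map_id])

lemma member_exists:
  assumes "p \<in> topspace M"
  shows "\<exists>a\<in>A. p \<in> topspace (N a)"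
proof -
  have "topspace M = (\<Union>a\<in>A. topspace (N a))"
    using directed_union unfolding directed_union_def by (elim conjE)
  then show ?thesis using assms by blast
qed

lemma member_mono: "a \<in> members_at p \<Longrightarrow> b \<in> A \<Longrightarrow> leq a b \<Longrightarrow> b \<in> members_at p"
  using topspace_mono[of a b] by blast

lemma directed_members_at:
  assumes "p \<in> topspace M"
  shows "directed_set (members_at p) leq"
  unfolding directed_set_def
proof (intro conjI ballI impI)
  show "members_at p \<noteq> {}" using member_exists[OF assms] by blast
  show "leq a a" if "a \<in> members_at p" for a using leq_refl that by blast
  show "leq a c" if "a \<in> members_at p" "b \<in> members_at p" "c \<in> members_at p" "leq a b" "leq b c" for a b c
    by (rule leq_trans[OF _ _ _ that(4,5)]) (use that(1-3) in simp_all)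
  fix a b assume a: "a \<in> members_at p" and b: "b \<in> members_at p"
  then have "\<exists>c\<in>A. leq a c \<and> leq b c" by (intro upper_bound) simp_all
  then obtain c where c: "c \<in> A" "leq a c" "leq b c" by (elim bexE conjE) (rule that)
  then show "\<exists>c\<in>members_at p. leq a c \<and> leq b c"
    using member_mono[OF a c(1,2)] by (intro bexI[of _ c] conjI)
qed

lemma homotopy_group_limit:
  assumes adm: "admits_weak_direct_limit_charts TYPE('e) A leq N M"
    and p: "p \<in> topspace M" and k: "0 < k"
  shows "direct_limit_of_groups TYPE('t) (members_at p) leq
    (\<lambda>a. homotopy_group k (N a) p) (\<lambda>a b. homotopy_map k (N b) p id)
    (homotopy_group k M p) (\<lambda>a. homotopy_map k M p id)"
proof (rule direct_limit_of_groupsI)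
  have maps: "homotopy_map k (N b) p id \<in> hom (homotopy_group k (N a) p) (homotopy_group k (N b) p)"
    if "a \<in> A" "b \<in> A" "leq a b" for a b
    by (rule homotopy_map_hom[OF inclusion[OF that] k])
  have maps_M: "homotopy_map k M p id \<in> hom (homotopy_group k (N a) p) (homotopy_group k M p)"
    if "a \<in> A" for a
    by (rule homotopy_map_hom[OF limit_inclusion[OF that] k])
  show "direct_system_of_groups (members_at p) leq (\<lambda>a. homotopy_group k (N a) p) (\<lambda>a b. homotopy_map k (N b) p id)"
    unfolding direct_system_of_groups_def direct_system_of_sets_def
  proof (intro conjI ballI impI directed_members_at p)
    fix a b assume "a \<in> members_at p" "b \<in> members_at p" "leq a b"
    then show "homotopy_map k (N b) p id \<in> hom (homotopy_group k (N a) p) (homotopy_group k (N b) p)"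
      by (intro maps) simp_all
    then show "homotopy_map k (N b) p id \<in> carrier (homotopy_group k (N a) p) \<rightarrow> carrier (homotopy_group k (N b) p)"
      by (simp add: hom_def)
  next
    fix a x assume "x \<in> carrier (homotopy_group k (N a) p)"
    then obtain f where "x = homotopy_class k (N a) p f" "f \<in> based_maps k (N a) p"
      unfolding homotopy_group_carrier by (rule imageE)
    then show "homotopy_map k (N a) p id x = x" by (simp add: homotopy_map_class)
  next
    fix a b c x assume abc: "a \<in> members_at p" "b \<in> members_at p" "c \<in> members_at p" "leq a b" "leq b c"
      and "x \<in> carrier (homotopy_group k (N a) p)"
    then obtain f where f: "x = homotopy_class k (N a) p f" "f \<in> based_maps k (N a) p"
      unfolding homotopy_group_carrier by (blast elim: imageE)
    have ab: "continuous_map (N a) (N b) id" and bc: "continuous_map (N b) (N c) id"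
      using abc by (simp_all add: inclusion)
    have ac: "continuous_map (N a) (N c) id"
      using continuous_map_compose[OF ab bc] by simp
    show "homotopy_map k (N c) p id (homotopy_map k (N b) p id x) = homotopy_map k (N c) p id x"
      using f by (simp add: homotopy_map_class[OF ab] homotopy_map_class[OF bc] homotopy_map_class[OF ac]
          based_maps_mono[OF _ ab])
  next
    fix a assume "a \<in> members_at p"
    then show "group (homotopy_group k (N a) p)" by (intro group_homotopy_group k) simp
  qed
  show "cocone_of_groups (members_at p) leq (\<lambda>a. homotopy_group k (N a) p) (\<lambda>a b. homotopy_map k (N b) p id)
      (homotopy_group k M p) (\<lambda>a. homotopy_map k M p id)"
    unfolding cocone_of_groups_def cocone_of_sets_def
  proof (intro conjI ballI impI)
    show "group (homotopy_group k M p)" by (rule group_homotopy_group[OF k p])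
    fix a assume a: "a \<in> members_at p"
    then show hom: "homotopy_map k M p id \<in> hom (homotopy_group k (N a) p) (homotopy_group k M p)"
      by (intro maps_M) simp
    then show "homotopy_map k M p id \<in> carrier (homotopy_group k (N a) p) \<rightarrow> carrier (homotopy_group k M p)"
      by (simp add: hom_def)
    fix b x assume b: "b \<in> members_at p" "leq a b" and "x \<in> carrier (homotopy_group k (N a) p)"
    then obtain f where f: "x = homotopy_class k (N a) p f" "f \<in> based_maps k (N a) p"
      unfolding homotopy_group_carrier by (blast elim: imageE)
    have ab: "continuous_map (N a) (N b) id" and aM: "continuous_map (N a) M id" and bM: "continuous_map (N b) M id"
      using a b by (simp_all add: inclusion limit_inclusion)
    show "homotopy_map k M p id (homotopy_map k (N b) p id x) = homotopy_map k M p id x"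
      using f by (simp add: homotopy_map_class[OF ab] homotopy_map_class[OF aM] homotopy_map_class[OF bM]
          based_maps_mono[OF _ ab])
  qed
  show "\<exists>a\<in>members_at p. \<exists>x\<in>carrier (homotopy_group k (N a) p). y = homotopy_map k M p id x"
    if "y \<in> carrier (homotopy_group k M p)" for y
  proof -
    obtain f where f: "y = homotopy_class k M p f" "f \<in> based_maps k M p"
      using \<open>y \<in> _\<close> unfolding homotopy_group_carrier by (rule imageE)
    obtain a where a: "a \<in> A" "p \<in> topspace (N a)" using member_exists[OF p] by (rule bexE)
    obtain b g where b: "b \<in> A" "leq a b" and g: "g \<in> based_maps k (N b) p" "based_homotopic k M p f g"
      using based_map_from_member[OF adm f(2) a] by (elim bexE conjE) (rule that)
    have "y = homotopy_map k M p id (homotopy_class k (N b) p g)"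
      using homotopy_class_eq[OF g(2)] homotopy_map_class[OF limit_inclusion[OF b(1)] g(1)] f(1) by simp
    moreover have "homotopy_class k (N b) p g \<in> carrier (homotopy_group k (N b) p)"
      unfolding homotopy_group_carrier using g(1) by (rule imageI)
    moreover have "b \<in> members_at p" using a member_mono[OF _ b] by simp
    ultimately show ?thesis by blast
  qed
  fix a x y assume a: "a \<in> members_at p" and x: "x \<in> carrier (homotopy_group k (N a) p)"
    and y: "y \<in> carrier (homotopy_group k (N a) p)"
    and eq: "homotopy_map k M p id x = homotopy_map k M p id y"
  obtain f where f: "x = homotopy_class k (N a) p f" "f \<in> based_maps k (N a) p"
    using x unfolding homotopy_group_carrier by (rule imageE)
  obtain g where g: "y = homotopy_class k (N a) p g" "g \<in> based_maps k (N a) p"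
    using y unfolding homotopy_group_carrier by (rule imageE)
  have aA: "a \<in> A" "p \<in> topspace (N a)" using a by simp_all
  note aM = limit_inclusion[OF aA(1)]
  have "homotopy_class k M p f = homotopy_class k M p g"
    using eq by (simp add: f g homotopy_map_class[OF aM])
  then have "based_homotopic k M p f g"
    by (simp add: homotopy_class_eq_iff[OF based_maps_mono[OF f(2) aM]])
  from based_homotopy_from_member[OF adm f(2) g(2) aA(1) disjI2[OF aA(2)] this]
  obtain b where b: "b \<in> A" "leq a b" "based_homotopic k (N b) p f g"
    by (elim bexE conjE) (rule that)
  note ab = inclusion[OF aA(1) b(1,2)]
  have "homotopy_map k (N b) p id x = homotopy_map k (N b) p id y"
    using homotopy_class_eq[OF b(3)] by (simp add: f g homotopy_map_class[OF ab])
  then show "\<exists>b\<in>members_at p. leq a b \<and> homotopy_map k (N b) p id x = homotopy_map k (N b) p id y"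
    using b(2) member_mono[OF a b(1,2)] by (intro bexI[of _ b] conjI)
qed

lemma path_components_system:
  assumes p: "p \<in> topspace M"
  shows "direct_system_of_sets (members_at p) leq
      (\<lambda>a. path_components_of (N a)) (\<lambda>a b. path_components_map (N b) id)" (is ?sys)
    and "cocone_of_sets (members_at p) leq
      (\<lambda>a. path_components_of (N a)) (\<lambda>a b. path_components_map (N b) id)
      (path_components_of M) (\<lambda>a. path_components_map M id)" (is ?coc)
proof -
  have in_top: "x \<in> topspace Y" if "continuous_map X Y id" "x \<in> topspace X" for X Y and x :: 'a
    using continuous_map_funspace[OF that(1)] that(2) by auto
  have map: "path_components_map Y id \<in> path_components_of X \<rightarrow> path_components_of Y"
    if XY: "continuous_map X Y id" for X Y :: "'a topology"
  proof
    fix c assume "c \<in> path_components_of X"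
    then obtain x where x: "c = path_component_of_set X x" "x \<in> topspace X"
      unfolding path_components_of_def by (rule imageE)
    show "path_components_map Y id c \<in> path_components_of Y"
      unfolding path_components_of_def x(1) path_components_map_class[OF XY x(2)]
      by (rule imageI[OF in_top[OF XY x(2)]])
  qed
  have comp: "path_components_map Z id (path_components_map Y id c) = path_components_map Z id c"
    if XY: "continuous_map X Y id" and YZ: "continuous_map Y Z id" and c: "c \<in> path_components_of X"
    for X Y Z :: "'a topology" and c
  proof -
    obtain x where x: "c = path_component_of_set X x" "x \<in> topspace X"
      using c unfolding path_components_of_def by (rule imageE)
    have XZ: "continuous_map X Z id" using continuous_map_compose[OF XY YZ] by simp
    show ?thesis
      unfolding x(1) path_components_map_class[OF XY x(2)] path_components_map_class[OF XZ x(2)]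
      by (rule path_components_map_class[OF YZ in_top[OF XY x(2)]])
  qed
  show ?sys
    unfolding direct_system_of_sets_def
  proof (intro conjI ballI impI directed_members_at p)
    show "path_components_map (N b) id \<in> path_components_of (N a) \<rightarrow> path_components_of (N b)"
      if "a \<in> members_at p" "b \<in> members_at p" "leq a b" for a b
      by (rule map[OF inclusion]) (use that in simp_all)
    show "path_components_map (N a) id c = c" if c: "c \<in> path_components_of (N a)" for a c
    proof -
      obtain x where x: "c = path_component_of_set (N a) x" "x \<in> topspace (N a)"
        using c unfolding path_components_of_def by (rule imageE)
      show ?thesis unfolding x(1) by (rule path_components_map_class[OF continuous_map_id x(2)])
    qed
    show "path_components_map (N c) id (path_components_map (N b) id x) = path_components_map (N c) id x"
      if "a \<in> members_at p" "b \<in> members_at p" "c \<in> members_at p" "leq a b" "leq b c"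
        "x \<in> path_components_of (N a)" for a b c x
      by (rule comp[OF inclusion inclusion that(6)]) (use that in simp_all)
  qed
  show ?coc
    unfolding cocone_of_sets_def
  proof (intro conjI ballI impI)
    show "path_components_map M id \<in> path_components_of (N a) \<rightarrow> path_components_of M"
      if "a \<in> members_at p" for a
      by (rule map[OF limit_inclusion]) (use that in simp)
    show "path_components_map M id (path_components_map (N b) id x) = path_components_map M id x"
      if "a \<in> members_at p" "b \<in> members_at p" "leq a b" "x \<in> path_components_of (N a)" for a b x
      by (rule comp[OF inclusion limit_inclusion that(4)]) (use that in simp_all)
  qed
qed

lemma path_components_surj:
  assumes p: "p \<in> topspace M" and c: "c \<in> path_components_of M"
  shows "\<exists>a\<in>members_at p. \<exists>d\<in>path_components_of (N a). c = path_components_map M id d"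
proof -
  obtain x where x: "c = path_component_of_set M x" "x \<in> topspace M"
    using c unfolding path_components_of_def by (rule imageE)
  obtain a where a: "a \<in> A" "p \<in> topspace (N a)" using member_exists[OF p] by (rule bexE)
  \<comment> \<open>A member containing \<open>x\<close> need not contain \<open>p\<close>; an upper
    bound of \<open>a\<close> and \<open>a'\<close> contains both.\<close>
  obtain a' where a': "a' \<in> A" "x \<in> topspace (N a')" using member_exists[OF x(2)] by (rule bexE)
  obtain b where b: "b \<in> A" "leq a b" "leq a' b"
    using upper_bound[OF a(1) a'(1)] by (elim bexE conjE) (rule that)
  have xb: "x \<in> topspace (N b)" by (rule subsetD[OF topspace_mono[OF a'(1) b(1,3)] a'(2)])
  have "c = path_components_map M id (path_component_of_set (N b) x)"
    unfolding x(1) by (rule path_components_map_class[OF limit_inclusion[OF b(1)] xb, symmetric])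
  moreover have "path_component_of_set (N b) x \<in> path_components_of (N b)"
    unfolding path_components_of_def using xb by (rule imageI)
  moreover have "b \<in> members_at p" using a member_mono[OF _ b(1,2)] by simp
  ultimately show ?thesis by blast
qed

text \<open>Points are regarded as based maps on the cube of dimension 0, so a path in
  \<open>M\<close> between them is a homotopy to which the compression applies.\<close>

lemma path_components_inj:
  assumes adm: "admits_weak_direct_limit_charts TYPE('e) A leq N M" and a: "a \<in> members_at p"
    and c: "c \<in> path_components_of (N a)" and d: "d \<in> path_components_of (N a)"
    and eq: "path_components_map M id c = path_components_map M id d"
  shows "\<exists>b\<in>members_at p. leq a b \<and> path_components_map (N b) id c = path_components_map (N b) id d"
proof -
  obtain x where x: "c = path_component_of_set (N a) x" "x \<in> topspace (N a)"
    using c unfolding path_components_of_def by (rule imageE)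
  obtain y where y: "d = path_component_of_set (N a) y" "y \<in> topspace (N a)"
    using d unfolding path_components_of_def by (rule imageE)
  have aA: "a \<in> A" using a by simp
  note aM = limit_inclusion[OF aA]
  have xM: "x \<in> topspace M" using continuous_map_funspace[OF aM] x(2) by auto
  have "path_component_of_set M x = path_component_of_set M y"
    using eq unfolding x(1) y(1) path_components_map_class[OF aM x(2)] path_components_map_class[OF aM y(2)] .
  then have "path_component_of M x y" unfolding path_component_set_eq_iff[OF xM] .
  then have xy: "based_homotopic 0 M p (\<lambda>_. x) (\<lambda>_. y)"
    unfolding path_component_based_homotopic[where p = p] .
  have "(\<lambda>_. x) \<in> based_maps 0 (N a) p" "(\<lambda>_. y) \<in> based_maps 0 (N a) p"
    using x(2) y(2) by (simp_all add: based_maps_def cube_boundary_def)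
  from based_homotopy_from_member[OF adm this aA disjI1[OF refl] xy]
  obtain b where b: "b \<in> A" "leq a b" "based_homotopic 0 (N b) p (\<lambda>_. x) (\<lambda>_. y)"
    by (elim bexE conjE) (rule that)
  note ab = inclusion[OF aA b(1,2)]
  have xb: "x \<in> topspace (N b)" using continuous_map_funspace[OF ab] x(2) by auto
  have "path_component_of (N b) x y"
    using b(3) unfolding path_component_based_homotopic[where p = p] .
  then have "path_component_of_set (N b) x = path_component_of_set (N b) y"
    unfolding path_component_set_eq_iff[OF xb] .
  then have "path_components_map (N b) id c = path_components_map (N b) id d"
    unfolding x(1) y(1) path_components_map_class[OF ab x(2)] path_components_map_class[OF ab y(2)] .
  then show ?thesis using b(2) member_mono[OF a b(1,2)] by (intro bexI[of _ b] conjI)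
qed

lemma path_components_limit:
  assumes adm: "admits_weak_direct_limit_charts TYPE('e) A leq N M" and p: "p \<in> topspace M"
  shows "direct_limit_of_sets TYPE('t) (members_at p) leq
    (\<lambda>a. path_components_of (N a)) (\<lambda>a b. path_components_map (N b) id)
    (path_components_of M) (\<lambda>a. path_components_map M id)"
  by (rule direct_limit_of_setsI[OF path_components_system[OF p]])
    (erule path_components_surj[OF p], erule path_components_inj[OF adm])

text \<open>Carriers and maps are those of the set-valued case, so the system, the cocone,
  surjectivity and injectivity carry over; what is added is that the objects are groups and the maps
  homomorphisms.\<close>

lemma path_components_group_limit:
  assumes adm: "admits_weak_direct_limit_charts TYPE('e) A leq N M" and p: "p \<in> topspace M"
    and G: "topological_group M G" and H: "\<And>a. a \<in> A \<Longrightarrow> topological_group (N a) (H a)"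
    and HG: "\<And>a. a \<in> A \<Longrightarrow> id \<in> hom (H a) G"
    and HH: "\<And>a b. a \<in> A \<Longrightarrow> b \<in> A \<Longrightarrow> leq a b \<Longrightarrow> id \<in> hom (H a) (H b)"
  shows "direct_limit_of_groups TYPE('t) (members_at p) leq
    (\<lambda>a. path_components_group (N a) (H a)) (\<lambda>a b. path_components_map (N b) id)
    (path_components_group M G) (\<lambda>a. path_components_map M id)"
proof -
  have carrier: "carrier (path_components_group X K) = path_components_of X" for X :: "'a topology" and K
    by (simp add: path_components_group_def)
  show ?thesis
  proof (rule direct_limit_of_groupsI, unfold carrier)
    show "direct_system_of_groups (members_at p) leq
        (\<lambda>a. path_components_group (N a) (H a)) (\<lambda>a b. path_components_map (N b) id)"
      unfolding direct_system_of_groups_def carrier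
    proof (intro conjI ballI impI path_components_system(1)[OF p])
      show "group (path_components_group (N a) (H a))" if "a \<in> members_at p" for a
        by (rule group_path_components_group[OF H]) (use that in simp)
      show "path_components_map (N b) id \<in> hom (path_components_group (N a) (H a)) (path_components_group (N b) (H b))"
        if "a \<in> members_at p" "b \<in> members_at p" "leq a b" for a b
        by (rule path_components_map_hom[OF H H inclusion HH]) (use that in simp_all)
    qed
    show "cocone_of_groups (members_at p) leq
        (\<lambda>a. path_components_group (N a) (H a)) (\<lambda>a b. path_components_map (N b) id)
        (path_components_group M G) (\<lambda>a. path_components_map M id)"
      unfolding cocone_of_groups_def carrier
    proof (intro conjI ballI path_components_system(2)[OF p])
      show "group (path_components_group M G)" by (rule group_path_components_group[OF G])
      show "path_components_map M id \<in> hom (path_components_group (N a) (H a)) (path_components_group M G)"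
        if "a \<in> members_at p" for a
        by (rule path_components_map_hom[OF H G limit_inclusion HG]) (use that in simp_all)
    qed
    show "\<exists>a\<in>members_at p. \<exists>d\<in>path_components_of (N a). c = path_components_map M id d"
      if "c \<in> path_components_of M" for c
      by (rule path_components_surj[OF p that])
    show "\<exists>b\<in>members_at p. leq a b \<and> path_components_map (N b) id c = path_components_map (N b) id d"
      if "a \<in> members_at p" "c \<in> path_components_of (N a)" "d \<in> path_components_of (N a)"
        "path_components_map M id c = path_components_map M id d" for a c d
      by (rule path_components_inj[OF adm that])
  qed
qed

end

theorem theorem1p2:
  fixes M :: "'a topology" and N :: "'i \<Rightarrow> 'a topology"
    and A :: "'i set" and leq :: "'i \<Rightarrow> 'i \<Rightarrow> bool" and p :: 'a
  assumes "manifold TYPE('e) M"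
    and "\<forall>a\<in>A. manifold TYPE('e) (N a)"
    and "directed_union A leq N M"
    and "admits_weak_direct_limit_charts TYPE('e) A leq N M"
    and "p \<in> topspace M"
  shows "(\<forall>k\<ge>1. direct_limit_of_groups TYPE('t) {a\<in>A. p \<in> topspace (N a)} leq
            (\<lambda>a. homotopy_group k (N a) p) (\<lambda>a b. homotopy_map k (N b) p id)
            (homotopy_group k M p) (\<lambda>a. homotopy_map k M p id)) \<and>
         direct_limit_of_sets TYPE('t) {a\<in>A. p \<in> topspace (N a)} leq
            (\<lambda>a. path_components_of (N a)) (\<lambda>a b. path_components_map (N b) id)
            (path_components_of M) (\<lambda>a. path_components_map M id) \<and>
         (\<forall>(G :: 'a monoid) (H :: 'i \<Rightarrow> 'a monoid).
            topological_group M G \<and> (\<forall>a\<in>A. topological_group (N a) (H a)) \<and>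
            (\<forall>a\<in>A. id \<in> hom (H a) G) \<and>
            (\<forall>a\<in>A. \<forall>b\<in>A. leq a b \<longrightarrow> id \<in> hom (H a) (H b)) \<and>
            p = \<one>\<^bsub>G\<^esub> \<longrightarrow>
            direct_limit_of_groups TYPE('t) {a\<in>A. p \<in> topspace (N a)} leq
              (\<lambda>a. path_components_group (N a) (H a)) (\<lambda>a b. path_components_map (N b) id)
              (path_components_group M G) (\<lambda>a. path_components_map M id))"
proof -
  interpret directed_spaces A leq N M by unfold_locales (rule assms(3))
  show ?thesis
  proof (intro conjI allI impI, goal_cases)
    case (1 k)
    then show ?case by (intro homotopy_group_limit[OF assms(4,5)]) simp
  next
    case 2
    show ?case by (rule path_components_limit[OF assms(4,5)])
  next
    case (3 G H)
    then show ?case by (elim conjE) (rule path_components_group_limit[OF assms(4,5)]; simp)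
  qed
qed

end
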